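(* Put $$J=\frac1{2\pi}\int_0^{2\pi}\sqrt{1+\tfrac12\cos t}\,dt,\qquad c_*:=\frac{\sqrt2}{J}=1.4381696565\ldots .$$ Let $V$ be a subset of a discrete group $\Gamma$. If $A_1(V)<c_*$, then $Z_2(V)\le 2$. More generally, if there is a constant $K<c_*$ such that $$\|(C_m)_{m=1}^r\|_{S_1^2(\ell_2)}\le K\left\|\sum_{m=1}^r C_m\otimes\lambda_{g_m}\right\|_1$$ for every $1\le r\le 6$, every pairwise distinct $g_1,\ldots,g_r\in V$, and every $C_1,\ldots,C_r\in M_2(\mathbb C)$, then $Z_2(V)\le2$.
   Context: $\lambda_g$ ($g\in\Gamma$) are the canonical unitaries of the left regular representation on $\ell_2(\Gamma)$, $\mathcal L(\Gamma)$ is the group von Neumann algebra they generate, and $\tau$ is its canonical tracial state, $\tau(\lambda_g)=\delta_{g,e}$. $\operatorname{tr}$ is the usual unnormalized trace on $M_d(\mathbb C)$, and for $F\in M_d(\mathbb C)\overline\otimes\mathcal L(\Gamma)$, $\|F\|_1=(\operatorname{tr}\otimes\tau)(|F|)$. For a finite family $(C_k)$ in $M_d(\mathbb C)$, $$\|(C_k)\|_{S_1^d(\ell_2)}=\inf\left\{\operatorname{tr}\Big(\sum_kX_k^*X_k\Big)^{1/2}+\operatorname{tr}\Big(\sum_kY_kY_k^*\Big)^{1/2}: C_k=X_k+Y_k,\ X_k,Y_k\in M_d(\mathbb C)\right\}.$$ $A_1(V)\in[0,\infty]$ is the least constant $A$ such that $\|(C_g)_{g\in V}\|_{S_1^d(\ell_2)}\le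 A\left\|\sum_{g\in V}C_g\otimes\lambda_g\right\|_1$ for all $d\ge1$ and all finitely supported families $(C_g)_{g\in V}\subset M_d(\mathbb C)$. $Z_2^c(V)=\sup_{g\ne e}\#\{(x,y)\in V^2:x^{-1}y=g\}$ (ordered pairs), $Z_2^r(V)=Z_2^c(V^{-1})$ where $V^{-1}=\{x^{-1}:x\in V\}$, and $Z_2(V)=\max\{Z_2^c(V),Z_2^r(V)\}$. *)

theory Defs
  imports
    "HOL-Analysis.Analysis"
    "HOL-Algebra.Group"
    "HOL-Library.Extended_Nat"
    "HOL-Library.Extended_Nonnegative_Real"
    "Jordan_Normal_Form.Schur_Decomposition"
begin

section \<open>Bounded operators on \<open>\<ell>\<^sub>2(I)\<close>\<close>

text \<open>
  Vectors of \<open>\<ell>\<^sub>2(I)\<close> are functions on the whole index type that vanish outside \<open>I\<close>.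
  The order on the complex numbers is that of \<open>HOL-Library.Complex_Order\<close>, so \<open>0 \<le> z\<close>
  means that \<open>z\<close> is real and nonnegative.
\<close>

definition ell2 :: "'i set \<Rightarrow> ('i \<Rightarrow> complex) set" where
  "ell2 I = {\<xi>. (\<forall>i. i \<notin> I \<longrightarrow> \<xi> i = 0) \<and> (\<lambda>i. (cmod (\<xi> i))\<^sup>2) summable_on I}"

definition ell2_inner :: "'i set \<Rightarrow> ('i \<Rightarrow> complex) \<Rightarrow> ('i \<Rightarrow> complex) \<Rightarrow> complex" where
  "ell2_inner I \<xi> \<eta> = (\<Sum>\<^sub>\<infinity>i\<in>I. \<xi> i * cnj (\<eta> i))"

definition ell2_norm :: "'i set \<Rightarrow> ('i \<Rightarrow> complex) \<Rightarrow> real" where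
  "ell2_norm I \<xi> = sqrt (\<Sum>\<^sub>\<infinity>i\<in>I. (cmod (\<xi> i))\<^sup>2)"

definition bounded_op :: "'i set \<Rightarrow> (('i \<Rightarrow> complex) \<Rightarrow> ('i \<Rightarrow> complex)) \<Rightarrow> bool" where
  "bounded_op I T \<longleftrightarrow>
     (\<forall>\<xi>\<in>ell2 I. T \<xi> \<in> ell2 I) \<and>
     (\<forall>\<xi>\<in>ell2 I. \<forall>\<eta>\<in>ell2 I. T (\<lambda>i. \<xi> i + \<eta> i) = (\<lambda>i. T \<xi> i + T \<eta> i)) \<and>
     (\<forall>c. \<forall>\<xi>\<in>ell2 I. T (\<lambda>i. c * \<xi> i) = (\<lambda>i. c * T \<xi> i)) \<and>
     (\<exists>K. \<forall>\<xi>\<in>ell2 I. ell2_norm I (T \<xi>) \<le> K * ell2_norm I \<xi>)"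

definition positive_op :: "'i set \<Rightarrow> (('i \<Rightarrow> complex) \<Rightarrow> ('i \<Rightarrow> complex)) \<Rightarrow> bool" where
  "positive_op I T \<longleftrightarrow> bounded_op I T \<and> (\<forall>\<xi>\<in>ell2 I. 0 \<le> ell2_inner I (T \<xi>) \<xi>)"

text \<open>
  Only the values of an operator on \<^term>\<open>ell2 I\<close> matter; restricting to extensional
  functions makes the operators described below unique as HOL functions.
\<close>

definition adjoint_op ::
  "'i set \<Rightarrow> (('i \<Rightarrow> complex) \<Rightarrow> ('i \<Rightarrow> complex)) \<Rightarrow> (('i \<Rightarrow> complex) \<Rightarrow> ('i \<Rightarrow> complex))" where
  "adjoint_op I T = (THE S. S \<in> extensional (ell2 I) \<and> bounded_op I S \<and>
     (\<forall>\<xi>\<in>ell2 I. \<forall>\<eta>\<in>ell2 I. ell2_inner I (T \<xi>) \<eta> = ell2_inner I \<xi> (S \<eta>)))"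

definition sqrt_op ::
  "'i set \<Rightarrow> (('i \<Rightarrow> complex) \<Rightarrow> ('i \<Rightarrow> complex)) \<Rightarrow> (('i \<Rightarrow> complex) \<Rightarrow> ('i \<Rightarrow> complex))" where
  "sqrt_op I T = (THE S. S \<in> extensional (ell2 I) \<and> positive_op I S \<and>
     (\<forall>\<xi>\<in>ell2 I. S (S \<xi>) = T \<xi>))"

definition abs_op ::
  "'i set \<Rightarrow> (('i \<Rightarrow> complex) \<Rightarrow> ('i \<Rightarrow> complex)) \<Rightarrow> (('i \<Rightarrow> complex) \<Rightarrow> ('i \<Rightarrow> complex))" where
  "abs_op I T = sqrt_op I (\<lambda>\<xi>. adjoint_op I T (T \<xi>))"


section \<open>The regular representation and the norm of \<open>L\<^sub>1(tr \<otimes> \<tau>)\<close>\<close>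

definition left_regular ::
  "('a, 'b) monoid_scheme \<Rightarrow> 'a \<Rightarrow> ('a \<Rightarrow> complex) \<Rightarrow> ('a \<Rightarrow> complex)" where
  "left_regular G g \<xi> = (\<lambda>x. if x \<in> carrier G then \<xi> (inv\<^bsub>G\<^esub> g \<otimes>\<^bsub>G\<^esub> x) else 0)"

text \<open>
  The Hilbert space \<open>\<complex>\<^sup>d \<otimes> \<ell>\<^sub>2(\<Gamma>)\<close> is realised as \<open>\<ell>\<^sub>2({0,\<dots>,d-1} \<times> \<Gamma>)\<close>; for \<open>C \<in> M\<^sub>d(\<complex>)\<close>
  and an operator \<open>T\<close> on \<open>\<ell>\<^sub>2(\<Gamma>)\<close>, \<open>mat_tensor d C T\<close> is \<open>C \<otimes> T\<close>.
\<close>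

abbreviation tensor_index :: "('a, 'b) monoid_scheme \<Rightarrow> nat \<Rightarrow> (nat \<times> 'a) set" where
  "tensor_index G d \<equiv> {..<d} \<times> carrier G"

definition mat_tensor ::
  "nat \<Rightarrow> complex mat \<Rightarrow> (('a \<Rightarrow> complex) \<Rightarrow> ('a \<Rightarrow> complex)) \<Rightarrow>
   (nat \<times> 'a \<Rightarrow> complex) \<Rightarrow> (nat \<times> 'a \<Rightarrow> complex)" where
  "mat_tensor d C T \<xi> =
     (\<lambda>(i, x). if i < d then \<Sum>j<d. C $$ (i, j) * T (\<lambda>y. \<xi> (j, y)) x else 0)"

text \<open>\<open>\<Sum>\<^bsub>m\<in>S\<^esub> C\<^sub>m \<otimes> \<lambda>\<^bsub>g m\<^esub>\<close>\<close>

definition lambda_sum ::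
  "('a, 'b) monoid_scheme \<Rightarrow> nat \<Rightarrow> 'm set \<Rightarrow> ('m \<Rightarrow> complex mat) \<Rightarrow> ('m \<Rightarrow> 'a) \<Rightarrow>
   (nat \<times> 'a \<Rightarrow> complex) \<Rightarrow> (nat \<times> 'a \<Rightarrow> complex)" where
  "lambda_sum G d S C g \<xi> = (\<lambda>k. \<Sum>m\<in>S. mat_tensor d (C m) (left_regular G (g m)) \<xi> k)"

definition mat_trace :: "complex mat \<Rightarrow> complex" where
  "mat_trace A = (\<Sum>i<dim_row A. A $$ (i, i))"

text \<open>
  The canonical trace of the group von Neumann algebra is the vector state
  \<open>\<tau>(T) = \<langle>T \<delta>\<^sub>e, \<delta>\<^sub>e\<rangle>\<close>; hence \<open>(tr \<otimes> \<tau>)(T) = \<Sum>\<^bsub>i<d\<^esub> \<langle>T (e\<^sub>i \<otimes> \<delta>\<^sub>e), e\<^sub>i \<otimes> \<delta>\<^sub>e\<rangle>\<close>.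
\<close>

definition tr_tau ::
  "('a, 'b) monoid_scheme \<Rightarrow> nat \<Rightarrow>
   ((nat \<times> 'a \<Rightarrow> complex) \<Rightarrow> (nat \<times> 'a \<Rightarrow> complex)) \<Rightarrow> complex" where
  "tr_tau G d T = (\<Sum>i<d.
     let \<delta> = (\<lambda>k. if k = (i, \<one>\<^bsub>G\<^esub>) then 1 else 0)
     in ell2_inner (tensor_index G d) (T \<delta>) \<delta>)"

text \<open>\<open>(tr \<otimes> \<tau>)(C \<otimes> \<lambda>\<^sub>g) = tr(C) \<delta>\<^bsub>g,e\<^esub>\<close>\<close>

lemma tr_tau_mat_tensor:
  assumes "Group.group G" and g: "g \<in> carrier G" and C: "C \<in> carrier_mat d d"
  shows "tr_tau G d (mat_tensor d C (left_regular G g)) = (if g = \<one>\<^bsub>G\<^esub> then mat_trace C else 0)"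
proof -
  interpret Group.group G by fact
  let ?\<delta> = "\<lambda>i k. if k = (i, \<one>\<^bsub>G\<^esub>) then 1 else 0 :: complex"
  have inv1: "inv\<^bsub>G\<^esub> g = \<one>\<^bsub>G\<^esub> \<longleftrightarrow> g = \<one>\<^bsub>G\<^esub>"
    using g by simp
  have "ell2_inner (tensor_index G d) (mat_tensor d C (left_regular G g) (?\<delta> i)) (?\<delta> i) =
      (if g = \<one>\<^bsub>G\<^esub> then C $$ (i, i) else 0)" if i: "i < d" for i
  proof -
    have "ell2_inner (tensor_index G d) (mat_tensor d C (left_regular G g) (?\<delta> i)) (?\<delta> i) =
        (\<Sum>\<^sub>\<infinity>k\<in>{(i, \<one>\<^bsub>G\<^esub>)}. mat_tensor d C (left_regular G g) (?\<delta> i) k * cnj (?\<delta> i k))"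
      unfolding ell2_inner_def by (rule infsum_cong_neutral) (use i in auto)
    also have "\<dots> = mat_tensor d C (left_regular G g) (?\<delta> i) (i, \<one>\<^bsub>G\<^esub>)"
      by simp
    also have "\<dots> = (\<Sum>j<d. if j = i then (if g = \<one>\<^bsub>G\<^esub> then C $$ (i, i) else 0) else 0)"
      using i g inv1 unfolding mat_tensor_def left_regular_def
      by (cases "g = \<one>\<^bsub>G\<^esub>") (auto simp: if_distrib[of "(*) _"] cong: if_cong)
    also have "\<dots> = (if g = \<one>\<^bsub>G\<^esub> then C $$ (i, i) else 0)"
      using i by simp
    finally show ?thesis .
  qed
  then show ?thesis
    using C unfolding tr_tau_def mat_trace_def Let_def by simp
qed

definition L1_norm ::
  "('a, 'b) monoid_scheme \<Rightarrow> nat \<Rightarrow>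
   ((nat \<times> 'a \<Rightarrow> complex) \<Rightarrow> (nat \<times> 'a \<Rightarrow> complex)) \<Rightarrow> real" where
  "L1_norm G d F = Re (tr_tau G d (abs_op (tensor_index G d) F))"


section \<open>The norm of \<open>S\<^sub>1\<^sup>d(\<ell>\<^sub>2)\<close>\<close>

text \<open>Matrices of varying dimension form no additive monoid, so finite sums are taken entrywise.\<close>

definition mat_sum :: "nat \<Rightarrow> 'm set \<Rightarrow> ('m \<Rightarrow> complex mat) \<Rightarrow> complex mat" where
  "mat_sum d S X = Matrix.mat d d (\<lambda>ij. \<Sum>m\<in>S. X m $$ ij)"

definition positive_mat :: "nat \<Rightarrow> complex mat \<Rightarrow> bool" where
  "positive_mat d A \<longleftrightarrow>
     A \<in> carrier_mat d d \<and> (\<forall>v\<in>carrier_vec d. 0 \<le> (A *\<^sub>v v) \<bullet>c v)"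

definition sqrt_mat :: "nat \<Rightarrow> complex mat \<Rightarrow> complex mat" where
  "sqrt_mat d A = (THE B. positive_mat d B \<and> B * B = A)"

definition S1_norm :: "nat \<Rightarrow> 'm set \<Rightarrow> ('m \<Rightarrow> complex mat) \<Rightarrow> real" where
  "S1_norm d S C = Inf
     {Re (mat_trace (sqrt_mat d (mat_sum d S (\<lambda>k. mat_adjoint (X k) * X k)))) +
      Re (mat_trace (sqrt_mat d (mat_sum d S (\<lambda>k. Y k * mat_adjoint (Y k))))) | X Y.
      \<forall>k\<in>S. X k \<in> carrier_mat d d \<and> Y k \<in> carrier_mat d d \<and> C k = X k + Y k}"


section \<open>The constants \<open>A\<^sub>1(V)\<close>, \<open>Z\<^sub>2(V)\<close> and \<open>c\<^sub>*\<close>\<close>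

text \<open>
  A finitely supported family on \<open>V\<close> is given by a finite \<open>S \<subseteq> V\<close> containing its support;
  the infimum of the empty set is \<open>\<infinity>\<close>.
\<close>

definition A1 :: "('a, 'b) monoid_scheme \<Rightarrow> 'a set \<Rightarrow> ennreal" where
  "A1 G V = Inf {ennreal A | A. 0 \<le> A \<and>
     (\<forall>d\<ge>1. \<forall>S C. finite S \<and> S \<subseteq> V \<and> (\<forall>g\<in>S. C g \<in> carrier_mat d d) \<longrightarrow>
        S1_norm d S C \<le> A * L1_norm G d (lambda_sum G d S C (\<lambda>g. g)))}"

definition ecard :: "'x set \<Rightarrow> enat" where
  "ecard X = (if finite X then enat (card X) else \<infinity>)"

definition Z2c :: "('a, 'b) monoid_scheme \<Rightarrow> 'a set \<Rightarrow> enat" where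
  "Z2c G V = (SUP g\<in>carrier G - {\<one>\<^bsub>G\<^esub>}.
     ecard {(x, y). x \<in> V \<and> y \<in> V \<and> inv\<^bsub>G\<^esub> x \<otimes>\<^bsub>G\<^esub> y = g})"

definition Z2r :: "('a, 'b) monoid_scheme \<Rightarrow> 'a set \<Rightarrow> enat" where
  "Z2r G V = Z2c G ((\<lambda>x. inv\<^bsub>G\<^esub> x) ` V)"

definition Z2 :: "('a, 'b) monoid_scheme \<Rightarrow> 'a set \<Rightarrow> enat" where
  "Z2 G V = max (Z2c G V) (Z2r G V)"

definition J_const :: real where
  "J_const = 1 / (2 * pi) * integral {0..2 * pi} (\<lambda>t. sqrt (1 + 1 / 2 * cos t))"

definition c_star :: real where
  "c_star = sqrt 2 / J_const"

end

theory Submission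
  imports Defs "HOL-Computational_Algebra.Formal_Power_Series"
begin

text \<open>
  Let \<open>g \<noteq> e\<close> and let \<open>x\<^sub>i, x\<^sub>i g \<in> V\<close> for three distinct \<open>x\<^sub>i\<close>. With \<open>|z| = 1\<close> consider the element
  \<open>F\<^sub>z = (e\<^sub>1 \<lambda>(x\<^sub>1) + e\<^sub>2 (\<lambda>(x\<^sub>2) + z \<lambda>(x\<^sub>3)) / \<surd>2) (1, \<lambda>(g))\<close> of \<open>M\<^sub>2 \<otimes> L(\<Gamma>)\<close>, a column times a row. Unless two of the pairs
  are linked in the wrong way, its coefficients satisfy \<open>\<Sum> C\<^sup>* C = \<Sum> C C\<^sup>* = 2\<close>, even when some of the six group
  elements coincide, so that pairing with the adjoint family gives an \<open>S\<^sub>1(\<ell>\<^sub>2)\<close> norm of at least \<open>2 \<surd>2\<close>.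
  Since \<open>W W\<^sup>* = 2\<close> for the row \<open>W\<close>, the moments of \<open>F\<^sub>z\<^sup>* F\<^sub>z\<close> are those of \<open>4 + z \<lambda>(h) + (z \<lambda>(h))\<^sup>*\<close> with \<open>h = x\<^sub>2\<^sup>-\<^sup>1 x\<^sub>3\<close>, and
  averaging over \<open>z\<close> removes the dependence on \<open>h\<close>: the mean of \<open>\<parallel>F\<^sub>z\<parallel>\<^sub>1\<close> is at most the mean of \<open>\<surd>(4 + 2 cos t)\<close>,
  which is \<open>2 J\<close>. Some \<open>z\<close> therefore gives the ratio \<open>\<surd>2 / J\<close>. In the one configuration that is left, the
  \<open>x\<^sub>i\<close> form a coset of a subgroup of order 3, and the sum over the coset gives the ratio \<open>\<surd>3\<close>.
  The case of \<open>V\<^sup>-\<^sup>1\<close> follows by applying everything to \<open>F\<^sub>z\<^sup>*\<close>, whose moments are the same by traciality.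
\<close>

text \<open>For a fixed z the spectral distribution of z lambda(h) may depend on z and on the order
  of h. In the moments h enters only through the frequencies n with h^n = e, and of these only n = 0
  survives integration over z. The norms of F_z are not integrated themselves: a constant lower
  bound for all of them is integrated against finite combinations of moments. Such combinations
  bound the norm from above because every coefficient of the series of sqrt(1 - y) after the first
  is negative.

  For a splitting C = X + Y the part X is controlled through columns and Y through rows, so the test
  family needs both sums to be scalar. Size 2 makes room for this: a coincidence of two of the six
  group elements matters only when their matrix units share a row or a column. So x_1 g = x_2 is
  harmless, while x_2 g = x_3 spoils the column sum.

  The adjoint and the square root are definite descriptions over functions on an index set, so
  existence and uniqueness have to be proved before any norm can be bounded; this is why a Hilbert
  space is built as a type.\<close>

no_notation Matrix.scalar_prod (infix \<open>\<bullet>\<close> 70)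

section \<open>The binomial series of the square root\<close>

text \<open>Taylor coefficients of \<open>sqrt (1 - y)\<close>; with this sign all of them except
  the first are negative.\<close>

definition sqrt_coeff :: "nat \<Rightarrow> real" where
  "sqrt_coeff k = (-1) ^ k * ((1 / 2) gchoose k)"

lemma sqrt_coeff_0 [simp]: "sqrt_coeff 0 = 1"
  by (simp add: sqrt_coeff_def)

lemma sqrt_coeff_Suc: "sqrt_coeff (Suc k) = sqrt_coeff k * ((real k - 1 / 2) / (real k + 1))"
  by (simp add: sqrt_coeff_def gbinomial_prod_rev prod.atLeast0_lessThan_Suc field_simps)

lemma sqrt_coeff_Suc_neg: "sqrt_coeff (Suc k) < 0"
proof (induction k)
  case (Suc k)
  then show ?case
    unfolding sqrt_coeff_Suc[of "Suc k"] by (intro mult_neg_pos) auto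
qed (simp add: sqrt_coeff_Suc)

text \<open>At y = 1 the partial sums have a closed form, and the next coefficient being negative
  makes them nonnegative. That bounds the sum of the absolute values by 2, so convergence reaches
  the boundary |y| = 1.\<close>

lemma sqrt_coeff_partial_sum: "(\<Sum>k\<le>n. sqrt_coeff k) = - 2 * (real n + 1) * sqrt_coeff (Suc n)"
proof (induction n)
  case (Suc n)
  have "sqrt_coeff (Suc (Suc n)) * (real n + 2) = sqrt_coeff (Suc n) * (real n + 1 / 2)"
    by (simp add: sqrt_coeff_Suc[of "Suc n"] field_simps)
  with Suc show ?case by (simp add: algebra_simps)
qed (simp add: sqrt_coeff_Suc)

lemma sum_abs_sqrt_coeff: "(\<Sum>k\<le>n. \<bar>sqrt_coeff k\<bar>) = 2 - (\<Sum>k\<le>n. sqrt_coeff k)"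
  by (induction n) (use sqrt_coeff_Suc_neg in \<open>auto simp: abs_if\<close>)

lemma sum_abs_sqrt_coeff_le: "(\<Sum>k\<le>n. \<bar>sqrt_coeff k\<bar>) \<le> 2"
proof -
  have "(\<Sum>k\<le>n. sqrt_coeff k) \<ge> 0"
    unfolding sqrt_coeff_partial_sum using sqrt_coeff_Suc_neg[of n]
    by (intro mult_nonpos_nonpos) auto
  then show ?thesis by (simp add: sum_abs_sqrt_coeff)
qed

lemma summable_abs_sqrt_coeff: "summable (\<lambda>k. \<bar>sqrt_coeff k\<bar>)"
proof (rule bounded_imp_summable)
  show "(\<Sum>k\<le>n. \<bar>sqrt_coeff k\<bar>) \<le> 2" for n
    by (rule sum_abs_sqrt_coeff_le)
qed simp

lemma suminf_abs_sqrt_coeff_le: "(\<Sum>k. \<bar>sqrt_coeff k\<bar>) \<le> 2"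
  by (rule suminf_le_const[OF summable_abs_sqrt_coeff])
    (metis sum_abs_sqrt_coeff_le abs_ge_zero lessThan_Suc_atMost lessThan_Suc sum.lessThan_Suc
      le_add_same_cancel1 order_trans)

text \<open>The Vandermonde identity for 1/2 + 1/2 = 1: the series squares to 1 - y. It serves both
  the scalar series and the operator series.\<close>

lemma sqrt_coeff_convolution:
  "(\<Sum>i\<le>n. sqrt_coeff i * sqrt_coeff (n - i)) = (if n = 0 then 1 else if n = 1 then - 1 else 0)"
proof -
  have "(\<Sum>i\<le>n. sqrt_coeff i * sqrt_coeff (n - i)) =
      (\<Sum>i\<le>n. (-1) ^ n * ((1 / 2 gchoose i) * (1 / 2 gchoose (n - i))))"
    by (rule sum.cong) (auto simp: sqrt_coeff_def simp flip: power_add)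
  also have "\<dots> = (-1) ^ n * (1 gchoose n)"
    using gbinomial_Vandermonde[of "1 / 2 :: real" "1 / 2" n]
    by (simp add: atMost_atLeast0 flip: sum_distrib_left)
  also have "(1 :: real) gchoose n = of_nat (1 choose n)"
    by (metis binomial_gbinomial of_nat_1)
  finally show ?thesis
    by (cases n; cases "n - 1") auto
qed

text \<open>The Cauchy product fixes the square of the sum; nonnegativity singles out the root. It
  is inherited from y = 1: the later coefficients are negative and y^k <= 1, so each term is at
  least its value at y = 1.\<close>

lemma sqrt_coeff_power_sums:
  assumes "\<bar>y :: real\<bar> \<le> 1"
  shows "(\<lambda>k. sqrt_coeff k * y ^ k) sums sqrt (1 - y)"
proof -
  have pow_le: "\<bar>y\<bar> ^ k \<le> 1" for k
    using assms by (simp add: power_le_one)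
  have summ: "summable (\<lambda>k. norm (sqrt_coeff k * y ^ k))"
    by (rule summable_comparison_test'[OF summable_abs_sqrt_coeff])
      (simp add: abs_mult power_abs mult_left_le pow_le)
  let ?s = "\<Sum>k. sqrt_coeff k * y ^ k"
  have "(\<lambda>n. \<Sum>i\<le>n. (sqrt_coeff i * y ^ i) * (sqrt_coeff (n - i) * y ^ (n - i))) sums (?s * ?s)"
    by (rule Cauchy_product_sums[OF summ summ])
  also have "(\<lambda>n. \<Sum>i\<le>n. (sqrt_coeff i * y ^ i) * (sqrt_coeff (n - i) * y ^ (n - i))) =
      (\<lambda>n. (if n = 0 then 1 else if n = 1 then - 1 else 0) * y ^ n)"
  proof
    fix n
    have "(\<Sum>i\<le>n. (sqrt_coeff i * y ^ i) * (sqrt_coeff (n - i) * y ^ (n - i))) =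
        (\<Sum>i\<le>n. sqrt_coeff i * sqrt_coeff (n - i)) * y ^ n"
      unfolding sum_distrib_right by (rule sum.cong) (auto simp: algebra_simps simp flip: power_add)
    then show "(\<Sum>i\<le>n. (sqrt_coeff i * y ^ i) * (sqrt_coeff (n - i) * y ^ (n - i))) =
        (if n = 0 then 1 else if n = 1 then - 1 else 0) * y ^ n"
      by (simp add: sqrt_coeff_convolution)
  qed
  finally have "(\<lambda>n. (if n = 0 then 1 else if n = 1 then - 1 else 0) * y ^ n) sums (?s * ?s)" .
  moreover have "(\<lambda>n. (if n = 0 then 1 else if n = 1 then - 1 else 0) * y ^ n) sums
      (\<Sum>n\<in>{0, 1}. (if n = 0 then 1 else if n = 1 then - 1 else 0) * y ^ n)"
    by (rule sums_finite) auto
  ultimately have sq: "?s * ?s = 1 - y"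
    by (auto dest: sums_unique2)
  have "0 \<le> ?s"
  proof (rule LIMSEQ_le_const)
    show "(\<lambda>n. \<Sum>k\<le>n. sqrt_coeff k * y ^ k) \<longlonglongrightarrow> ?s"
      using summable_sums[OF summable_norm_cancel[OF summ]] by (simp add: sums_def_le)
    have "0 \<le> (\<Sum>k\<le>n. sqrt_coeff k * y ^ k)" for n
    proof -
      have "sqrt_coeff k \<le> sqrt_coeff k * y ^ k" for k
      proof (cases k)
        case (Suc j)
        have "y ^ k \<le> 1" using pow_le[of k] abs_ge_self[of "y ^ k"] by (simp add: power_abs)
        then show ?thesis
          using mult_left_mono_neg[of "y ^ k" 1 "sqrt_coeff k"] sqrt_coeff_Suc_neg[of j] Suc by simp
      qed simp
      then have "(\<Sum>k\<le>n. sqrt_coeff k) \<le> (\<Sum>k\<le>n. sqrt_coeff k * y ^ k)"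
        by (rule sum_mono)
      then show ?thesis
        using sum_abs_sqrt_coeff_le[of n] by (simp add: sum_abs_sqrt_coeff)
    qed
    then show "\<exists>N. \<forall>n\<ge>N. 0 \<le> (\<Sum>k\<le>n. sqrt_coeff k * y ^ k)" by blast
  qed
  then have "?s = sqrt (1 - y)"
    using sq by (metis abs_of_nonneg real_sqrt_mult_self real_sqrt_abs2)
  then show ?thesis
    using summable_sums[OF summable_norm_cancel[OF summ]] by simp
qed

text \<open>Two factors for two uses: r = 1/2 gives geometric decay for the numerics, while for r =
  1 it is the tail of the absolute coefficients that tends to 0.\<close>

lemma sqrt_approx_error:
  assumes "\<bar>y\<bar> \<le> r" and "r \<le> 1"
  shows "\<bar>(\<Sum>k\<le>N. sqrt_coeff k * y ^ k) - sqrt (1 - y)\<bar> \<le> r ^ Suc N * (\<Sum>k. \<bar>sqrt_coeff (k + Suc N)\<bar>)"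
proof -
  let ?t = "\<lambda>k. sqrt_coeff k * y ^ k"
  let ?b = "\<lambda>k. r ^ Suc N * \<bar>sqrt_coeff (k + Suc N)\<bar>"
  have r: "0 \<le> r" using assms(1) by (rule order_trans[OF abs_ge_zero])
  have sb: "summable ?b"
    by (intro summable_mult summable_ignore_initial_segment[OF summable_abs_sqrt_coeff])
  have le: "norm (?t (k + Suc N)) \<le> ?b k" for k
  proof -
    have "\<bar>y\<bar> ^ (k + Suc N) \<le> 1 * r ^ Suc N"
      unfolding power_add using assms r
      by (intro mult_mono power_le_one power_mono) auto
    then have "\<bar>sqrt_coeff (k + Suc N)\<bar> * \<bar>y\<bar> ^ (k + Suc N) \<le> \<bar>sqrt_coeff (k + Suc N)\<bar> * r ^ Suc N"
      by (intro mult_left_mono) auto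
    then show ?thesis
      by (simp only: real_norm_def abs_mult power_abs mult.commute)
  qed
  have "sqrt (1 - y) - (\<Sum>k\<le>N. ?t k) = (\<Sum>k. ?t (k + Suc N))"
    using sqrt_coeff_power_sums[of y] assms
      suminf_split_initial_segment[of ?t "Suc N"]
    by (simp add: sums_iff lessThan_Suc_atMost del: add_Suc_right)
  moreover have "norm (\<Sum>k. ?t (k + Suc N)) \<le> (\<Sum>k. ?b k)"
    by (rule norm_suminf_le[OF le sb])
  moreover have "(\<Sum>k. ?b k) = r ^ Suc N * (\<Sum>k. \<bar>sqrt_coeff (k + Suc N)\<bar>)"
    by (rule suminf_mult[OF summable_ignore_initial_segment[OF summable_abs_sqrt_coeff]])
  ultimately show ?thesis by (simp add: abs_minus_commute)
qed

lemma sqrt_coeff_tail: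
  "(\<lambda>N. \<Sum>k. \<bar>sqrt_coeff (k + Suc N)\<bar>) \<longlonglongrightarrow> 0"
  using LIMSEQ_Suc[OF suminf_exist_split2[OF summable_abs_sqrt_coeff]] by simp

lemma sqrt_coeff_tail_le_1: "(\<Sum>k. \<bar>sqrt_coeff (k + Suc N)\<bar>) \<le> 1"
proof -
  have "(\<Sum>k. \<bar>sqrt_coeff (k + Suc N)\<bar>) + (\<Sum>k<Suc N. \<bar>sqrt_coeff k\<bar>) \<le> 2"
    using suminf_split_initial_segment[OF summable_abs_sqrt_coeff, of "Suc N"]
      suminf_abs_sqrt_coeff_le by simp
  moreover have "(\<Sum>k<Suc N. \<bar>sqrt_coeff k\<bar>) \<ge> 1"
    by (subst sum.lessThan_Suc_shift) (simp add: sum_nonneg)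
  ultimately show ?thesis by simp
qed

section \<open>Numerical bounds\<close>

text \<open>Wallis recursion: the derivative of cos^(k+1) t sin t integrates to 0 over a
  period.\<close>

lemma integral_cos_power_Suc_Suc:
  "(real k + 2) * integral {0..2 * pi} (\<lambda>t. cos t ^ (k + 2)) =
   (real k + 1) * integral {0..2 * pi} (\<lambda>t. cos t ^ k)"
proof -
  have "((\<lambda>t. (real k + 2) * cos t ^ (k + 2) - (real k + 1) * cos t ^ k) has_integral
      cos (2 * pi) ^ Suc k * sin (2 * pi) - cos 0 ^ Suc k * sin 0) {0..2 * pi}"
  proof (rule fundamental_theorem_of_calculus)
    fix t :: real
    have "((\<lambda>t. cos t ^ Suc k * sin t) has_real_derivative
        (real k + 1) * cos t ^ k * (- sin t) * sin t + cos t ^ Suc k * cos t) (at t within {0..2 * pi})"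
      using DERIV_mult[OF DERIV_power_Suc[OF DERIV_subset[OF DERIV_cos]] DERIV_subset[OF DERIV_sin]]
      by (simp add: algebra_simps)
    also have "(real k + 1) * cos t ^ k * (- sin t) * sin t + cos t ^ Suc k * cos t =
        (real k + 2) * cos t ^ (k + 2) - (real k + 1) * cos t ^ k"
    proof -
      have ss: "sin t * sin t = 1 - cos t * cos t"
        using sin_cos_squared_add[of t] by (simp add: power2_eq_square)
      have "(real k + 1) * cos t ^ k * (- sin t) * sin t + cos t ^ Suc k * cos t =
          (real k + 1) * cos t ^ k * - (sin t * sin t) + cos t ^ k * (cos t * cos t)"
        by simp
      also have "\<dots> = (real k + 2) * (cos t ^ k * (cos t * cos t)) - (real k + 1) * cos t ^ k"
        unfolding ss by (simp add: algebra_simps)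
      finally show ?thesis by (simp add: power2_eq_square)
    qed
    finally show "((\<lambda>t. cos t ^ Suc k * sin t) has_vector_derivative
        (real k + 2) * cos t ^ (k + 2) - (real k + 1) * cos t ^ k) (at t within {0..2 * pi})"
      by (simp add: has_real_derivative_iff_has_vector_derivative)
  qed simp
  then have "integral {0..2 * pi} (\<lambda>t. (real k + 2) * cos t ^ (k + 2) - (real k + 1) * cos t ^ k) = 0"
    by (simp add: integral_unique)
  moreover have "(\<lambda>t. cos t ^ n) integrable_on {0..2 * pi}" for n
    by (intro integrable_continuous_interval continuous_intros)
  ultimately show ?thesis
    by (subst (asm) integral_diff) (auto intro!: integrable_continuous_interval continuous_intros)
qed

lemma integral_cos_power_odd: "integral {0..2 * pi} (\<lambda>t. cos t ^ (2 * j + 1)) = 0"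
proof (induction j)
  case 0
  have "(cos has_integral sin (2 * pi) - sin 0) {0..2 * pi}"
    by (rule fundamental_theorem_of_calculus)
      (auto intro!: derivative_eq_intros simp flip: has_real_derivative_iff_has_vector_derivative)
  then show ?case by (simp add: integral_unique)
next
  case (Suc j)
  then show ?case using integral_cos_power_Suc_Suc[of "2 * j + 1"] by simp
qed

text \<open>\<open>J_term j\<close> is the share of degree 2 j in J, that is,
  \<open>sqrt_coeff (2 * j)\<close> times the mean of (cos t / 2)^(2 j). The factor merges two
  coefficient ratios with the Wallis recursion.\<close>

fun J_term :: "nat \<Rightarrow> real" where
  "J_term 0 = 1"
| "J_term (Suc j) = J_term j * ((16 * (real j)\<^sup>2 - 1) / (64 * (real j + 1)\<^sup>2))"

lemma integral_J_term:
  "sqrt_coeff (2 * j) * (1 / 2) ^ (2 * j) * integral {0..2 * pi} (\<lambda>t. cos t ^ (2 * j)) = 2 * pi * J_term j"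
proof (induction j)
  case (Suc j)
  let ?I = "\<lambda>k. integral {0..2 * pi} (\<lambda>t. cos t ^ k)"
  have I: "?I (2 * j + 2) = (2 * real j + 1) / (2 * real j + 2) * ?I (2 * j)"
    using integral_cos_power_Suc_Suc[of "2 * j"] by (simp add: field_simps)
  have p: "(1 / 2 :: real) ^ (2 * j + 2) = (1 / 2) ^ (2 * j) * (1 / 4)"
    by (simp add: power2_eq_square)
  have c: "sqrt_coeff (2 * j + 2) = sqrt_coeff (2 * j) *
      ((2 * real j - 1 / 2) / (2 * real j + 1) * ((2 * real j + 1 / 2) / (2 * real j + 2)))"
  proof -
    have "real (2 * j) = 2 * real j" "real (2 * j + 1) - 1 / 2 = 2 * real j + 1 / 2"
      "real (2 * j + 1) + 1 = 2 * real j + 2" by simp_all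
    then show ?thesis
      using sqrt_coeff_Suc[of "2 * j"] sqrt_coeff_Suc[of "2 * j + 1"]
      by (simp only: Suc_eq_plus1 add.assoc one_add_one mult.assoc)
  qed
  have "sqrt_coeff (2 * j + 2) * (1 / 2) ^ (2 * j + 2) * ?I (2 * j + 2) =
      (sqrt_coeff (2 * j) * (1 / 2) ^ (2 * j) * ?I (2 * j)) *
      ((2 * real j - 1 / 2) / (2 * real j + 1) * ((2 * real j + 1 / 2) / (2 * real j + 2)) * (1 / 4) *
        ((2 * real j + 1) / (2 * real j + 2)))"
    unfolding I c p by (simp only: mult_ac)
  also have "(2 * real j - 1 / 2) / (2 * real j + 1) * ((2 * real j + 1 / 2) / (2 * real j + 2)) * (1 / 4) *
        ((2 * real j + 1) / (2 * real j + 2)) = (16 * (real j)\<^sup>2 - 1) / (64 * (real j + 1)\<^sup>2)"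
  proof -
    have "(2 * real j - 1 / 2) / a * ((2 * real j + 1 / 2) / b) * (1 / 4) * (a / b) =
        (4 * (real j)\<^sup>2 - 1 / 4) / (4 * b\<^sup>2)" if "a \<noteq> 0" "b \<noteq> 0" for a b :: real
      using that by (simp add: field_simps power2_eq_square)
    from this[of "2 * real j + 1" "2 * real j + 2"]
    have "(2 * real j - 1 / 2) / (2 * real j + 1) * ((2 * real j + 1 / 2) / (2 * real j + 2)) * (1 / 4) *
        ((2 * real j + 1) / (2 * real j + 2)) = (4 * (real j)\<^sup>2 - 1 / 4) / (4 * (2 * real j + 2)\<^sup>2)"
      by (simp add: add_eq_0_iff)
    also have "\<dots> = (16 * (real j)\<^sup>2 - 1) / (64 * (real j + 1)\<^sup>2)"
      by (simp add: field_simps power2_eq_square)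
    finally show ?thesis .
  qed
  finally show ?case using Suc by simp
qed simp

lemma J_const_approx: "\<bar>J_const - (\<Sum>j\<le>19. J_term j)\<bar> \<le> (1 / 2) ^ 40"
proof -
  \<comment> \<open>Forty terms: the error 2^-40 is below 10^-12, and since the odd powers integrate
    to 0 only twenty values \<open>J_term j\<close> remain.\<close>
  let ?p = "\<lambda>t. \<Sum>k\<le>39. sqrt_coeff k * (- (1 / 2) * cos t) ^ k"
  have "integral {0..2 * pi} ?p = (\<Sum>k\<le>39. sqrt_coeff k * (- (1 / 2)) ^ k * integral {0..2 * pi} (\<lambda>t. cos t ^ k))"
    unfolding power_mult_distrib mult.assoc[symmetric]
    by (subst integral_sum) (auto intro!: integrable_continuous_interval continuous_intros)
  also have "\<dots> = (\<Sum>k<2 * 20. sqrt_coeff k * (- (1 / 2)) ^ k * integral {0..2 * pi} (\<lambda>t. cos t ^ k))"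
    by (rule sum.cong) auto
  also have "\<dots> = (\<Sum>j<20. 2 * pi * J_term j)"
  proof -
    have "(\<Sum>k<2 * n. sqrt_coeff k * (- (1 / 2)) ^ k * integral {0..2 * pi} (\<lambda>t. cos t ^ k)) =
        (\<Sum>j<n. 2 * pi * J_term j)" for n
    proof (induction n)
      case (Suc n)
      then show ?case
        using integral_J_term[of n] integral_cos_power_odd[of n] by simp
    qed simp
    then show ?thesis .
  qed
  also have "\<dots> = 2 * pi * (\<Sum>j\<le>19. J_term j)"
    unfolding sum_distrib_left by (rule sum.cong) auto
  finally have p: "integral {0..2 * pi} ?p = 2 * pi * (\<Sum>j\<le>19. J_term j)" .
  have intp: "?p integrable_on {0..2 * pi}" and ints: "(\<lambda>t. sqrt (1 + 1 / 2 * cos t)) integrable_on {0..2 * pi}"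
    by (intro integrable_continuous_interval continuous_intros)+
  have "norm (integral {0..2 * pi} (\<lambda>t. ?p t - sqrt (1 + 1 / 2 * cos t))) \<le>
      integral {0..2 * pi} (\<lambda>t. (1 / 2) ^ 40)"
  proof (rule integral_norm_bound_integral)
    show "norm (?p t - sqrt (1 + 1 / 2 * cos t)) \<le> (1 / 2) ^ 40" for t
    proof -
      have "\<bar>?p t - sqrt (1 - - (1 / 2) * cos t)\<bar> \<le> (1 / 2) ^ Suc 39 * (\<Sum>k. \<bar>sqrt_coeff (k + Suc 39)\<bar>)"
        by (rule sqrt_approx_error) (use abs_cos_le_one[of t] in \<open>auto simp: abs_mult\<close>)
      also have "\<dots> \<le> (1 / 2) ^ Suc 39 * 1"
        by (intro mult_left_mono sqrt_coeff_tail_le_1) simp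
      finally show ?thesis by simp
    qed
  qed (use intp ints in \<open>auto intro: integrable_diff\<close>)
  then have "\<bar>integral {0..2 * pi} ?p - 2 * pi * J_const\<bar> \<le> 2 * pi * (1 / 2) ^ 40"
    unfolding integral_diff[OF intp ints] by (simp add: J_const_def)
  then have "2 * pi * \<bar>(\<Sum>j\<le>19. J_term j) - J_const\<bar> \<le> 2 * pi * (1 / 2) ^ 40"
    unfolding p by (simp add: abs_mult flip: right_diff_distrib)
  then show ?thesis by (simp add: abs_minus_commute)
qed

lemma J_const_bounds: "0.98334265077 < J_const" "J_const < 0.98334265079"
proof -
  have "0.983342650774 < (\<Sum>j\<le>19. J_term j)" "(\<Sum>j\<le>19. J_term j) < 0.983342650776"
    by (simp_all add: eval_nat_numeral)
  moreover have "\<bar>J_const - (\<Sum>j\<le>19. J_term j)\<bar> \<le> 1 / 10 ^ 12"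
    by (rule order_trans[OF J_const_approx]) (simp add: power_divide)
  ultimately show "0.98334265077 < J_const" "J_const < 0.98334265079"
    unfolding abs_le_iff by simp_all
qed

text \<open>The upper bound also yields c_* < sqrt 3, which the coset of order 3 requires.\<close>

lemma c_star_bounds: "1.4381696565 \<le> c_star" "c_star < 1.4381696566"
proof -
  have J: "0 < J_const" using J_const_bounds by simp
  have "1.4381696565 * J_const \<le> 1.4381696565 * 0.98334265079"
    using J_const_bounds by (intro mult_left_mono) auto
  also have "\<dots> \<le> sqrt 2"
    by (rule real_le_rsqrt) (simp add: power2_eq_square)
  finally show "1.4381696565 \<le> c_star" using J by (simp add: c_star_def field_simps)
  have "sqrt 2 < 1.4381696566 * 0.98334265077"
    by (rule real_less_lsqrt) (simp_all add: power2_eq_square)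
  also have "\<dots> < 1.4381696566 * J_const"
    using J_const_bounds by simp
  finally show "c_star < 1.4381696566" using J by (simp add: c_star_def field_simps)
qed

section \<open>Lower bounds for the norm of \<open>S\<^sub>1\<^sup>2(\<ell>\<^sub>2)\<close>\<close>

lemma sum_cnj_cauchy_schwarz:
  fixes u v :: "'k \<Rightarrow> complex"
  shows "(cmod (\<Sum>k\<in>K. cnj (u k) * v k))\<^sup>2 \<le> (\<Sum>k\<in>K. (cmod (u k))\<^sup>2) * (\<Sum>k\<in>K. (cmod (v k))\<^sup>2)"
proof -
  have "cmod (\<Sum>k\<in>K. cnj (u k) * v k) \<le> (\<Sum>k\<in>K. \<bar>cmod (u k)\<bar> * \<bar>cmod (v k)\<bar>)"
    by (rule order_trans[OF norm_sum]) (simp add: norm_mult)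
  also have "\<dots> \<le> L2_set (\<lambda>k. cmod (u k)) K * L2_set (\<lambda>k. cmod (v k)) K"
    by (rule L2_set_mult_ineq)
  finally have "(cmod (\<Sum>k\<in>K. cnj (u k) * v k))\<^sup>2 \<le> (L2_set (\<lambda>k. cmod (u k)) K * L2_set (\<lambda>k. cmod (v k)) K)\<^sup>2"
    by (intro power_mono) auto
  also have "\<dots> = (\<Sum>k\<in>K. (cmod (u k))\<^sup>2) * (\<Sum>k\<in>K. (cmod (v k))\<^sup>2)"
    by (simp add: power_mult_distrib L2_set_def sum_nonneg)
  finally show ?thesis .
qed

text \<open>The mixed terms obey p1 e2 + e1 p2 >= 2 |p| |e| by the arithmetic-geometric mean
  inequality, which makes the determinant monotone on positive 2 by 2 matrices.\<close>

lemma psd_det_mono: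
  fixes p1 p2 e1 e2 :: real and p e :: complex
  assumes "0 \<le> p1" "0 \<le> p2" "0 \<le> e1" "0 \<le> e2"
    and p: "(cmod p)\<^sup>2 \<le> p1 * p2" and e: "(cmod e)\<^sup>2 \<le> e1 * e2"
  shows "p1 * p2 - (cmod p)\<^sup>2 \<le> (p1 + e1) * (p2 + e2) - (cmod (p + e))\<^sup>2"
proof -
  have "(cmod p * cmod e)\<^sup>2 \<le> (p1 * p2) * (e1 * e2)"
    unfolding power_mult_distrib using assms by (intro mult_mono) auto
  also have "\<dots> = (p1 * e2) * (e1 * p2)" by simp
  finally have "4 * (cmod p * cmod e)\<^sup>2 \<le> 4 * ((p1 * e2) * (e1 * p2))" by simp
  also have "4 * (x * y) \<le> (x + y)\<^sup>2" for x y :: real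
    using sum_squares_bound[of x y] by (simp add: power2_sum)
  finally have "(2 * (cmod p * cmod e))\<^sup>2 \<le> (p1 * e2 + e1 * p2)\<^sup>2"
    by (simp add: power_mult_distrib)
  then have pe: "2 * (cmod p * cmod e) \<le> p1 * e2 + e1 * p2"
    by (rule power2_le_imp_le) (use assms in auto)
  have "(cmod (p + e))\<^sup>2 \<le> (cmod p + cmod e)\<^sup>2"
    by (intro power_mono norm_triangle_ineq) simp
  then have "(cmod (p + e))\<^sup>2 \<le> (cmod p)\<^sup>2 + (cmod e)\<^sup>2 + 2 * (cmod p * cmod e)"
    by (simp add: power2_sum)
  then show ?thesis using pe e by (simp add: algebra_simps)
qed

text \<open>The right side is the square of the trace norm of the matrix: with singular values s and
  t it equals s^2 + t^2 + 2 s t.\<close>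

lemma cmod_trace_le:
  fixes m11 m12 m21 m22 :: complex
  shows "(cmod (m11 + m22))\<^sup>2 \<le>
    (cmod m11)\<^sup>2 + (cmod m12)\<^sup>2 + (cmod m21)\<^sup>2 + (cmod m22)\<^sup>2 + 2 * cmod (m11 * m22 - m12 * m21)"
proof -
  have "cmod m11 * cmod m22 \<le> cmod (m11 * m22 - m12 * m21) + cmod m12 * cmod m21"
    by (metis norm_mult norm_triangle_sub add.commute)
  moreover have "2 * (cmod m12 * cmod m21) \<le> (cmod m12)\<^sup>2 + (cmod m21)\<^sup>2"
    using sum_squares_bound[of "cmod m12" "cmod m21"] by simp
  moreover have "(cmod (m11 + m22))\<^sup>2 \<le> (cmod m11 + cmod m22)\<^sup>2"
    by (intro power_mono norm_triangle_ineq) simp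
  ultimately show ?thesis by (simp add: power2_sum)
qed

definition gram :: "'k set \<Rightarrow> ('k \<Rightarrow> complex) \<Rightarrow> ('k \<Rightarrow> complex) \<Rightarrow> complex" where
  "gram K u v = (\<Sum>k\<in>K. cnj (u k) * v k)"

lemma gram_self: "gram K u u = of_real (\<Sum>k\<in>K. (cmod (u k))\<^sup>2)"
  unfolding gram_def of_real_sum by (rule sum.cong) (simp_all add: complex_norm_square mult.commute del: of_real_power)

lemma gram_commute: "gram K v u = cnj (gram K u v)"
  by (simp add: gram_def mult.commute)

lemma gram_psd:
  "0 \<le> Re (gram K u u)" "gram K u u = of_real (Re (gram K u u))"
  "(cmod (gram K u v))\<^sup>2 \<le> Re (gram K u u) * Re (gram K v v)"
  using sum_cnj_cauchy_schwarz[where K = K and u = u and v = v]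
  by (simp_all add: gram_self sum_nonneg) (simp add: gram_def)

text \<open>
  The trace of the square root of the positive 2 by 2 matrix with diagonal \<open>n1\<close>, \<open>n2\<close> and
  off-diagonal entry \<open>b\<close>.
\<close>

definition sqrt_trace :: "real \<Rightarrow> real \<Rightarrow> complex \<Rightarrow> real" where
  "sqrt_trace n1 n2 b = sqrt (n1 + n2 + 2 * sqrt (n1 * n2 - (cmod b)\<^sup>2))"

text \<open>
  The cross Gram matrix \<open>M\<close> of the \<open>c\<close>'s against the \<open>x\<close>'s satisfies \<open>M\<^sup>* M \<le> a N\<close> (Bessel), where \<open>N\<close>
  is the Gram matrix of the \<open>x\<close>'s; then use \<open>|tr M|\<^sup>2 \<le> tr (M\<^sup>* M) + 2 |det M|\<close>.
\<close>

lemma gram_trace_duality: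
  fixes c1 c2 x1 x2 :: "'k \<Rightarrow> complex"
  assumes a: "0 < a" and c: "gram K c1 c1 = of_real a" "gram K c2 c2 = of_real a" "gram K c1 c2 = 0"
  shows "Re (gram K c1 x1 + gram K c2 x2) \<le>
    sqrt a * sqrt_trace (Re (gram K x1 x1)) (Re (gram K x2 x2)) (gram K x1 x2)"
proof -
  define m11 m12 m21 m22 where m: "m11 = gram K c1 x1" "m12 = gram K c1 x2"
    "m21 = gram K c2 x1" "m22 = gram K c2 x2"
  have c21: "gram K c2 c1 = 0" using c(3) gram_commute[of K c2 c1] by simp
  \<comment> \<open>The residues of x1 and x2 after projection onto the span of c1 and c2, which are
    orthogonal of squared length a.\<close>
  define y1 where "y1 k = x1 k - (m11 * c1 k + m21 * c2 k) / of_real a" for k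
  define y2 where "y2 k = x2 k - (m12 * c1 k + m22 * c2 k) / of_real a" for k
  have gram_res: "gram K (\<lambda>k. u k - (p * c1 k + q * c2 k) / of_real a) (\<lambda>k. v k - (r * c1 k + s * c2 k) / of_real a) =
      gram K u v - (cnj p * r + cnj q * s) / of_real a"
    if "gram K c1 u = p" "gram K c2 u = q" "gram K c1 v = r" "gram K c2 v = s" for u v p q r s
  proof -
    define L where "L = gram K (\<lambda>k. u k - (p * c1 k + q * c2 k) / of_real a) (\<lambda>k. v k - (r * c1 k + s * c2 k) / of_real a)"
    have "L = gram K u v - (r * gram K u c1 + s * gram K u c2) / of_real a
      - (cnj p * gram K c1 v + cnj q * gram K c2 v) / of_real a
      + (cnj p * (r * gram K c1 c1 + s * gram K c1 c2) + cnj q * (r * gram K c2 c1 + s * gram K c2 c2)) / (of_real a)\<^sup>2"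
      by (simp add: L_def gram_def algebra_simps sum.distrib sum_subtractf sum_distrib_left sum_divide_distrib
          add_divide_distrib diff_divide_distrib power2_eq_square)
    moreover have "gram K u c1 = cnj p" "gram K u c2 = cnj q"
      using that gram_commute by metis+
    ultimately have "L = gram K u v - (cnj p * r + cnj q * s) / of_real a"
      using a by (simp add: c c21 that add_divide_distrib power2_eq_square mult.commute)
    then show ?thesis by (simp add: L_def)
  qed
  let ?N1 = "Re (gram K x1 x1)" and ?N2 = "Re (gram K x2 x2)" and ?b = "gram K x1 x2"
  let ?P1 = "((cmod m11)\<^sup>2 + (cmod m21)\<^sup>2) / a" and ?P2 = "((cmod m12)\<^sup>2 + (cmod m22)\<^sup>2) / a"
  let ?p = "(cnj m11 * m12 + cnj m21 * m22) / of_real a"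
  have e1: "Re (gram K y1 y1) = ?N1 - ?P1" and e2: "Re (gram K y2 y2) = ?N2 - ?P2"
    and e: "gram K y1 y2 = ?b - ?p"
    unfolding y1_def y2_def
    by (subst gram_res; simp add: m cmod_def power2_eq_square)+
  have det_P: "?P1 * ?P2 - (cmod ?p)\<^sup>2 = (cmod (m11 * m22 - m12 * m21) / a)\<^sup>2"
  proof -
    have "((cmod m11)\<^sup>2 + (cmod m21)\<^sup>2) * ((cmod m12)\<^sup>2 + (cmod m22)\<^sup>2) - (cmod (cnj m11 * m12 + cnj m21 * m22))\<^sup>2 =
        (cmod (m11 * m22 - m12 * m21))\<^sup>2"
      unfolding cmod_power2 by (simp add: algebra_simps power2_eq_square)
    then show ?thesis
      using a by (simp add: norm_divide power_divide power2_eq_square diff_divide_distrib[symmetric])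
  qed
  \<comment> \<open>The Gram matrix of the x's is P = M* M / a plus the Gram matrix of the residues,
    so its determinant is at least det P.\<close>
  have "?P1 * ?P2 - (cmod ?p)\<^sup>2 \<le>
      (?P1 + Re (gram K y1 y1)) * (?P2 + Re (gram K y2 y2)) - (cmod (?p + gram K y1 y2))\<^sup>2"
  proof (rule psd_det_mono)
    have "0 \<le> (cmod (m11 * m22 - m12 * m21) / a)\<^sup>2" by simp
    then show "(cmod ?p)\<^sup>2 \<le> ?P1 * ?P2" unfolding det_P[symmetric] by simp
  qed (use a gram_psd in \<open>auto intro: divide_nonneg_pos\<close>)
  then have "(cmod (m11 * m22 - m12 * m21) / a)\<^sup>2 \<le> ?N1 * ?N2 - (cmod ?b)\<^sup>2"
    unfolding det_P e1 e2 e by simp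
  then have "cmod (m11 * m22 - m12 * m21) / a \<le> sqrt (?N1 * ?N2 - (cmod ?b)\<^sup>2)"
    by (rule real_le_rsqrt)
  then have det: "cmod (m11 * m22 - m12 * m21) \<le> a * sqrt (?N1 * ?N2 - (cmod ?b)\<^sup>2)"
    using a by (simp add: field_simps)
  have "?P1 \<le> ?N1" "?P2 \<le> ?N2"
    using gram_psd(1)[of K y1] gram_psd(1)[of K y2] e1 e2 by simp_all
  then have tr: "(cmod m11)\<^sup>2 + (cmod m21)\<^sup>2 \<le> a * ?N1" "(cmod m12)\<^sup>2 + (cmod m22)\<^sup>2 \<le> a * ?N2"
    using a by (simp_all add: field_simps)
  have "(cmod (m11 + m22))\<^sup>2 \<le> a * (?N1 + ?N2 + 2 * sqrt (?N1 * ?N2 - (cmod ?b)\<^sup>2))"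
    using cmod_trace_le[of m11 m22 m12 m21] det tr by (simp add: algebra_simps)
  then have "cmod (m11 + m22) \<le> sqrt a * sqrt_trace ?N1 ?N2 ?b"
    unfolding sqrt_trace_def real_sqrt_mult[symmetric] by (rule real_le_rsqrt)
  then show ?thesis
    using complex_Re_le_cmod[of "m11 + m22"] by (simp add: m)
qed

section \<open>Square roots of positive 2 by 2 matrices\<close>

lemma sum_lessThan_2: "(\<Sum>i<2. f i) = f 0 + f (1 :: nat)"
  by (simp add: numeral_2_eq_2)

lemma mat_mult_2:
  assumes "A \<in> carrier_mat 2 2" "B \<in> carrier_mat 2 2" "i < 2" "j < 2"
  shows "(A * B) $$ (i, j) = A $$ (i, 0) * B $$ (0, j) + A $$ (i, 1) * B $$ (1, j)"
  using assms by (auto simp: scalar_prod_def numeral_2_eq_2)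

lemma eq_mat_2:
  assumes "A \<in> carrier_mat 2 2" "B \<in> carrier_mat 2 2"
    "A $$ (0, 0) = B $$ (0, 0)" "A $$ (0, 1) = B $$ (0, 1)"
    "A $$ (1, 0) = B $$ (1, 0)" "A $$ (1, 1) = B $$ (1, 1)"
  shows "A = B"
  by (rule eq_matI) (use assms in \<open>auto simp: less_2_cases_iff\<close>)

lemma quadratic_form_2:
  assumes "B \<in> carrier_mat 2 2" "v \<in> carrier_vec 2"
  shows "(B *\<^sub>v v) \<bullet>c v = (B $$ (0, 0) * v $ 0 + B $$ (0, 1) * v $ 1) * cnj (v $ 0) +
    (B $$ (1, 0) * v $ 0 + B $$ (1, 1) * v $ 1) * cnj (v $ 1)"
  using assms by (auto simp: scalar_prod_def numeral_2_eq_2)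

text \<open>The vectors (1,0), (0,1), (1,1) and (1,i) force a real diagonal and a hermitian matrix;
  the vectors (s b, -t), with b the off-diagonal entry, give the determinant condition.\<close>

lemma positive_mat_2_iff:
  assumes B: "B \<in> carrier_mat 2 2"
  shows "positive_mat 2 B \<longleftrightarrow> (\<exists>p r. 0 \<le> p \<and> 0 \<le> r \<and> B $$ (0, 0) = of_real p \<and> B $$ (1, 1) = of_real r \<and>
    B $$ (1, 0) = cnj (B $$ (0, 1)) \<and> (cmod (B $$ (0, 1)))\<^sup>2 \<le> p * r)" (is "_ \<longleftrightarrow> ?R")
proof
  assume pos: "positive_mat 2 B"
  have q: "0 \<le> (B $$ (0, 0) * x + B $$ (0, 1) * y) * cnj x + (B $$ (1, 0) * x + B $$ (1, 1) * y) * cnj y" for x y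
  proof -
    define v where "v = Matrix.vec 2 (\<lambda>i :: nat. if i = 0 then x else y)"
    have v: "v \<in> carrier_vec 2" "v $ 0 = x" "v $ 1 = y" by (simp_all add: v_def)
    have "0 \<le> (B *\<^sub>v v) \<bullet>c v" using pos v(1) unfolding positive_mat_def by blast
    then show ?thesis unfolding quadratic_form_2[OF B v(1)] v(2,3) .
  qed
  define p r where "p = Re (B $$ (0, 0))" and "r = Re (B $$ (1, 1))"
  let ?b = "B $$ (0, 1)"
  have "0 \<le> B $$ (0, 0)" "0 \<le> B $$ (1, 1)"
    using q[of 1 0] q[of 0 1] by simp_all
  then have p: "B $$ (0, 0) = of_real p" "0 \<le> p" and r: "B $$ (1, 1) = of_real r" "0 \<le> r"
    by (simp_all only: p_def r_def less_eq_complex_def complex_eq_iff) simp_all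
  have "0 \<le> of_real p + ?b + (B $$ (1, 0) + of_real r)"
    "0 \<le> of_real p + ?b * \<i> + (B $$ (1, 0) + of_real r * \<i>) * - \<i>"
    using q[of 1 1] q[of 1 \<i>] unfolding p(1) r(1) by simp_all
  then have b: "B $$ (1, 0) = cnj ?b"
    by (simp add: less_eq_complex_def complex_eq_iff)
  have form: "0 \<le> p * s\<^sup>2 * (cmod ?b)\<^sup>2 + r * t\<^sup>2 - 2 * s * t * (cmod ?b)\<^sup>2" for s t :: real
  proof -
    have "(of_real p * (of_real s * z) + z * - of_real t) * cnj (of_real s * z) +
        (cnj z * (of_real s * z) + of_real r * - of_real t) * cnj (- of_real t) =
        of_real p * (of_real s)\<^sup>2 * (z * cnj z) + of_real r * (of_real t)\<^sup>2 - 2 * of_real s * of_real t * (z * cnj z)"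
      for z by (simp add: algebra_simps power2_eq_square)
    also have "of_real p * (of_real s)\<^sup>2 * (z * cnj z) + of_real r * (of_real t)\<^sup>2 - 2 * of_real s * of_real t * (z * cnj z) =
        of_real (p * s\<^sup>2 * (cmod z)\<^sup>2 + r * t\<^sup>2 - 2 * s * t * (cmod z)\<^sup>2)" for z
      by (simp only: complex_norm_square[symmetric] of_real_add of_real_diff of_real_mult of_real_power of_real_numeral)
    finally show ?thesis
      using q[of "of_real s * ?b" "- of_real t"] unfolding p r b by (simp only: less_eq_complex_def) simp
  qed
  have "(cmod ?b)\<^sup>2 \<le> p * r"
  proof (cases "p = 0")
    case True
    have "?b = 0"
    proof (rule ccontr)
      assume "?b \<noteq> 0"
      \<comment> \<open>With p = 0 these parameters turn the form into a negative number.\<close>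
      then have "0 \<le> r - 2 * (r + 1)"
        using form[of "(r + 1) / (cmod ?b)\<^sup>2" 1] True by simp
      then show False using r(2) by simp
    qed
    then show ?thesis using True by simp
  next
    case False
    then have "0 \<le> p * (p * r - (cmod ?b)\<^sup>2)"
      using form[of 1 p] by (simp add: algebra_simps power2_eq_square)
    then show ?thesis using p False by (simp add: zero_le_mult_iff)
  qed
  with p r b show ?R by blast
next
  assume ?R
  then obtain p r where h: "0 \<le> p" "0 \<le> r" "B $$ (0, 0) = of_real p" "B $$ (1, 1) = of_real r"
    "B $$ (1, 0) = cnj (B $$ (0, 1))" "(cmod (B $$ (0, 1)))\<^sup>2 \<le> p * r" by blast
  let ?b = "B $$ (0, 1)"
  have "0 \<le> (B *\<^sub>v v) \<bullet>c v" if v: "v \<in> carrier_vec 2" for v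
  proof -
    let ?x = "v $ 0" and ?y = "v $ 1"
    have "(B *\<^sub>v v) \<bullet>c v = of_real (p * (cmod ?x)\<^sup>2 + r * (cmod ?y)\<^sup>2 + 2 * Re (?b * ?y * cnj ?x))"
    proof -
      have "(of_real p * x + b * y) * cnj x + (cnj b * x + of_real r * y) * cnj y =
          of_real p * (x * cnj x) + of_real r * (y * cnj y) + (b * y * cnj x + cnj (b * y * cnj x))" for b x y
        by (simp add: algebra_simps)
      then show ?thesis
        unfolding quadratic_form_2[OF B v] h
        by (simp only: complex_norm_square[symmetric] complex_add_cnj of_real_add of_real_mult)
    qed
    moreover have "0 \<le> p * (cmod ?x)\<^sup>2 + r * (cmod ?y)\<^sup>2 + 2 * Re (?b * ?y * cnj ?x)"
    proof -
      have "cmod ?b \<le> sqrt (p * r)" using h(6) by (rule real_le_rsqrt)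
      then have "cmod (?b * ?y * cnj ?x) \<le> (sqrt p * cmod ?x) * (sqrt r * cmod ?y)"
        using mult_right_mono[of "cmod ?b" "sqrt (p * r)" "cmod ?x * cmod ?y"]
        by (simp add: norm_mult real_sqrt_mult mult_ac)
      moreover have "2 * ((sqrt p * cmod ?x) * (sqrt r * cmod ?y)) \<le> p * (cmod ?x)\<^sup>2 + r * (cmod ?y)\<^sup>2"
        using sum_squares_bound[of "sqrt p * cmod ?x" "sqrt r * cmod ?y"] h(1,2)
        by (simp add: power_mult_distrib)
      moreover have "- cmod (?b * ?y * cnj ?x) \<le> Re (?b * ?y * cnj ?x)"
        using abs_Re_le_cmod[of "?b * ?y * cnj ?x"] by simp
      ultimately show ?thesis by linarith
    qed
    ultimately show ?thesis by (simp add: less_eq_complex_def)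
  qed
  then show "positive_mat 2 B" using B by (simp add: positive_mat_def)
qed

text \<open>Cayley-Hamilton for the root B: A + D = t B with D = det B = sqrt (det A) and t = tr B =
  sqrt (tr A + 2 D). For t > 0 this both constructs and determines B; t = 0 forces B = 0.\<close>

lemma sqrt_mat_2:
  assumes A: "A \<in> carrier_mat 2 2" and n: "0 \<le> n1" "0 \<le> n2"
    and A00: "A $$ (0, 0) = of_real n1" and A11: "A $$ (1, 1) = of_real n2"
    and A10: "A $$ (1, 0) = cnj (A $$ (0, 1))" and le: "(cmod (A $$ (0, 1)))\<^sup>2 \<le> n1 * n2"
  shows "Re (mat_trace (sqrt_mat 2 A)) = sqrt_trace n1 n2 (A $$ (0, 1))"
proof -
  let ?b = "A $$ (0, 1)"
  have one2: "1 < (2 :: nat)" by simp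
  define D where "D = sqrt (n1 * n2 - (cmod ?b)\<^sup>2)"
  define t where "t = sqrt (n1 + n2 + 2 * D)"
  have D: "0 \<le> D" "D\<^sup>2 = n1 * n2 - (cmod ?b)\<^sup>2" using le by (simp_all add: D_def)
  have t: "0 \<le> t" "t\<^sup>2 = n1 + n2 + 2 * D" using n D by (simp_all add: t_def)
  have sol: "\<exists>p r. 0 \<le> p \<and> 0 \<le> r \<and> B $$ (0, 0) = of_real p \<and> B $$ (1, 1) = of_real r \<and>
      B $$ (1, 0) = cnj (B $$ (0, 1)) \<and> (cmod (B $$ (0, 1)))\<^sup>2 \<le> p * r \<and> p + r = t \<and> t * p = n1 + D \<and>
      t * r = n2 + D \<and> of_real t * B $$ (0, 1) = ?b" if pos: "positive_mat 2 B" and sq: "B * B = A" for B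
  proof -
    have B: "B \<in> carrier_mat 2 2" using pos by (simp add: positive_mat_def)
    obtain p r where h: "0 \<le> p" "0 \<le> r" "B $$ (0, 0) = of_real p" "B $$ (1, 1) = of_real r"
      "B $$ (1, 0) = cnj (B $$ (0, 1))" "(cmod (B $$ (0, 1)))\<^sup>2 \<le> p * r"
      using pos positive_mat_2_iff[OF B] by blast
    let ?q = "B $$ (0, 1)"
    have "complex_of_real n1 = of_real (p\<^sup>2 + (cmod ?q)\<^sup>2)"
      using mat_mult_2[OF B B, of 0 0] unfolding sq A00 h of_real_add complex_norm_square
      by (simp add: power2_eq_square)
    then have n1: "n1 = p\<^sup>2 + (cmod ?q)\<^sup>2" by (simp only: of_real_eq_iff)
    have "complex_of_real n2 = of_real (r\<^sup>2 + (cmod ?q)\<^sup>2)"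
      using mat_mult_2[OF B B, of 1 1] unfolding sq A11 h of_real_add complex_norm_square
      by (simp add: power2_eq_square mult.commute)
    then have n2: "n2 = r\<^sup>2 + (cmod ?q)\<^sup>2" by (simp only: of_real_eq_iff)
    have b: "?b = of_real (p + r) * ?q"
      using mat_mult_2[OF B B, of 0 1] unfolding sq h by (simp add: algebra_simps)
    have "cmod ?b = (p + r) * cmod ?q" unfolding b norm_mult norm_of_real using h(1,2) by simp
    then have "n1 * n2 - (cmod ?b)\<^sup>2 = (p * r - (cmod ?q)\<^sup>2)\<^sup>2"
      by (simp add: n1 n2 power2_eq_square algebra_simps)
    then have D': "D = p * r - (cmod ?q)\<^sup>2" using h(6) by (simp add: D_def)
    have "n1 + n2 + 2 * D = (p + r)\<^sup>2"
      by (simp add: n1 n2 D' power2_eq_square algebra_simps)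
    then have t': "t = p + r" using h(1,2) by (simp add: t_def)
    show ?thesis
      using h b by (intro exI[of _ p] exI[of _ r]) (simp add: t' D' n1 n2 power2_eq_square algebra_simps)
  qed
  have "\<exists>B. positive_mat 2 B \<and> B * B = A"
  proof (cases "t = 0")
    case True
    then have "n1 = 0" "n2 = 0" using t n D by (auto simp: add_nonneg_eq_0_iff)
    then have "A = 0\<^sub>m 2 2" using A A00 A11 A10 le by (intro eq_mat_2) auto
    moreover have "positive_mat 2 (0\<^sub>m 2 2)" by (subst positive_mat_2_iff) auto
    ultimately show ?thesis by (intro exI[of _ "0\<^sub>m 2 2"]) auto
  next
    case False
    then have t0: "0 < t" using t by simp
    define p r q where "p = (n1 + D) / t" "r = (n2 + D) / t" "q = ?b / of_real t"
    define B where "B = Matrix.mat 2 2 (\<lambda>(i, j). if i = 0 then if j = 0 then of_real p else q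
      else if j = 0 then cnj q else of_real r)"
    have B: "B \<in> carrier_mat 2 2" by (simp add: B_def)
    have ent: "B $$ (0, 0) = of_real p" "B $$ (0, 1) = q" "B $$ (1, 0) = cnj q" "B $$ (1, 1) = of_real r"
      by (simp_all add: B_def)
    have pr: "0 \<le> p" "0 \<le> r" using n D t0 by (simp_all add: p_r_q_def)
    have q2: "(cmod q)\<^sup>2 = (cmod ?b)\<^sup>2 / t\<^sup>2" using t0 by (simp add: p_r_q_def norm_divide power_divide)
    have "p + r = t\<^sup>2 / t" unfolding t(2) by (simp add: p_r_q_def add_divide_distrib)
    then have sum: "p + r = t" using t0 by (simp add: power2_eq_square)
    have "p * r - (cmod q)\<^sup>2 = (n1 * n2 + D * (n1 + n2) + D\<^sup>2 - (cmod ?b)\<^sup>2) / t\<^sup>2"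
      unfolding q2 by (simp add: p_r_q_def power2_eq_square algebra_simps add_divide_distrib diff_divide_distrib)
    also have "n1 * n2 + D * (n1 + n2) + D\<^sup>2 - (cmod ?b)\<^sup>2 = D * t\<^sup>2"
      unfolding t(2) using D(2) by (simp add: algebra_simps power2_eq_square)
    finally have det: "p * r - (cmod q)\<^sup>2 = D" using t0 by simp
    have "p * p + (cmod q)\<^sup>2 = p * (p + r) - D" "r * r + (cmod q)\<^sup>2 = r * (p + r) - D"
      using det by (simp_all add: algebra_simps)
    then have n12: "p * p + (cmod q)\<^sup>2 = n1" "r * r + (cmod q)\<^sup>2 = n2"
      unfolding sum using t0 by (simp_all add: p_r_q_def)
    have "positive_mat 2 B"
      unfolding positive_mat_2_iff[OF B] ent
      using pr det D by (intro exI[of _ p] exI[of _ r]) auto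
    moreover have "B * B = A"
    proof (rule eq_mat_2[OF _ A])
      show "(B * B) $$ (0, 0) = A $$ (0, 0)"
        unfolding mat_mult_2[OF B B zero_less_numeral zero_less_numeral] ent A00 n12(1)[symmetric]
        by (simp add: complex_norm_square[symmetric] flip: of_real_power)
      show "(B * B) $$ (1, 1) = A $$ (1, 1)"
        unfolding mat_mult_2[OF B B one2 one2] ent A11 n12(2)[symmetric]
        by (simp add: complex_norm_square[symmetric] mult.commute flip: of_real_power)
      have "of_real p * q + q * of_real r = q * of_real (p + r)" by (simp add: algebra_simps)
      also have "\<dots> = ?b" unfolding sum using t0 by (simp add: p_r_q_def)
      finally have *: "of_real p * q + q * of_real r = ?b" .
      then show "(B * B) $$ (0, 1) = ?b"
        using mat_mult_2[OF B B, of 0 1] ent by simp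
      show "(B * B) $$ (1, 0) = A $$ (1, 0)"
        using mat_mult_2[OF B B, of 1 0] ent arg_cong[OF *, of cnj] A10 by (simp add: mult.commute add.commute)
    qed (use B in simp)
    ultimately show ?thesis by blast
  qed
  then obtain B where B: "positive_mat 2 B" "B * B = A" by blast
  have uniq: "B' = B" if pos': "positive_mat 2 B'" and sq': "B' * B' = A" for B'
  proof -
    obtain p r p' r' where h: "B $$ (0, 0) = of_real p" "B $$ (1, 1) = of_real r"
      "B $$ (1, 0) = cnj (B $$ (0, 1))" "t * p = n1 + D" "t * r = n2 + D" "of_real t * B $$ (0, 1) = ?b"
      "B' $$ (0, 0) = of_real p'" "B' $$ (1, 1) = of_real r'"
      "B' $$ (1, 0) = cnj (B' $$ (0, 1))" "t * p' = n1 + D" "t * r' = n2 + D" "of_real t * B' $$ (0, 1) = ?b"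
      and z: "0 \<le> p" "0 \<le> r" "p + r = t" "(cmod (B $$ (0, 1)))\<^sup>2 \<le> p * r"
        "0 \<le> p'" "0 \<le> r'" "p' + r' = t" "(cmod (B' $$ (0, 1)))\<^sup>2 \<le> p' * r'"
      using sol[OF B] sol[OF pos' sq'] by metis
    have "p = p' \<and> r = r' \<and> B $$ (0, 1) = B' $$ (0, 1)"
    proof (cases "t = 0")
      case True
      then have 0: "p = 0" "r = 0" "p' = 0" "r' = 0" using z by auto
      have "(cmod (B $$ (0, 1)))\<^sup>2 \<le> 0" "(cmod (B' $$ (0, 1)))\<^sup>2 \<le> 0"
        using z(4,8) unfolding 0 by simp_all
      then show ?thesis using 0 by simp
    next
      case False
      then show ?thesis
        using h by (metis mult_left_cancel of_real_eq_0_iff)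
    qed
    then show ?thesis
      using h B pos' by (intro eq_mat_2) (auto simp: positive_mat_def)
  qed
  have "sqrt_mat 2 A = B"
    unfolding sqrt_mat_def by (rule the_equality, rule conjI[OF B]) (elim conjE, rule uniq)
  moreover have "Re (mat_trace B) = t"
  proof -
    have dim: "dim_row B = 2" using B(1) by (auto simp: positive_mat_def)
    obtain p r where "B $$ (0, 0) = of_real p" "B $$ (1, 1) = of_real r" "p + r = t"
      using sol[OF B] by (elim exE conjE) (rule that)
    then show ?thesis unfolding mat_trace_def dim sum_lessThan_2 by simp
  qed
  ultimately show ?thesis by (simp add: t_def D_def sqrt_trace_def)
qed

lemma mat_adjoint_2:
  assumes "A \<in> carrier_mat 2 2" "i < 2" "j < 2"
  shows "mat_adjoint A $$ (i, j) = cnj (A $$ (j, i))"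
  using assms by (simp add: mat_adjoint_def mat_of_rows_def)

lemma mat_adjoint_carrier_2: "A \<in> carrier_mat 2 2 \<Longrightarrow> mat_adjoint A \<in> carrier_mat 2 2"
  by (auto simp: mat_adjoint_def)

definition col_family :: "('m \<Rightarrow> complex mat) \<Rightarrow> nat \<Rightarrow> 'm \<times> nat \<Rightarrow> complex" where
  "col_family X j = (\<lambda>(k, i). X k $$ (i, j))"

text \<open>The conjugation makes the Gram matrix of the rows equal to the sum of X X* rather than
  to its conjugate.\<close>

definition row_family :: "('m \<Rightarrow> complex mat) \<Rightarrow> nat \<Rightarrow> 'm \<times> nat \<Rightarrow> complex" where
  "row_family X i = (\<lambda>(k, j). cnj (X k $$ (i, j)))"

lemma gram_pairs:
  "gram (S \<times> {..<2}) u v =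
    (\<Sum>k\<in>S. cnj (u (k, 0)) * v (k, 0) + cnj (u (k, 1)) * v (k, 1 :: nat))"
proof -
  have "gram (S \<times> {..<2}) u v = (\<Sum>(k, i)\<in>S \<times> {..<2}. cnj (u (k, i)) * v (k, i))"
    by (simp add: gram_def case_prod_unfold)
  then show ?thesis unfolding sum.cartesian_product[symmetric] sum_lessThan_2 .
qed

lemma mat_sum_col:
  assumes "\<forall>k\<in>S. X k \<in> carrier_mat 2 2" "a < 2" "b < 2"
  shows "mat_sum 2 S (\<lambda>k. mat_adjoint (X k) * X k) $$ (a, b) =
    gram (S \<times> {..<2}) (col_family X a) (col_family X b)"
proof -
  have "(mat_adjoint (X k) * X k) $$ (a, b) = (\<Sum>i<2. cnj (X k $$ (i, a)) * X k $$ (i, b))"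
    if "k \<in> S" for k
  proof -
    have X: "X k \<in> carrier_mat 2 2" using assms(1) that by blast
    show ?thesis
      unfolding mat_mult_2[OF mat_adjoint_carrier_2[OF X] X assms(2,3)] sum_lessThan_2
      using mat_adjoint_2[OF X assms(2)] by simp
  qed
  then show ?thesis
    using assms by (simp add: mat_sum_def gram_def col_family_def sum.cartesian_product case_prod_unfold)
qed

lemma mat_sum_row:
  assumes "\<forall>k\<in>S. X k \<in> carrier_mat 2 2" "a < 2" "b < 2"
  shows "mat_sum 2 S (\<lambda>k. X k * mat_adjoint (X k)) $$ (a, b) =
    gram (S \<times> {..<2}) (row_family X a) (row_family X b)"
proof -
  have "(X k * mat_adjoint (X k)) $$ (a, b) = (\<Sum>j<2. X k $$ (a, j) * cnj (X k $$ (b, j)))"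
    if "k \<in> S" for k
  proof -
    have X: "X k \<in> carrier_mat 2 2" using assms(1) that by blast
    show ?thesis
      unfolding mat_mult_2[OF X mat_adjoint_carrier_2[OF X] assms(2,3)] sum_lessThan_2
      using mat_adjoint_2[OF X _ assms(3)] by simp
  qed
  then show ?thesis
    using assms by (simp add: mat_sum_def gram_def row_family_def sum.cartesian_product case_prod_unfold)
qed

lemma sqrt_mat_gram:
  assumes "A \<in> carrier_mat 2 2" "\<And>i j. i < 2 \<Longrightarrow> j < 2 \<Longrightarrow> A $$ (i, j) = gram K (f i) (f j)"
  shows "Re (mat_trace (sqrt_mat 2 A)) =
    sqrt_trace (Re (gram K (f 0) (f 0))) (Re (gram K (f 1) (f 1))) (gram K (f 0) (f 1))"
proof -
  have "Re (mat_trace (sqrt_mat 2 A)) =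
      sqrt_trace (Re (gram K (f 0) (f 0))) (Re (gram K (f 1) (f 1))) (A $$ (0, 1))"
    using gram_psd(1)[of K] gram_psd(2)[of K] gram_psd(3)[of K "f 0" "f 1"] gram_commute[of K "f 1" "f 0"]
    by (intro sqrt_mat_2[OF assms(1)]) (auto simp: assms(2))
  then show ?thesis by (simp add: assms(2))
qed

text \<open>Pairing C = X + Y with C itself gives 2 a as the real trace of the sum of C* X plus that
  of the sum of C* Y. By trace duality the first is at most sqrt a times the column term of X, the
  second at most sqrt a times the row term of Y.\<close>

lemma S1_norm_ge:
  assumes C: "\<forall>k\<in>S. C k \<in> carrier_mat 2 2" and a: "0 < a"
    and col: "mat_sum 2 S (\<lambda>k. mat_adjoint (C k) * C k) = of_real a \<cdot>\<^sub>m 1\<^sub>m 2"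
    and row: "mat_sum 2 S (\<lambda>k. C k * mat_adjoint (C k)) = of_real a \<cdot>\<^sub>m 1\<^sub>m 2"
  shows "2 * sqrt a \<le> S1_norm 2 S C"
  unfolding S1_norm_def
proof (rule cInf_greatest, goal_cases)
  case 1
  \<comment> \<open>The infimum is over a nonempty set: take X = C and Y = 0.\<close>
  show ?case
    unfolding ex_in_conv[symmetric] mem_Collect_eq
    by (rule exI, rule exI[of _ C], rule exI[of _ "\<lambda>_. 0\<^sub>m 2 2"], rule conjI[OF refl]) (use C in auto)
next
  case (2 v)
  from 2[unfolded mem_Collect_eq] obtain X Y where v: "v = Re (mat_trace (sqrt_mat 2 (mat_sum 2 S (\<lambda>k. mat_adjoint (X k) * X k)))) +
      Re (mat_trace (sqrt_mat 2 (mat_sum 2 S (\<lambda>k. Y k * mat_adjoint (Y k)))))"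
    and XY: "\<forall>k\<in>S. X k \<in> carrier_mat 2 2 \<and> Y k \<in> carrier_mat 2 2 \<and> C k = X k + Y k"
    by (elim exE conjE) (rule that)
  from XY have XC: "\<forall>k\<in>S. X k \<in> carrier_mat 2 2" and YC: "\<forall>k\<in>S. Y k \<in> carrier_mat 2 2"
    by blast+
  let ?K = "S \<times> {..<2 :: nat}"
  let ?c = "col_family C" and ?x = "col_family X" and ?r = "row_family C" and ?y = "row_family Y"
  have c: "gram ?K (?c i) (?c j) = (if i = j then of_real a else 0)" if "i < 2" "j < 2" for i j
    using mat_sum_col[OF C that] that unfolding col by auto
  have r: "gram ?K (?r i) (?r j) = (if i = j then of_real a else 0)" if "i < 2" "j < 2" for i j
    using mat_sum_row[OF C that] that unfolding row by auto
  have "Re (mat_trace (sqrt_mat 2 (mat_sum 2 S (\<lambda>k. mat_adjoint (X k) * X k)))) =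
      sqrt_trace (Re (gram ?K (?x 0) (?x 0))) (Re (gram ?K (?x 1) (?x 1))) (gram ?K (?x 0) (?x 1))"
    by (rule sqrt_mat_gram[OF _ mat_sum_col[OF XC]]) (simp_all add: mat_sum_def)
  then have 1: "Re (gram ?K (?c 0) (?x 0) + gram ?K (?c 1) (?x 1)) \<le>
      sqrt a * Re (mat_trace (sqrt_mat 2 (mat_sum 2 S (\<lambda>k. mat_adjoint (X k) * X k))))"
    using gram_trace_duality[OF a, of ?K "?c 0" "?c 1" "?x 0" "?x 1"] c by simp
  have "Re (mat_trace (sqrt_mat 2 (mat_sum 2 S (\<lambda>k. Y k * mat_adjoint (Y k))))) =
      sqrt_trace (Re (gram ?K (?y 0) (?y 0))) (Re (gram ?K (?y 1) (?y 1))) (gram ?K (?y 0) (?y 1))"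
    by (rule sqrt_mat_gram[OF _ mat_sum_row[OF YC]]) (simp_all add: mat_sum_def)
  then have 2: "Re (gram ?K (?r 0) (?y 0) + gram ?K (?r 1) (?y 1)) \<le>
      sqrt a * Re (mat_trace (sqrt_mat 2 (mat_sum 2 S (\<lambda>k. Y k * mat_adjoint (Y k)))))"
    using gram_trace_duality[OF a, of ?K "?r 0" "?r 1" "?y 0" "?y 1"] r by simp
  have ent: "C k $$ (i, j) = X k $$ (i, j) + Y k $$ (i, j)" if "k \<in> S" "i < 2" "j < 2" for k i j
    using XY that by (metis carrier_matD index_add_mat(1))
  \<comment> \<open>Pairing by rows is the conjugate of pairing by columns, so the real parts
    agree.\<close>
  have rows: "Re (gram ?K (?r 0) (?y 0) + gram ?K (?r 1) (?y 1)) =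
      Re (gram ?K (?c 0) (col_family Y 0) + gram ?K (?c 1) (col_family Y 1))"
    unfolding gram_pairs by (simp add: col_family_def row_family_def sum.distrib mult.commute add_ac)
  have "gram ?K (?c j) (?x j) + gram ?K (?c j) (col_family Y j) = gram ?K (?c j) (?c j)" if "j < 2" for j
    unfolding gram_def sum.distrib[symmetric]
    by (rule sum.cong) (use ent that in \<open>auto simp: col_family_def algebra_simps\<close>)
  from this[of 0] this[of 1] have "Re (gram ?K (?c 0) (?x 0) + gram ?K (?c 1) (?x 1)) +
      Re (gram ?K (?c 0) (col_family Y 0) + gram ?K (?c 1) (col_family Y 1)) = 2 * a"
    using c[of 0 0] c[of 1 1] by (simp add: complex_eq_iff)
  then have av: "2 * a \<le> sqrt a * v"
    using 1 2 rows unfolding v by (simp add: algebra_simps)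
  have aa: "sqrt a * (2 * sqrt a) = 2 * a"
    using a by simp
  have "sqrt a * (2 * sqrt a) \<le> sqrt a * v"
    unfolding aa by (rule av)
  then show ?case by (rule mult_left_le_imp_le) (use a in simp)
qed

section \<open>Square roots of positive operators\<close>

text \<open>Only the real Hilbert space structure enters; complex homogeneity of the root is
  recovered later from its commuting with multiplication by scalars.\<close>

locale positive_contraction =
  fixes B :: "'a::{real_inner, banach} \<Rightarrow> 'a"
  assumes bounded_linear_B: "bounded_linear B"
    and symm: "B v \<bullet> w = v \<bullet> B w"
    and pos: "0 \<le> B v \<bullet> v"
    and contr: "norm (B v) \<le> norm v"
begin

lemma linear_B: "linear B"
  using bounded_linear_B by (simp add: bounded_linear.linear)

lemma norm_pow_le: "norm ((B ^^ k) v) \<le> norm v"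
  by (induction k) (auto intro: contr order_trans)

lemma bounded_linear_pow: "bounded_linear (B ^^ k)"
proof (induction k)
  case (Suc k)
  then show ?case
    using bounded_linear_compose[OF bounded_linear_B Suc] by (simp add: o_def)
qed (simp add: id_def bounded_linear_ident)

lemma sym_pow: "(B ^^ k) v \<bullet> w = v \<bullet> (B ^^ k) w"
proof (induction k arbitrary: w)
  case (Suc k)
  have "(B ^^ Suc k) v \<bullet> w = (B ^^ k) v \<bullet> B w" by (simp add: symm)
  then show ?case by (simp add: Suc funpow_swap1)
qed simp

text \<open>Even powers give the square of a norm, odd powers the form of B at some B^j v. This
  positivity is what makes a truncated series an upper bound.\<close>

lemma pos_pow: "0 \<le> (B ^^ k) v \<bullet> v"
proof -
  have "(B ^^ (2 * j)) v \<bullet> v = (B ^^ j) v \<bullet> (B ^^ j) v" for j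
    by (simp add: mult_2 funpow_add sym_pow)
  moreover have "(B ^^ (2 * j + 1)) v \<bullet> v = B ((B ^^ j) v) \<bullet> (B ^^ j) v" for j
    by (metis (no_types, lifting) Suc_eq_plus1 add_Suc_right comp_apply funpow.simps(2) funpow_add
        funpow_swap1 mult_2 sym_pow)
  ultimately show ?thesis
    by (cases "even k") (auto elim!: evenE oddE simp: pos)
qed

lemma summable_series: "summable (\<lambda>k. sqrt_coeff k *\<^sub>R (B ^^ k) v)"
proof (rule summable_comparison_test)
  show "summable (\<lambda>k. \<bar>sqrt_coeff k\<bar> * norm v)"
    by (intro summable_mult2 summable_abs_sqrt_coeff)
  show "\<exists>N. \<forall>n\<ge>N. norm (sqrt_coeff n *\<^sub>R (B ^^ n) v) \<le> \<bar>sqrt_coeff n\<bar> * norm v"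
    by (auto intro!: mult_left_mono norm_pow_le)
qed

definition sqrt_one_minus :: "'a \<Rightarrow> 'a" where
  "sqrt_one_minus v = (\<Sum>k. sqrt_coeff k *\<^sub>R (B ^^ k) v)"

lemma root_sums: "(\<lambda>k. sqrt_coeff k *\<^sub>R (B ^^ k) v) sums sqrt_one_minus v"
  unfolding sqrt_one_minus_def by (rule summable_sums[OF summable_series])

lemma norm_root_le: "norm (sqrt_one_minus v) \<le> 2 * norm v"
proof -
  have s: "summable (\<lambda>k. \<bar>sqrt_coeff k\<bar> * norm v)"
    by (intro summable_mult2 summable_abs_sqrt_coeff)
  have "norm (sqrt_one_minus v) \<le> (\<Sum>k. \<bar>sqrt_coeff k\<bar> * norm v)"
    unfolding sqrt_one_minus_def
    by (rule norm_suminf_le[OF _ s]) (auto intro: mult_left_mono norm_pow_le)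
  also have "\<dots> = (\<Sum>k. \<bar>sqrt_coeff k\<bar>) * norm v"
    by (rule suminf_mult2[symmetric, OF summable_abs_sqrt_coeff])
  also have "\<dots> \<le> 2 * norm v"
    by (intro mult_right_mono suminf_abs_sqrt_coeff_le) simp
  finally show ?thesis .
qed

lemma root_commute:
  assumes "bounded_linear C" and "\<And>v. C (B v) = B (C v)"
  shows "C (sqrt_one_minus v) = sqrt_one_minus (C v)"
proof -
  have "C ((B ^^ k) v) = (B ^^ k) (C v)" for k
    by (induction k) (auto simp: assms(2))
  then have "(\<lambda>k. sqrt_coeff k *\<^sub>R (B ^^ k) (C v)) sums C (sqrt_one_minus v)"
    using bounded_linear.sums[OF assms(1) root_sums[of v]]
    by (simp add: linear_scale[OF bounded_linear.linear[OF assms(1)]])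
  then show ?thesis
    using root_sums[of "C v"] by (rule sums_unique2)
qed

lemma bounded_linear_root: "bounded_linear sqrt_one_minus"
proof (rule bounded_linear_intro[where K = 2])
  show "sqrt_one_minus (x + y) = sqrt_one_minus x + sqrt_one_minus y" for x y
    by (rule sums_unique2[OF root_sums])
      (use sums_add[OF root_sums[of x] root_sums[of y]] in
        \<open>simp add: bounded_linear.linear[OF bounded_linear_pow] linear_add scaleR_add_right\<close>)
  show "sqrt_one_minus (r *\<^sub>R x) = r *\<^sub>R sqrt_one_minus x" for r x
    using root_commute[OF bounded_linear_scaleR_right[of r], of x]
    by (simp add: linear_scale[OF linear_B])
qed (metis norm_root_le mult.commute)

lemma root_inner_sums: "(\<lambda>k. sqrt_coeff k * ((B ^^ k) v \<bullet> w)) sums (sqrt_one_minus v \<bullet> w)"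
  using bounded_linear.sums[OF bounded_linear_inner_left root_sums[of v]] by simp

lemma root_sym: "sqrt_one_minus v \<bullet> w = v \<bullet> sqrt_one_minus w"
proof (rule sums_unique2[OF root_inner_sums])
  show "(\<lambda>k. sqrt_coeff k * ((B ^^ k) v \<bullet> w)) sums (v \<bullet> sqrt_one_minus w)"
    using root_inner_sums[of w v] by (simp only: sym_pow inner_commute[of v])
qed

text \<open>Each discarded term is a negative coefficient times a nonnegative moment. Through this
  one-sided estimate the L1 norm gets bounded by finitely many moments.\<close>

lemma root_inner_le: "sqrt_one_minus v \<bullet> v \<le> (\<Sum>k\<le>N. sqrt_coeff k * ((B ^^ k) v \<bullet> v))"
proof -
  have s: "summable (\<lambda>k. sqrt_coeff k * ((B ^^ k) v \<bullet> v))"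
    using root_inner_sums[of v v] by (simp add: sums_iff)
  have "sqrt_coeff (k + Suc N) * ((B ^^ (k + Suc N)) v \<bullet> v) \<le> 0" for k
    using sqrt_coeff_Suc_neg[of "k + N"] pos_pow by (intro mult_nonpos_nonneg) (auto simp del: funpow.simps)
  then have "(\<Sum>k. sqrt_coeff (k + Suc N) * ((B ^^ (k + Suc N)) v \<bullet> v)) \<le> 0"
    by (intro suminf_le_const[OF summable_ignore_initial_segment[OF s]] sum_nonpos)
  then show ?thesis
    using suminf_split_initial_segment[OF s, of "Suc N"] root_inner_sums[of v v]
    by (simp add: sums_iff lessThan_Suc_atMost)
qed

text \<open>Contractivity bounds all moments by the one of degree 0, so each partial sum is at least
  its value at y = 1 times that moment.\<close>

lemma root_pos: "0 \<le> sqrt_one_minus v \<bullet> v"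
proof (rule LIMSEQ_le_const)
  show "(\<lambda>n. \<Sum>k\<le>n. sqrt_coeff k * ((B ^^ k) v \<bullet> v)) \<longlonglongrightarrow> sqrt_one_minus v \<bullet> v"
    using root_inner_sums[of v v] by (simp add: sums_def_le)
  have "0 \<le> (\<Sum>k\<le>n. sqrt_coeff k * ((B ^^ k) v \<bullet> v))" for n
  proof -
    have le: "(B ^^ k) v \<bullet> v \<le> v \<bullet> v" for k
    proof -
      have "(B ^^ k) v \<bullet> v \<le> norm ((B ^^ k) v) * norm v" by (rule norm_cauchy_schwarz)
      also have "\<dots> \<le> norm v * norm v" by (intro mult_right_mono norm_pow_le) simp
      finally show ?thesis by (simp add: power2_eq_square power2_norm_eq_inner flip: power2_eq_square)
    qed
    have "(\<Sum>k\<le>n. sqrt_coeff k * (v \<bullet> v)) \<le> (\<Sum>k\<le>n. sqrt_coeff k * ((B ^^ k) v \<bullet> v))"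
    proof (rule sum_mono)
      show "sqrt_coeff k * (v \<bullet> v) \<le> sqrt_coeff k * ((B ^^ k) v \<bullet> v)" for k
        by (cases k) (use le[of k] sqrt_coeff_Suc_neg in \<open>auto intro: mult_left_mono_neg less_imp_le\<close>)
    qed
    moreover have "0 \<le> (\<Sum>k\<le>n. sqrt_coeff k) * (v \<bullet> v)"
      using sum_abs_sqrt_coeff_le[of n] by (intro mult_nonneg_nonneg) (simp_all add: sum_abs_sqrt_coeff)
    ultimately show ?thesis
      unfolding sum_distrib_right by (rule order_trans[rotated])
  qed
  then show "\<exists>N. \<forall>n\<ge>N. 0 \<le> (\<Sum>k\<le>n. sqrt_coeff k * ((B ^^ k) v \<bullet> v))" by blast
qed

text \<open>Absolute summability of the double family permits regrouping by n = k + j, where the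
  convolution identity leaves only the terms n = 0 and n = 1.\<close>

lemma sqrt_one_minus_square: "sqrt_one_minus (sqrt_one_minus v) = v - B v"
proof -
  let ?c = sqrt_coeff
  let ?f = "\<lambda>k j. (?c k * ?c j) *\<^sub>R (B ^^ (k + j)) v"
  have abs: "(\<lambda>k. \<bar>?c k\<bar>) summable_on UNIV"
    using summable_abs_sqrt_coeff by (simp add: summable_on_UNIV_nonneg_real_iff)
  have "(\<lambda>p. norm (\<bar>?c (fst p)\<bar> * \<bar>?c (snd p)\<bar>)) summable_on UNIV \<times> UNIV"
    unfolding Infinite_Sum.abs_summable_on_Sigma_iff using abs
    by (simp add: infsum_cmult_right' summable_on_cmult_right summable_on_cmult_left infsum_nonneg)
  then have "(\<lambda>p. \<bar>?c (fst p)\<bar> * \<bar>?c (snd p)\<bar> * norm v) summable_on UNIV \<times> UNIV"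
    by (intro summable_on_cmult_left) simp
  then have "(\<lambda>p. norm (?f (fst p) (snd p))) summable_on UNIV \<times> UNIV"
    by (rule summable_on_comparison_test)
      (auto simp: abs_mult intro!: mult_left_mono norm_pow_le)
  then have sumf: "(\<lambda>(k, j). ?f k j) summable_on UNIV \<times> UNIV"
    using abs_summable_summable by (fastforce simp: case_prod_unfold)
  have "summable (\<lambda>k. norm (?c k *\<^sub>R (B ^^ k) v))" for v
    by (rule summable_comparison_test'[OF summable_mult2[OF summable_abs_sqrt_coeff, of "norm v"]])
      (auto intro: mult_left_mono norm_pow_le)
  then have hs: "((\<lambda>k. ?c k *\<^sub>R (B ^^ k) v) has_sum sqrt_one_minus v) UNIV" for v
    by (rule norm_summable_imp_has_sum[OF _ root_sums])
  have "sqrt_one_minus (sqrt_one_minus v) = (\<Sum>\<^sub>\<infinity>k. ?c k *\<^sub>R (B ^^ k) (sqrt_one_minus v))"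
    by (rule infsumI[OF hs, symmetric])
  also have "\<dots> = (\<Sum>\<^sub>\<infinity>k. \<Sum>\<^sub>\<infinity>j. ?f k j)"
  proof (rule infsum_cong)
    fix k
    have "bounded_linear (\<lambda>x. ?c k *\<^sub>R (B ^^ k) x)"
      by (intro bounded_linear_const_scaleR bounded_linear_pow)
    then show "?c k *\<^sub>R (B ^^ k) (sqrt_one_minus v) = (\<Sum>\<^sub>\<infinity>j. ?f k j)"
      using infsumI[OF has_sum_bounded_linear[OF _ hs[of v]], of "\<lambda>x. ?c k *\<^sub>R (B ^^ k) x"]
      by (simp add: linear_scale[OF bounded_linear.linear[OF bounded_linear_pow]] funpow_add)
  qed
  also have "\<dots> = (\<Sum>\<^sub>\<infinity>(k, j)\<in>UNIV \<times> UNIV. ?f k j)"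
    using sumf by (rule infsum_Sigma'_banach)
  also have "\<dots> = (\<Sum>\<^sub>\<infinity>(n, i)\<in>Sigma UNIV (\<lambda>n. {..n}). ?f i (n - i))"
    by (rule infsum_reindex_bij_witness[of _ "\<lambda>(n, i). (i, n - i)" "\<lambda>(k, j). (k + j, k)"]) auto
  also have "\<dots> = (\<Sum>\<^sub>\<infinity>n. \<Sum>\<^sub>\<infinity>i\<in>{..n}. ?f i (n - i))"
  proof (rule infsum_Sigma'_banach[symmetric])
    show "(\<lambda>(n, i). ?f i (n - i)) summable_on Sigma UNIV (\<lambda>n. {..n})"
      using sumf
      by (subst summable_on_reindex_bij_witness[of _ "\<lambda>(k, j). (k + j, k)" "\<lambda>(n, i). (i, n - i)"
            "UNIV \<times> UNIV" "\<lambda>(k, j). ?f k j"]) auto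
  qed
  also have "\<dots> = (\<Sum>\<^sub>\<infinity>n. (if n = 0 then 1 else if n = 1 then - 1 else 0) *\<^sub>R (B ^^ n) v)"
    by (rule infsum_cong) (simp add: scaleR_sum_left flip: sqrt_coeff_convolution)
  also have "\<dots> = (\<Sum>\<^sub>\<infinity>n\<in>{0, 1}. (if n = 0 then 1 else if n = 1 then - 1 else 0) *\<^sub>R (B ^^ n) v)"
    by (rule infsum_cong_neutral) auto
  also have "\<dots> = v - B v" by simp
  finally show ?thesis .
qed

end

section \<open>Positive operators and the uniqueness of their square roots\<close>

definition pos_op :: "('a::real_inner \<Rightarrow> 'a) \<Rightarrow> bool" where
  "pos_op A \<longleftrightarrow> bounded_linear A \<and> (\<forall>v w. A v \<bullet> w = v \<bullet> A w) \<and> (\<forall>v. 0 \<le> A v \<bullet> v)"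

lemma pos_op_cauchy_schwarz:
  assumes "pos_op A"
  shows "(A v \<bullet> w)\<^sup>2 \<le> (A v \<bullet> v) * (A w \<bullet> w)"
proof -
  have lin: "linear A" and sym: "\<And>v w. A v \<bullet> w = v \<bullet> A w" and pos: "\<And>v. 0 \<le> A v \<bullet> v"
    using assms by (auto simp: pos_op_def bounded_linear.linear)
  have q: "0 \<le> (A v \<bullet> v) + 2 * t * (A v \<bullet> w) + t\<^sup>2 * (A w \<bullet> w)" for t
  proof -
    have "A (v + t *\<^sub>R w) \<bullet> (v + t *\<^sub>R w) = (A v \<bullet> v) + 2 * t * (A v \<bullet> w) + t\<^sup>2 * (A w \<bullet> w)"
      using sym[of w v]
      by (simp add: linear_add[OF lin] linear_scale[OF lin] inner_add_left inner_add_right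
          power2_eq_square algebra_simps inner_commute)
    then show ?thesis using pos[of "v + t *\<^sub>R w"] by simp
  qed
  show ?thesis
  proof (cases "A w \<bullet> w = 0")
    case True
    have "A v \<bullet> w = 0"
    proof (rule ccontr)
      assume "A v \<bullet> w \<noteq> 0"
      \<comment> \<open>The chosen parameter turns the quadratic form into -1.\<close>
      then show False
        using q[of "- (A v \<bullet> v + 1) / (2 * (A v \<bullet> w))"] True by (simp add: field_simps)
    qed
    then show ?thesis using True by simp
  next
    case False
    then have w: "0 < A w \<bullet> w" using pos[of w] by simp
    have "0 \<le> ((A v \<bullet> v) + 2 * (- (A v \<bullet> w) / (A w \<bullet> w)) * (A v \<bullet> w) +
        (- (A v \<bullet> w) / (A w \<bullet> w))\<^sup>2 * (A w \<bullet> w)) * (A w \<bullet> w)"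
      by (intro mult_nonneg_nonneg q less_imp_le[OF w])
    also have "\<dots> = (A v \<bullet> v) * (A w \<bullet> w) - (A v \<bullet> w)\<^sup>2"
      using w by (simp add: field_simps power2_eq_square)
    finally show ?thesis by simp
  qed
qed

lemma pos_op_inner_eq_0:
  assumes "pos_op A" and "A v \<bullet> v = 0"
  shows "A v = 0"
  using pos_op_cauchy_schwarz[OF assms(1), of v "A v"] assms(2) by simp

text \<open>With w = S v - T v, commutation and S^2 = T^2 give S w + T w = 0. Positivity then yields
  S w = T w = 0, so |w|^2 = <v, S w - T w> = 0.\<close>

lemma pos_op_sqrt_unique:
  assumes S: "pos_op S" and T: "pos_op T" and eq: "\<And>v. S (S v) = T (T v)"
    and comm: "\<And>v. S (T v) = T (S v)"
  shows "S = T"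
proof
  fix v
  have linS: "linear S" and linT: "linear T"
    and sym: "\<And>v w. S v \<bullet> w = v \<bullet> S w" "\<And>v w. T v \<bullet> w = v \<bullet> T w"
    using S T by (auto simp: pos_op_def bounded_linear.linear)
  define w where "w = S v - T v"
  have "S w + T w = 0"
    by (simp add: w_def linear_diff[OF linS] linear_diff[OF linT] eq comm)
  then have "S w \<bullet> w + T w \<bullet> w = 0"
    by (metis inner_add_left inner_zero_left)
  moreover have "0 \<le> S w \<bullet> w" "0 \<le> T w \<bullet> w"
    using S T by (auto simp: pos_op_def)
  ultimately have "S w = 0" "T w = 0"
    using pos_op_inner_eq_0[OF S] pos_op_inner_eq_0[OF T] by auto
  then have "w \<bullet> w = 0"
    by (subst (1) w_def) (simp add: inner_diff_left sym)
  then show "S v = T v" by (simp add: w_def)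
qed

locale scaled_pos_op =
  fixes A :: "'a::{real_inner, banach} \<Rightarrow> 'a" and M :: real
  assumes A: "pos_op A" and M: "0 < M" and bound: "A v \<bullet> v \<le> M * (v \<bullet> v)"
begin

text \<open>The complement 1 - A/M lies between 0 and 1, so the series applies to it and the root of
  A is sqrt M times the root of 1 - defect.\<close>

definition defect :: "'a \<Rightarrow> 'a" where
  "defect v = v - (1 / M) *\<^sub>R A v"

lemma linear_A: "linear A" and sym_A: "A v \<bullet> w = v \<bullet> A w" and pos_A: "0 \<le> A v \<bullet> v"
  using A by (auto simp: pos_op_def bounded_linear.linear)

lemma pos_op_defect: "pos_op defect"
  unfolding pos_op_def
proof (intro conjI allI)
  show "bounded_linear defect"
    unfolding defect_def using A
    by (auto simp: pos_op_def intro!: bounded_linear_sub bounded_linear_ident bounded_linear_const_scaleR)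
  show "defect v \<bullet> w = v \<bullet> defect w" for v w
    by (simp add: defect_def inner_diff_left inner_diff_right sym_A)
  show "0 \<le> defect v \<bullet> v" for v
    using bound[of v] M by (simp add: defect_def inner_diff_left field_simps)
qed

sublocale positive_contraction defect
proof (rule positive_contraction.intro)
  show "bounded_linear defect" using pos_op_defect by (auto simp: pos_op_def)
  show "defect v \<bullet> w = v \<bullet> defect w" for v w
    using pos_op_defect by (auto simp: pos_op_def)
  show "0 \<le> defect v \<bullet> v" for v
    using pos_op_defect by (auto simp: pos_op_def)
  fix v
  let ?u = "defect v"
  have le: "defect x \<bullet> x \<le> x \<bullet> x" for x
    using pos_A[of x] M by (simp add: defect_def inner_diff_left)
  have dpos: "0 \<le> defect x \<bullet> x" for x
    using pos_op_defect unfolding pos_op_def by blast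
  \<comment> \<open>Cauchy-Schwarz for the form of the defect, taken at v and u = defect v, yields
    |u|^4 <= |v|^2 |u|^2.\<close>
  have "(?u \<bullet> ?u)\<^sup>2 \<le> (?u \<bullet> v) * (defect ?u \<bullet> ?u)"
    by (rule pos_op_cauchy_schwarz[OF pos_op_defect])
  also have "\<dots> \<le> (v \<bullet> v) * (?u \<bullet> ?u)"
    by (intro mult_mono le dpos inner_ge_zero)
  finally have "?u \<bullet> ?u \<le> v \<bullet> v"
    by (cases "?u \<bullet> ?u = 0") (auto simp: power2_eq_square mult_le_cancel_right)
  then show "norm ?u \<le> norm v" by (simp add: norm_eq_sqrt_inner)
qed

definition sqrt_pos :: "'a \<Rightarrow> 'a" where
  "sqrt_pos v = sqrt M *\<^sub>R sqrt_one_minus v"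

lemma pos_op_sqrt_pos: "pos_op sqrt_pos"
  unfolding pos_op_def sqrt_pos_def
  using M root_pos by (auto intro!: bounded_linear_const_scaleR bounded_linear_root simp: root_sym)

lemma sqrt_pos_square: "sqrt_pos (sqrt_pos v) = A v"
proof -
  have "sqrt_pos (sqrt_pos v) = M *\<^sub>R sqrt_one_minus (sqrt_one_minus v)"
    using M by (simp add: sqrt_pos_def linear_scale[OF bounded_linear.linear[OF bounded_linear_root]])
  also have "\<dots> = A v"
    using M by (simp add: sqrt_one_minus_square defect_def)
  finally show ?thesis .
qed

lemma sqrt_pos_commute:
  assumes C: "bounded_linear C" and "\<And>v. C (A v) = A (C v)"
  shows "C (sqrt_pos v) = sqrt_pos (C v)"
proof -
  have lin: "linear C" using C by (simp add: bounded_linear.linear)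
  have "C (sqrt_one_minus v) = sqrt_one_minus (C v)"
    by (rule root_commute[OF C])
      (simp add: defect_def linear_diff[OF lin] linear_scale[OF lin] assms(2))
  then show ?thesis by (simp add: sqrt_pos_def linear_scale[OF lin])
qed

text \<open>A positive root T commutes with T^2 = A, hence with the series in A; this is the
  commutation on which uniqueness rests.\<close>

lemma sqrt_pos_unique:
  assumes T: "pos_op T" and "\<And>v. T (T v) = A v"
  shows "T = sqrt_pos"
proof (rule HOL.sym, rule pos_op_sqrt_unique[OF pos_op_sqrt_pos T])
  show "sqrt_pos (T v) = T (sqrt_pos v)" for v
    by (rule sqrt_pos_commute[symmetric]) (use T in \<open>auto simp: pos_op_def simp flip: assms(2)\<close>)
qed (simp add: sqrt_pos_square assms(2))

lemma sqrt_pos_inner_le: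
  "sqrt_pos v \<bullet> v \<le> sqrt M * (\<Sum>k\<le>N. sqrt_coeff k * ((defect ^^ k) v \<bullet> v))"
  using M by (simp add: sqrt_pos_def mult_left_mono root_inner_le)

end

section \<open>The Hilbert space of square summable functions\<close>

lemma summable_mult_cnj:
  fixes f g :: "'i \<Rightarrow> complex"
  assumes "(\<lambda>i. (cmod (f i))\<^sup>2) summable_on I" and "(\<lambda>i. (cmod (g i))\<^sup>2) summable_on I"
  shows "(\<lambda>i. f i * cnj (g i)) summable_on I"
proof (rule abs_summable_summable)
  have le: "norm (f i * cnj (g i)) \<le> (cmod (f i))\<^sup>2 + (cmod (g i))\<^sup>2" for i
  proof -
    have "0 \<le> cmod (f i) * cmod (g i)" by simp
    then show ?thesis
      using sum_squares_bound[of "cmod (f i)" "cmod (g i)"] unfolding norm_mult complex_mod_cnj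
      by linarith
  qed
  show "(\<lambda>i. norm (f i * cnj (g i))) summable_on I"
    by (rule summable_on_comparison_test[OF summable_on_add[OF assms]]) (use le in auto)
qed

text \<open>
  All spaces \<open>\<ell>\<^sub>2(I)\<close> over one index type embed into the following one, whose norm and inner product are those of
  the underlying real Hilbert space; the complex structure is carried by \<open>cscale\<close> and \<open>cinner\<close>.
\<close>

typedef 'i l2 = "{f :: 'i \<Rightarrow> complex. (\<lambda>i. (cmod (f i))\<^sup>2) summable_on UNIV}"
  morphisms coef Abs_l2
  by (rule exI[of _ "\<lambda>_. 0"]) simp

setup_lifting type_definition_l2

lemma coef_summable: "(\<lambda>i. (cmod (coef v i))\<^sup>2) summable_on I"
  by (rule summable_on_subset_banach[of _ UNIV]) (use coef in auto)

lemma coef_mult_summable: "(\<lambda>i. coef v i * cnj (coef w i)) summable_on I"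
  by (intro summable_mult_cnj coef_summable)

lemma l2_eqI: "(\<And>i. coef v i = coef w i) \<Longrightarrow> v = w"
  by (metis coef_inject ext)

lemma square_summable_add:
  fixes f g :: "'i \<Rightarrow> complex"
  assumes "(\<lambda>i. (cmod (f i))\<^sup>2) summable_on I" and "(\<lambda>i. (cmod (g i))\<^sup>2) summable_on I"
  shows "(\<lambda>i. (cmod (f i + g i))\<^sup>2) summable_on I"
proof (rule summable_on_comparison_test)
  show "(\<lambda>i. 2 * ((cmod (f i))\<^sup>2 + (cmod (g i))\<^sup>2)) summable_on I"
    by (intro summable_on_cmult_right summable_on_add assms)
  show "(cmod (f i + g i))\<^sup>2 \<le> 2 * ((cmod (f i))\<^sup>2 + (cmod (g i))\<^sup>2)" for i
  proof -
    have "(cmod (f i + g i))\<^sup>2 \<le> (cmod (f i) + cmod (g i))\<^sup>2"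
      by (intro power_mono norm_triangle_ineq) simp
    also have "\<dots> \<le> 2 * ((cmod (f i))\<^sup>2 + (cmod (g i))\<^sup>2)"
      using sum_squares_bound[of "cmod (f i)" "cmod (g i)"] by (simp add: power2_sum)
    finally show ?thesis .
  qed
qed simp

lemma square_summable_scale:
  fixes f :: "'i \<Rightarrow> complex"
  assumes "(\<lambda>i. (cmod (f i))\<^sup>2) summable_on I"
  shows "(\<lambda>i. (cmod (c * f i))\<^sup>2) summable_on I"
  using summable_on_cmult_right[OF assms, of "(cmod c)\<^sup>2"] by (simp add: norm_mult power_mult_distrib)

lift_definition cscale :: "complex \<Rightarrow> 'i l2 \<Rightarrow> 'i l2" is "\<lambda>c f i. c * f i"
  by (rule square_summable_scale)

lift_definition cinner :: "'i l2 \<Rightarrow> 'i l2 \<Rightarrow> complex" is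
  "\<lambda>f g. \<Sum>\<^sub>\<infinity>i. f i * cnj (g i)" .

instantiation l2 :: (type) real_inner
begin

lift_definition zero_l2 :: "'a l2" is "\<lambda>_. 0" by simp
lift_definition plus_l2 :: "'a l2 \<Rightarrow> 'a l2 \<Rightarrow> 'a l2" is "\<lambda>f g i. f i + g i"
  by (rule square_summable_add)
lift_definition uminus_l2 :: "'a l2 \<Rightarrow> 'a l2" is "\<lambda>f i. - f i" by simp
lift_definition minus_l2 :: "'a l2 \<Rightarrow> 'a l2 \<Rightarrow> 'a l2" is "\<lambda>f g i. f i - g i"
  using square_summable_add[of _ UNIV "\<lambda>i. - _ i"] by simp
lift_definition scaleR_l2 :: "real \<Rightarrow> 'a l2 \<Rightarrow> 'a l2" is "\<lambda>r f i. of_real r * f i"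
  by (rule square_summable_scale)
definition inner_l2 :: "'a l2 \<Rightarrow> 'a l2 \<Rightarrow> real" where "inner_l2 v w = Re (cinner v w)"
definition norm_l2 :: "'a l2 \<Rightarrow> real" where "norm_l2 v = sqrt (inner v v)"
definition dist_l2 :: "'a l2 \<Rightarrow> 'a l2 \<Rightarrow> real" where "dist_l2 v w = norm (v - w)"
definition sgn_l2 :: "'a l2 \<Rightarrow> 'a l2" where "sgn_l2 v = inverse (norm v) *\<^sub>R v"
definition uniformity_l2 :: "('a l2 \<times> 'a l2) filter" where
  "uniformity_l2 = (INF e\<in>{0 <..}. principal {(x, y). dist x y < e})"
definition open_l2 :: "'a l2 set \<Rightarrow> bool" where
  "open_l2 U = (\<forall>x\<in>U. eventually (\<lambda>(x', y). x' = x \<longrightarrow> y \<in> U) uniformity)"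

lemma cinner_add: "cinner (u + v) w = cinner u w + cinner v (w :: 'a l2)"
  unfolding cinner.rep_eq plus_l2.rep_eq distrib_right
  by (intro infsum_add coef_mult_summable)

lemma cinner_commute: "cinner v w = cnj (cinner w (v :: 'a l2))"
  unfolding cinner.rep_eq by (subst infsum_cnj[symmetric]) (simp add: mult.commute)

lemma cinner_scale: "cinner (cscale c v) w = c * cinner v (w :: 'a l2)"
  unfolding cinner.rep_eq cscale.rep_eq mult.assoc by (rule infsum_cmult_right')

lemma scaleR_l2_cscale: "r *\<^sub>R v = cscale (of_real r) (v :: 'a l2)"
  by transfer simp

lemma inner_self: "inner v v = (\<Sum>\<^sub>\<infinity>i. (cmod (coef (v :: 'a l2) i))\<^sup>2)"
proof -
  have "((\<lambda>i. of_real ((cmod (coef v i))\<^sup>2)) has_sum complex_of_real (\<Sum>\<^sub>\<infinity>i. (cmod (coef v i))\<^sup>2)) UNIV"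
    by (intro has_sum_of_real has_sum_infsum coef_summable)
  then have "cinner v v = complex_of_real (\<Sum>\<^sub>\<infinity>i. (cmod (coef v i))\<^sup>2)"
    unfolding cinner.rep_eq by (metis (no_types, lifting) infsumI infsum_cong complex_norm_square)
  then show ?thesis by (simp add: inner_l2_def)
qed

lemma coef_le_inner: "(cmod (coef v i))\<^sup>2 \<le> inner v (v :: 'a l2)"
  unfolding inner_self
  using finite_sum_le_infsum[OF coef_summable[of v UNIV], of "{i}"] by simp

instance
proof
  fix x y z :: "'a l2" and r s :: real and U :: "'a l2 set"
  show "x + y + z = x + (y + z)" by transfer (simp add: add.assoc)
  show "x + y = y + x" by transfer (simp add: add.commute)
  show "0 + x = x" by transfer simp
  show "- x + x = 0" by transfer simp
  show "x - y = x + - y" by transfer simp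
  show "r *\<^sub>R (x + y) = r *\<^sub>R x + r *\<^sub>R y" by transfer (simp add: algebra_simps)
  show "(r + s) *\<^sub>R x = r *\<^sub>R x + s *\<^sub>R x" by transfer (simp add: algebra_simps)
  show "r *\<^sub>R s *\<^sub>R x = (r * s) *\<^sub>R x" by transfer (simp add: algebra_simps)
  show "1 *\<^sub>R x = x" by transfer simp
  show "dist x y = norm (x - y)" by (rule dist_l2_def)
  show "sgn x = inverse (norm x) *\<^sub>R x" by (rule sgn_l2_def)
  show "uniformity = (INF e\<in>{0 <..}. principal {(x :: 'a l2, y). dist x y < e})"
    by (rule uniformity_l2_def)
  show "open U = (\<forall>x\<in>U. \<forall>\<^sub>F (x', y) in uniformity. x' = x \<longrightarrow> y \<in> U)"
    by (rule open_l2_def)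
  show "x \<bullet> y = y \<bullet> x" using cinner_commute[of x y] by (simp add: inner_l2_def)
  show "(x + y) \<bullet> z = x \<bullet> z + y \<bullet> z" by (simp add: inner_l2_def cinner_add)
  show "(r *\<^sub>R x) \<bullet> y = r * (x \<bullet> y)" by (simp add: inner_l2_def scaleR_l2_cscale cinner_scale)
  show "0 \<le> x \<bullet> x" unfolding inner_self by (simp add: infsum_nonneg)
  have "x = 0" if "x \<bullet> x = 0"
    by (rule l2_eqI) (use coef_le_inner[of x] that in \<open>simp add: zero_l2.rep_eq\<close>)
  then show "(x \<bullet> x = 0) = (x = 0)" by (auto simp: inner_self zero_l2.rep_eq)
  show "norm x = sqrt (x \<bullet> x)" by (rule norm_l2_def)
qed

end

lemma norm_l2_square: "(norm (v :: 'i l2))\<^sup>2 = (\<Sum>\<^sub>\<infinity>i. (cmod (coef v i))\<^sup>2)"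
  by (simp add: power2_norm_eq_inner inner_self)

lemma norm_coef_le: "cmod (coef v i) \<le> norm (v :: 'i l2)"
  using coef_le_inner[of v i] by (simp add: norm_eq_sqrt_inner real_le_rsqrt)

lemma finite_sum_le_norm:
  assumes "finite F"
  shows "(\<Sum>i\<in>F. (cmod (coef v i))\<^sup>2) \<le> (norm (v :: 'i l2))\<^sup>2"
  unfolding norm_l2_square by (rule finite_sum_le_infsum) (use assms coef_summable in auto)

text \<open>Coordinates converge; bounds on finite partial sums pass to the limit and control the
  whole distance to it.\<close>

instance l2 :: (type) banach
proof
  fix X :: "nat \<Rightarrow> 'a l2"
  assume "Cauchy X"
  then have cauchy: "\<exists>N. \<forall>m\<ge>N. \<forall>n\<ge>N. norm (X m - X n) < e" if "0 < e" for e
    using that by (simp add: Cauchy_def dist_norm)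
  have "Cauchy (\<lambda>n. coef (X n) i)" for i
    unfolding Cauchy_def dist_norm
  proof (intro allI impI)
    fix e :: real assume "e > 0"
    then obtain N where "\<forall>m\<ge>N. \<forall>n\<ge>N. norm (X m - X n) < e"
      using cauchy by blast
    moreover have "cmod (coef (X m) i - coef (X n) i) \<le> norm (X m - X n)" for m n
      using norm_coef_le[of "X m - X n" i] by (simp add: minus_l2.rep_eq)
    ultimately show "\<exists>N. \<forall>m\<ge>N. \<forall>n\<ge>N. cmod (coef (X m) i - coef (X n) i) < e"
      by (meson order.strict_trans1)
  qed
  then have "\<forall>i. \<exists>l. (\<lambda>n. coef (X n) i) \<longlonglongrightarrow> l"
    by (simp add: Cauchy_convergent_iff convergent_def)
  from choice[OF this] obtain g where "\<forall>i. (\<lambda>n. coef (X n) i) \<longlonglongrightarrow> g i" ..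
  then have g: "(\<lambda>n. coef (X n) i) \<longlonglongrightarrow> g i" for i ..
  have main: "(\<lambda>i. (cmod (coef (X m) i - g i))\<^sup>2) summable_on UNIV \<and>
      (\<Sum>\<^sub>\<infinity>i. (cmod (coef (X m) i - g i))\<^sup>2) \<le> e\<^sup>2"
    if e: "e > 0" and N: "\<forall>m\<ge>N. \<forall>n\<ge>N. norm (X m - X n) < e" and m: "m \<ge> N" for e N m
  proof -
    have fin: "(\<Sum>i\<in>F. (cmod (coef (X m) i - g i))\<^sup>2) \<le> e\<^sup>2" if "finite F" for F
    proof (rule LIMSEQ_le_const2)
      show "(\<lambda>n. \<Sum>i\<in>F. (cmod (coef (X m) i - coef (X n) i))\<^sup>2) \<longlonglongrightarrow> (\<Sum>i\<in>F. (cmod (coef (X m) i - g i))\<^sup>2)"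
        by (intro tendsto_sum tendsto_power tendsto_norm tendsto_diff tendsto_const g)
      have "(\<Sum>i\<in>F. (cmod (coef (X m) i - coef (X n) i))\<^sup>2) \<le> e\<^sup>2" if "n \<ge> N" for n
      proof -
        have "(\<Sum>i\<in>F. (cmod (coef (X m - X n) i))\<^sup>2) \<le> (norm (X m - X n))\<^sup>2"
          by (rule finite_sum_le_norm) fact
        also have "\<dots> \<le> e\<^sup>2" using N m that by (intro power_mono) (auto intro: less_imp_le)
        finally show ?thesis by (simp add: minus_l2.rep_eq)
      qed
      then show "\<exists>N. \<forall>n\<ge>N. (\<Sum>i\<in>F. (cmod (coef (X m) i - coef (X n) i))\<^sup>2) \<le> e\<^sup>2" by blast
    qed
    have s: "(\<lambda>i. (cmod (coef (X m) i - g i))\<^sup>2) summable_on UNIV"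
      by (rule nonneg_bounded_partial_sums_imp_summable_on[of _ _ "e\<^sup>2"])
        (auto intro!: eventually_finite_subsets_at_top_weakI fin)
    then show ?thesis by (auto intro: infsum_le_finite_sums fin)
  qed
  obtain N0 where N0: "\<forall>m\<ge>N0. \<forall>n\<ge>N0. norm (X m - X n) < 1"
    using cauchy[of 1] by auto
  have "(\<lambda>i. (cmod (coef (X N0) i - (coef (X N0) i - g i)))\<^sup>2) summable_on UNIV"
    using square_summable_add[of "coef (X N0)" UNIV "\<lambda>i. - (coef (X N0) i - g i)"]
      coef_summable[of "X N0"] main[OF _ N0, of N0] by (simp add: norm_minus_commute)
  then have gs: "(\<lambda>i. (cmod (g i))\<^sup>2) summable_on UNIV" by simp
  have coef_g: "coef (Abs_l2 g) = g" using gs by (simp add: Abs_l2_inverse)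
  have "X \<longlonglongrightarrow> Abs_l2 g"
  proof (rule LIMSEQ_I)
    fix r :: real assume r: "0 < r"
    then obtain N where N: "\<forall>m\<ge>N. \<forall>n\<ge>N. norm (X m - X n) < r / 2"
      using cauchy[of "r / 2"] by auto
    have "norm (X m - Abs_l2 g) < r" if "m \<ge> N" for m
    proof -
      have "(norm (X m - Abs_l2 g))\<^sup>2 \<le> (r / 2)\<^sup>2"
        using main[OF _ N that] r by (simp add: norm_l2_square minus_l2.rep_eq coef_g)
      then have "norm (X m - Abs_l2 g) \<le> r / 2"
        by (rule power2_le_imp_le) (use r in simp)
      then show ?thesis using r by simp
    qed
    then show "\<exists>N. \<forall>n\<ge>N. norm (X n - Abs_l2 g) < r" by blast
  qed
  then show "convergent X" by (auto simp: convergent_def)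
qed

lemma coef_zero: "coef 0 i = 0" by (simp add: zero_l2.rep_eq)

lift_definition basis :: "'i \<Rightarrow> 'i l2" is "\<lambda>i j. if j = i then 1 else 0"
proof -
  fix i :: 'i
  have "(\<lambda>j. (cmod (if j = i then 1 else 0))\<^sup>2) summable_on {i} \<longleftrightarrow>
      (\<lambda>j. (cmod (if j = i then 1 else 0))\<^sup>2) summable_on UNIV"
    by (rule summable_on_cong_neutral) auto
  then show "(\<lambda>j. (cmod (if j = i then 1 else 0))\<^sup>2) summable_on UNIV"
    by simp
qed

lemma cinner_basis: "cinner v (basis i) = coef v i"
proof -
  have "cinner v (basis i) = (\<Sum>\<^sub>\<infinity>j\<in>{i}. coef v j * cnj (coef (basis i) j))"
    unfolding cinner.rep_eq by (rule infsum_cong_neutral) (auto simp: basis.rep_eq)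
  then show ?thesis by (simp add: basis.rep_eq)
qed

lift_definition restr :: "'i set \<Rightarrow> 'i l2 \<Rightarrow> 'i l2" is "\<lambda>I f i. if i \<in> I then f i else 0"
proof -
  fix I :: "'i set" and f :: "'i \<Rightarrow> complex"
  assume "(\<lambda>i. (cmod (f i))\<^sup>2) summable_on UNIV"
  then show "(\<lambda>i. (cmod (if i \<in> I then f i else 0))\<^sup>2) summable_on UNIV"
    by (rule summable_on_comparison_test) auto
qed

lemma cinner_scale_right: "cinner v (cscale c w) = cnj c * cinner v w"
  by (metis cinner_commute cinner_scale complex_cnj_mult)

lemma cinner_add_right: "cinner v (u + w) = cinner v u + cinner v w"
  by (metis cinner_add cinner_commute complex_cnj_add)

lemma inner_eq_Re: "v \<bullet> w = Re (cinner v w)"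
  by (rule inner_l2_def)

lemma cinner_eq: "cinner v w = Complex (v \<bullet> w) (v \<bullet> cscale \<i> w)"
  by (simp add: complex_eq_iff inner_eq_Re cinner_scale_right)

lemma norm_cscale: "norm (cscale c v) = cmod c * norm v"
proof -
  have "cinner (cscale c v) (cscale c v) = of_real ((cmod c)\<^sup>2) * cinner v v"
    by (simp only: cinner_scale cinner_scale_right complex_norm_square mult_ac)
  then have "(norm (cscale c v))\<^sup>2 = (cmod c * norm v)\<^sup>2"
    by (simp add: power2_norm_eq_inner inner_eq_Re power_mult_distrib)
  then show ?thesis by simp
qed

lemma bounded_linear_cscale: "bounded_linear (cscale c :: 'i l2 \<Rightarrow> 'i l2)"
proof (rule bounded_linear_intro[where K = "cmod c"])
  show "cscale c (v + w) = cscale c v + cscale c w" for v w :: "'i l2"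
    by transfer (simp add: distrib_left)
  show "cscale c (r *\<^sub>R v) = r *\<^sub>R cscale c v" for r and v :: "'i l2"
    by transfer (simp add: mult.left_commute)
qed (simp add: norm_cscale mult.commute)

lemma norm_restr_le: "norm (restr I v) \<le> norm v"
proof -
  have "(norm (restr I v))\<^sup>2 \<le> (norm v)\<^sup>2"
    unfolding norm_l2_square
    by (rule infsum_mono[OF coef_summable coef_summable]) (simp add: restr.rep_eq)
  then show ?thesis by (rule power2_le_imp_le) simp
qed

lemma bounded_linear_restr: "bounded_linear (restr I)"
proof (rule bounded_linear_intro[where K = 1])
  show "restr I (v + w) = restr I v + restr I w" for v w
    by transfer auto
  show "restr I (r *\<^sub>R v) = r *\<^sub>R restr I v" for r v
    by transfer auto
qed (simp add: norm_restr_le)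

lemma restr_restr: "restr I (restr I v) = restr I v"
  by transfer auto

lemma cinner_nondeg: "(\<And>v. cinner v w = cinner v w') \<Longrightarrow> w = w'"
  by (rule l2_eqI) (metis cinner_basis cinner_commute)

section \<open>Operators on \<open>\<ell>\<^sub>2(I)\<close> as operators on the Hilbert space of all square summable functions\<close>

lemma ell2_iff: "\<xi> \<in> ell2 I \<longleftrightarrow> (\<exists>v. restr I v = v \<and> coef v = \<xi>)"
proof
  assume \<xi>: "\<xi> \<in> ell2 I"
  then have "(\<lambda>i. (cmod (\<xi> i))\<^sup>2) summable_on UNIV"
    unfolding ell2_def
    by (subst summable_on_cong_neutral[of I UNIV _ "\<lambda>i. (cmod (\<xi> i))\<^sup>2"]) auto
  then have c: "coef (Abs_l2 \<xi>) = \<xi>" by (simp add: Abs_l2_inverse)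
  then have "restr I (Abs_l2 \<xi>) = Abs_l2 \<xi>"
    using \<xi> by (intro l2_eqI) (auto simp: restr.rep_eq ell2_def)
  with c show "\<exists>v. restr I v = v \<and> coef v = \<xi>" by blast
next
  assume "\<exists>v. restr I v = v \<and> coef v = \<xi>"
  then obtain v where v: "restr I v = v" "coef v = \<xi>" by blast
  then have "\<xi> i = 0" if "i \<notin> I" for i
    using that by (metis restr.rep_eq)
  then show "\<xi> \<in> ell2 I" using coef_summable[of v I] v by (auto simp: ell2_def)
qed

lemma ell2E:
  assumes "\<xi> \<in> ell2 I"
  obtains v where "restr I v = v" "coef v = \<xi>"
  using assms unfolding ell2_iff by (elim exE conjE)

lemma coef_in_ell2: "restr I v = v \<Longrightarrow> coef v \<in> ell2 I"
  by (auto simp: ell2_iff)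

lemma coef_Abs_ell2: "\<xi> \<in> ell2 I \<Longrightarrow> coef (Abs_l2 \<xi>) = \<xi>"
  by (metis ell2_iff coef_inverse)

lemma restr_Abs_ell2: "\<xi> \<in> ell2 I \<Longrightarrow> restr I (Abs_l2 \<xi>) = Abs_l2 \<xi>"
  by (metis ell2_iff coef_inverse)

lemma restr_eq_0: "restr I v = v \<Longrightarrow> i \<notin> I \<Longrightarrow> coef v i = 0"
  by (metis restr.rep_eq)

lemma ell2_inner_coef:
  assumes "restr I v = v"
  shows "ell2_inner I (coef v) (coef w) = cinner v w"
  unfolding ell2_inner_def cinner.rep_eq
  by (rule infsum_cong_neutral) (use restr_eq_0[OF assms] in auto)

lemma ell2_norm_coef:
  assumes "restr I v = v"
  shows "ell2_norm I (coef v) = norm v"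
proof -
  have "(\<Sum>\<^sub>\<infinity>i\<in>I. (cmod (coef v i))\<^sup>2) = (\<Sum>\<^sub>\<infinity>i. (cmod (coef v i))\<^sup>2)"
    by (rule infsum_cong_neutral) (use restr_eq_0[OF assms] in auto)
  then show ?thesis by (simp add: ell2_norm_def flip: norm_l2_square)
qed

text \<open>The last two conditions say P L = L = L P for the projection P = \<open>restr I\<close>:
  operators on the subspace are encoded as a corner of the operators on the whole space.\<close>

definition op_on :: "'i set \<Rightarrow> ('i l2 \<Rightarrow> 'i l2) \<Rightarrow> bool" where
  "op_on I L \<longleftrightarrow> bounded_linear L \<and> (\<forall>c v. L (cscale c v) = cscale c (L v)) \<and>
    (\<forall>v. restr I (L v) = L v) \<and> (\<forall>v. L (restr I v) = L v)"

text \<open>Restricting the domain makes the result extensional, as the definite descriptions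
  demand.\<close>

definition fun_op :: "'i set \<Rightarrow> ('i l2 \<Rightarrow> 'i l2) \<Rightarrow> ('i \<Rightarrow> complex) \<Rightarrow> ('i \<Rightarrow> complex)" where
  "fun_op I L = (\<lambda>\<xi>\<in>ell2 I. coef (L (Abs_l2 \<xi>)))"

definition l2_op :: "'i set \<Rightarrow> (('i \<Rightarrow> complex) \<Rightarrow> ('i \<Rightarrow> complex)) \<Rightarrow> 'i l2 \<Rightarrow> 'i l2" where
  "l2_op I T v = Abs_l2 (T (coef (restr I v)))"

lemma fun_op_coef: "restr I v = v \<Longrightarrow> fun_op I L (coef v) = coef (L v)"
  by (simp add: fun_op_def coef_in_ell2 coef_inverse)

lemma bounded_op_fun_op:
  assumes "op_on I L"
  shows "bounded_op I (fun_op I L)"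
proof -
  have bl: "bounded_linear L" and sc: "\<And>c v. L (cscale c v) = cscale c (L v)"
    and res: "\<And>v. restr I (L v) = L v" using assms by (auto simp: op_on_def)
  show ?thesis
    unfolding bounded_op_def
  proof (intro conjI ballI allI)
    show "fun_op I L \<xi> \<in> ell2 I" if "\<xi> \<in> ell2 I" for \<xi>
      using that by (simp add: fun_op_def coef_in_ell2 res)
  next
    fix \<xi> \<eta> assume \<xi>: "\<xi> \<in> ell2 I" and \<eta>: "\<eta> \<in> ell2 I"
    obtain v where v: "restr I v = v" "coef v = \<xi>"
      by (rule ell2E[OF \<xi>])
    obtain w where w: "restr I w = w" "coef w = \<eta>"
      by (rule ell2E[OF \<eta>])
    have r: "restr I (v + w) = v + w"
      using v w by (simp add: linear_add[OF bounded_linear.linear[OF bounded_linear_restr]])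
    have "(\<lambda>i. \<xi> i + \<eta> i) = coef (v + w)" using v w by (auto simp: plus_l2.rep_eq)
    moreover have "fun_op I L (coef (v + w)) = (\<lambda>i. fun_op I L (coef v) i + fun_op I L (coef w) i)"
      unfolding fun_op_coef[OF r] fun_op_coef[OF v(1)] fun_op_coef[OF w(1)]
      by (simp add: linear_add[OF bounded_linear.linear[OF bl]] plus_l2.rep_eq)
    ultimately show "fun_op I L (\<lambda>i. \<xi> i + \<eta> i) = (\<lambda>i. fun_op I L \<xi> i + fun_op I L \<eta> i)"
      using v w by simp
  next
    fix c \<xi> assume "\<xi> \<in> ell2 I"
    then obtain v where v: "restr I v = v" "coef v = \<xi>" unfolding ell2_iff by blast
    have r: "restr I (cscale c v) = cscale c v"
      using v(1) by (metis (no_types, lifting) l2_eqI cscale.rep_eq mult_zero_right restr.rep_eq)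
    have "(\<lambda>i. c * \<xi> i) = coef (cscale c v)" using v by (auto simp: cscale.rep_eq)
    moreover have "fun_op I L (coef (cscale c v)) = (\<lambda>i. c * fun_op I L (coef v) i)"
      unfolding fun_op_coef[OF r] fun_op_coef[OF v(1)] by (simp add: sc cscale.rep_eq)
    ultimately show "fun_op I L (\<lambda>i. c * \<xi> i) = (\<lambda>i. c * fun_op I L \<xi> i)"
      using v by simp
  next
    obtain K where K: "\<And>v. norm (L v) \<le> norm v * K" using bl bounded_linear.bounded by blast
    have "ell2_norm I (fun_op I L \<xi>) \<le> K * ell2_norm I \<xi>" if \<xi>: "\<xi> \<in> ell2 I" for \<xi>
    proof -
      obtain v where v: "restr I v = v" "coef v = \<xi>" by (rule ell2E[OF \<xi>])
      show ?thesis
        using K[of v] fun_op_coef[OF v(1), of L] ell2_norm_coef[OF v(1)] ell2_norm_coef[OF res, of v] v(2)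
        by (simp add: mult.commute)
    qed
    then show "\<exists>K. \<forall>\<xi>\<in>ell2 I. ell2_norm I (fun_op I L \<xi>) \<le> K * ell2_norm I \<xi>" by blast
  qed
qed

lemma
  assumes T: "bounded_op I T"
  shows op_on_l2_op: "op_on I (l2_op I T)"
    and coef_l2_op: "restr I v = v \<Longrightarrow> coef (l2_op I T v) = T (coef v)"
proof -
  have in_ell2: "coef (restr I v) \<in> ell2 I" for v by (simp add: coef_in_ell2 restr_restr)
  then have T_ell2: "T (coef (restr I v)) \<in> ell2 I" for v using T by (simp add: bounded_op_def)
  have c: "coef (l2_op I T v) = T (coef (restr I v))" for v
    unfolding l2_op_def by (rule coef_Abs_ell2[OF T_ell2])
  then show "coef (l2_op I T v) = T (coef v)" if "restr I v = v" using that by simp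
  have res: "restr I (l2_op I T v) = l2_op I T v" for v
    unfolding l2_op_def by (rule restr_Abs_ell2[OF T_ell2])
  obtain K where K: "\<And>\<xi>. \<xi> \<in> ell2 I \<Longrightarrow> ell2_norm I (T \<xi>) \<le> K * ell2_norm I \<xi>"
    using T unfolding bounded_op_def by blast
  have sc: "l2_op I T (cscale a v) = cscale a (l2_op I T v)" for a v
  proof (rule l2_eqI)
    fix i
    have "coef (restr I (cscale a v)) = (\<lambda>i. a * coef (restr I v) i)"
      by (auto simp: restr.rep_eq cscale.rep_eq)
    then show "coef (l2_op I T (cscale a v)) i = coef (cscale a (l2_op I T v)) i"
      using T in_ell2[of v] unfolding c cscale.rep_eq by (simp add: bounded_op_def)
  qed
  have "bounded_linear (l2_op I T)"
  proof (rule bounded_linear_intro[where K = "\<bar>K\<bar>"])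
    fix v w
    have "coef (restr I (v + w)) = (\<lambda>i. coef (restr I v) i + coef (restr I w) i)"
      by (auto simp: restr.rep_eq plus_l2.rep_eq)
    then show "l2_op I T (v + w) = l2_op I T v + l2_op I T w"
      using T in_ell2[of v] in_ell2[of w]
      by (intro l2_eqI) (simp add: c plus_l2.rep_eq bounded_op_def)
    show "l2_op I T (r *\<^sub>R v) = r *\<^sub>R l2_op I T v" for r
      by (simp add: scaleR_l2_cscale sc)
    have "norm (l2_op I T v) \<le> K * norm (restr I v)"
      using K[OF in_ell2[of v]] ell2_norm_coef[OF res[of v]] ell2_norm_coef[OF restr_restr, of I v]
      by (simp add: c)
    also have "\<dots> \<le> \<bar>K\<bar> * norm (restr I v)" by (intro mult_right_mono) auto
    also have "\<dots> \<le> \<bar>K\<bar> * norm v"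
      by (intro mult_left_mono norm_restr_le) simp
    finally show "norm (l2_op I T v) \<le> norm v * \<bar>K\<bar>" by (simp add: mult.commute)
  qed
  then show "op_on I (l2_op I T)"
    using sc res by (simp add: op_on_def l2_op_def restr_restr)
qed

text \<open>Symmetry comes by polarization from the quadratic form being real.\<close>

lemma pos_op_l2_op:
  assumes "positive_op I T"
  shows "pos_op (l2_op I T)"
proof -
  let ?L = "l2_op I T"
  have T: "bounded_op I T" and nonneg: "\<And>\<xi>. \<xi> \<in> ell2 I \<Longrightarrow> 0 \<le> ell2_inner I (T \<xi>) \<xi>"
    using assms by (auto simp: positive_op_def)
  have op: "bounded_linear ?L" "\<And>c v. ?L (cscale c v) = cscale c (?L v)"
    "\<And>v. restr I (?L v) = ?L v" "\<And>v. ?L (restr I v) = ?L v"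
    using op_on_l2_op[OF T] by (auto simp: op_on_def)
  note lin = bounded_linear.linear[OF op(1)]
  have pos: "0 \<le> cinner (?L v) v" for v
  proof -
    have "cinner (?L v) v = ell2_inner I (coef (?L v)) (coef v)"
      by (rule ell2_inner_coef[OF op(3), symmetric])
    also have "\<dots> = ell2_inner I (coef (?L v)) (coef (restr I v))"
      unfolding ell2_inner_def by (rule infsum_cong) (simp add: restr.rep_eq)
    also have "coef (?L v) = T (coef (restr I v))"
      using coef_l2_op[OF T restr_restr, of v] op(4) by simp
    finally show ?thesis using nonneg[of "coef (restr I v)"] by (simp add: coef_in_ell2 restr_restr)
  qed
  have "?L v \<bullet> w = ?L w \<bullet> v" for v w
  proof -
    have "Im (cinner (?L (v + cscale \<i> w)) (v + cscale \<i> w)) = 0"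
      using pos[of "v + cscale \<i> w"] by (simp add: less_eq_complex_def)
    moreover have "Im (cinner (?L v) v) = 0" "Im (cinner (?L w) w) = 0"
      using pos[of v] pos[of w] by (simp_all add: less_eq_complex_def)
    ultimately show ?thesis
      by (simp add: linear_add[OF lin] op(2) cinner_add cinner_add_right cinner_scale
          cinner_scale_right inner_eq_Re)
  qed
  then show ?thesis
    using op(1) pos unfolding pos_op_def less_eq_complex_def
    by (metis inner_commute inner_eq_Re zero_complex.sel(1))
qed

text \<open>The adjoint is explicit data, since for the elements considered it is again a finite
  combination of translations; M is an upper bound of F' F.\<close>

locale adjoint_pair =
  fixes I :: "'i set" and F F' :: "'i l2 \<Rightarrow> 'i l2" and M :: real
  assumes F: "op_on I F" and F': "op_on I F'"
    and adj: "cinner (F v) w = cinner v (F' w)"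
    and M: "0 < M" and norm_le: "(norm (F v))\<^sup>2 \<le> M * (norm v)\<^sup>2"
begin

definition A :: "'i l2 \<Rightarrow> 'i l2" where "A v = F' (F v)"

lemma A_inner: "A v \<bullet> w = F v \<bullet> F w"
  by (metis A_def adj inner_eq_Re inner_commute)

lemma pos_op_A: "pos_op A"
  unfolding pos_op_def
proof (intro conjI allI)
  show "bounded_linear A"
    unfolding A_def using F F' by (auto simp: op_on_def intro: bounded_linear_compose)
  show "A v \<bullet> w = v \<bullet> A w" for v w
    by (metis A_inner inner_commute)
qed (simp add: A_inner)

sublocale scaled_pos_op A M
  by unfold_locales (use pos_op_A M norm_le in \<open>auto simp: A_inner power2_norm_eq_inner\<close>)

lemma op_on_sqrt_pos: "op_on I sqrt_pos"
proof -
  have restr: "restr I (sqrt_pos v) = sqrt_pos (restr I v)" for v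
    by (rule sqrt_pos_commute[OF bounded_linear_restr]) (use F F' in \<open>simp add: A_def op_on_def\<close>)
  have sc: "cscale c (sqrt_pos v) = sqrt_pos (cscale c v)" for c v
    by (rule sqrt_pos_commute[OF bounded_linear_cscale]) (use F F' in \<open>simp add: A_def op_on_def\<close>)
  have lin: "linear sqrt_pos" using pos_op_sqrt_pos by (simp add: pos_op_def bounded_linear.linear)
  \<comment> \<open>The root kills u = v - P v, because |S u|^2 = <u, A u> = |F u|^2 = 0 for S =
    \<open>sqrt_pos\<close>.\<close>
  have eq: "sqrt_pos (restr I v) = sqrt_pos v" for v
  proof -
    let ?u = "v - restr I v"
    have "F ?u = 0"
      using F by (simp add: op_on_def linear_diff[OF bounded_linear.linear])
    then have "?u \<bullet> A ?u = 0"
      using A_inner[of ?u ?u] by (simp only: inner_commute[of ?u]) simp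
    moreover have "sqrt_pos ?u \<bullet> sqrt_pos ?u = ?u \<bullet> sqrt_pos (sqrt_pos ?u)"
      using pos_op_sqrt_pos unfolding pos_op_def by blast
    ultimately have "sqrt_pos ?u = 0" by (simp only: sqrt_pos_square inner_eq_zero_iff)
    then show ?thesis by (simp add: linear_diff[OF lin])
  qed
  then show ?thesis
    using restr sc pos_op_sqrt_pos by (simp add: op_on_def pos_op_def)
qed

lemma adjoint_op_eq:
  assumes T: "\<And>\<xi>. \<xi> \<in> ell2 I \<Longrightarrow> T \<xi> = fun_op I F \<xi>"
  shows "adjoint_op I T = fun_op I F'"
  unfolding adjoint_op_def
proof (rule the_equality)
  have res: "\<And>v. restr I (F v) = F v" "\<And>v. restr I (F' v) = F' v"
    using F F' by (auto simp: op_on_def)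
  have main: "ell2_inner I (T \<xi>) \<eta> = ell2_inner I \<xi> (fun_op I F' \<eta>)"
    if \<xi>: "\<xi> \<in> ell2 I" and \<eta>: "\<eta> \<in> ell2 I" for \<xi> \<eta>
  proof -
    obtain v where v: "restr I v = v" "coef v = \<xi>"
      by (rule ell2E[OF \<xi>])
    obtain w where w: "restr I w = w" "coef w = \<eta>"
      by (rule ell2E[OF \<eta>])
    show ?thesis
      using T[OF \<xi>] fun_op_coef[OF v(1), of F] fun_op_coef[OF w(1), of F'] v w
        ell2_inner_coef[OF res(1), of v w] ell2_inner_coef[OF v(1), of "F' w"]
      by (simp add: adj)
  qed
  then show "fun_op I F' \<in> extensional (ell2 I) \<and> bounded_op I (fun_op I F') \<and>
      (\<forall>\<xi>\<in>ell2 I. \<forall>\<eta>\<in>ell2 I. ell2_inner I (T \<xi>) \<eta> = ell2_inner I \<xi> (fun_op I F' \<eta>))"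
    using bounded_op_fun_op[OF F'] by (simp add: fun_op_def)
  fix S
  assume S: "S \<in> extensional (ell2 I) \<and> bounded_op I S \<and>
      (\<forall>\<xi>\<in>ell2 I. \<forall>\<eta>\<in>ell2 I. ell2_inner I (T \<xi>) \<eta> = ell2_inner I \<xi> (S \<eta>))"
  have "S \<eta> = fun_op I F' \<eta>" if \<eta>: "\<eta> \<in> ell2 I" for \<eta>
  proof
    fix i
    obtain w where w: "restr I w = w" "coef w = S \<eta>"
      using S \<eta> unfolding bounded_op_def by (metis ell2_iff)
    obtain u where u: "restr I u = u" "coef u = fun_op I F' \<eta>"
      using bounded_op_fun_op[OF F'] \<eta> unfolding bounded_op_def by (metis ell2_iff)
    show "S \<eta> i = fun_op I F' \<eta> i"
    proof (cases "i \<in> I")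
      case True
      then have b: "restr I (basis i) = basis i"
        by (intro l2_eqI) (auto simp: restr.rep_eq basis.rep_eq)
      have "cinner (basis i) w = cinner (basis i) u"
        using S main[OF coef_in_ell2[OF b] \<eta>] \<eta> coef_in_ell2[OF b]
          ell2_inner_coef[OF b, of w] ell2_inner_coef[OF b, of u] w u by simp
      then have "coef w i = coef u i" by (metis cinner_basis cinner_commute complex_cnj_cancel_iff)
      then show ?thesis using w u by simp
    next
      case False
      then show ?thesis using restr_eq_0[OF w(1) False] restr_eq_0[OF u(1) False] w u by simp
    qed
  qed
  then show "S = fun_op I F'"
    using S by (intro extensionalityI[of _ "ell2 I"]) (auto simp: fun_op_def)
qed

text \<open>Existence is the series root of F' F. For uniqueness a competitor S is transported by
  \<open>l2_op\<close> to a positive operator with the same square, where the uniqueness of the root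
  applies.\<close>

lemma abs_op_eq:
  assumes T: "\<And>\<xi>. \<xi> \<in> ell2 I \<Longrightarrow> T \<xi> = fun_op I F \<xi>"
  shows "abs_op I T = fun_op I sqrt_pos"
proof -
  have res: "\<And>v. restr I (F v) = F v" "\<And>v. restr I (sqrt_pos v) = sqrt_pos v"
    using F op_on_sqrt_pos by (auto simp: op_on_def)
  have adj_T: "adjoint_op I T = fun_op I F'"
    by (rule adjoint_op_eq) (rule T)
  have TT: "adjoint_op I T (T (coef v)) = coef (A v)" if "restr I v = v" for v
    unfolding adj_T using that by (simp add: T coef_in_ell2 fun_op_coef res A_def)
  show ?thesis
    unfolding abs_op_def sqrt_op_def
  proof (rule the_equality)
    have "0 \<le> cinner (sqrt_pos v) v" for v
    proof -
      \<comment> \<open>The value is real since \<open>sqrt_pos\<close> is symmetric for the real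
        inner product and commutes with i.\<close>
      have "cinner (sqrt_pos v) v = cnj (cinner (sqrt_pos v) v)"
      proof (subst cinner_commute[symmetric], unfold cinner_eq[of v "sqrt_pos v"] cinner_eq[of "sqrt_pos v" v])
        have "sqrt_pos v \<bullet> cscale \<i> v = v \<bullet> cscale \<i> (sqrt_pos v)"
          using pos_op_sqrt_pos op_on_sqrt_pos by (simp add: pos_op_def op_on_def)
        then show "Complex (sqrt_pos v \<bullet> v) (sqrt_pos v \<bullet> cscale \<i> v) =
            Complex (v \<bullet> sqrt_pos v) (v \<bullet> cscale \<i> (sqrt_pos v))"
          by (simp add: inner_commute)
      qed
      moreover have "0 \<le> Re (cinner (sqrt_pos v) v)"
        using pos_op_sqrt_pos unfolding pos_op_def inner_eq_Re by blast
      ultimately show ?thesis by (simp add: less_eq_complex_def complex_eq_iff)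
    qed
    then have "positive_op I (fun_op I sqrt_pos)"
      unfolding positive_op_def using bounded_op_fun_op[OF op_on_sqrt_pos]
      by (auto simp: ell2_iff fun_op_coef ell2_inner_coef res)
    moreover have "fun_op I sqrt_pos (fun_op I sqrt_pos \<xi>) = adjoint_op I T (T \<xi>)" if "\<xi> \<in> ell2 I" for \<xi>
      using that by (auto simp: ell2_iff fun_op_coef res sqrt_pos_square TT)
    ultimately show "fun_op I sqrt_pos \<in> extensional (ell2 I) \<and> positive_op I (fun_op I sqrt_pos) \<and>
        (\<forall>\<xi>\<in>ell2 I. fun_op I sqrt_pos (fun_op I sqrt_pos \<xi>) = adjoint_op I T (T \<xi>))"
      by (simp add: fun_op_def)
    fix S
    assume S: "S \<in> extensional (ell2 I) \<and> positive_op I S \<and> (\<forall>\<xi>\<in>ell2 I. S (S \<xi>) = adjoint_op I T (T \<xi>))"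
    then have bS: "bounded_op I S" by (simp add: positive_op_def)
    note opS = op_on_l2_op[OF bS]
    have "l2_op I S = sqrt_pos"
    proof (rule sqrt_pos_unique)
      show "pos_op (l2_op I S)" using S by (simp add: pos_op_l2_op)
      fix v
      have 1: "restr I (l2_op I S (restr I v)) = l2_op I S (restr I v)"
        using opS by (simp add: op_on_def)
      have "coef (l2_op I S (l2_op I S (restr I v))) = coef (A (restr I v))"
        using S TT[OF restr_restr, of v] coef_in_ell2[OF restr_restr, of I v]
        by (simp add: coef_l2_op[OF bS 1] coef_l2_op[OF bS restr_restr])
      then show "l2_op I S (l2_op I S v) = A v"
        using opS F by (simp add: coef_inject op_on_def A_def)
    qed
    then have "S \<xi> = fun_op I sqrt_pos \<xi>" if "\<xi> \<in> ell2 I" for \<xi>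
      using that coef_l2_op[OF bS] by (auto simp: ell2_iff fun_op_coef)
    then show "S = fun_op I sqrt_pos"
      using S by (intro extensionalityI[of _ "ell2 I"]) (auto simp: fun_op_def)
  qed
qed

end

section \<open>The algebra generated by the \<open>E\<^sub>i\<^sub>j \<otimes> \<lambda>\<^sub>g\<close>\<close>

context group
begin

definition unit_op :: "nat \<Rightarrow> nat \<Rightarrow> 'a \<Rightarrow> (nat \<times> 'a) l2 \<Rightarrow> (nat \<times> 'a) l2" where
  "unit_op i j g v = Abs_l2 (\<lambda>(k, x). if k = i \<and> x \<in> carrier G then coef v (j, inv g \<otimes> x) else 0)"

lemma unit_op_square_summable:
  assumes g: "g \<in> carrier G"
  shows "(\<lambda>p. (cmod (if fst p = i \<and> snd p \<in> carrier G then coef v (j, inv g \<otimes> snd p) else 0))\<^sup>2) summable_on UNIV"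
    and "(\<Sum>\<^sub>\<infinity>p. (cmod (if fst p = i \<and> snd p \<in> carrier G then coef v (j, inv g \<otimes> snd p) else 0))\<^sup>2) \<le> (norm v)\<^sup>2"
proof -
  let ?f = "\<lambda>p. (cmod (if fst p = i \<and> snd p \<in> carrier G then coef v (j, inv g \<otimes> snd p) else 0))\<^sup>2"
  let ?h = "\<lambda>p. (cmod (coef v p))\<^sup>2"
  let ?D = "{i} \<times> carrier G" and ?R = "{j} \<times> carrier G"
  have bij: "bij_betw (\<lambda>p. (j, inv g \<otimes> snd p)) ?D ?R"
    by (rule bij_betw_byWitness[where f' = "\<lambda>p. (i, g \<otimes> snd p)"])
      (use g in \<open>auto simp flip: m_assoc\<close>)
  have s: "(\<lambda>p. ?h (j, inv g \<otimes> snd p)) summable_on ?D"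
    using summable_on_reindex_bij_betw[OF bij, of ?h] coef_summable by blast
  then have "?f summable_on ?D"
    by (subst summable_on_cong[where g = "\<lambda>p. ?h (j, inv g \<otimes> snd p)"]) auto
  then show "?f summable_on UNIV"
    by (subst summable_on_cong_neutral[where T = ?D and g = ?f]) auto
  have "(\<Sum>\<^sub>\<infinity>p. ?f p) = (\<Sum>\<^sub>\<infinity>p\<in>?D. ?h (j, inv g \<otimes> snd p))"
    by (rule infsum_cong_neutral) auto
  also have "\<dots> = (\<Sum>\<^sub>\<infinity>p\<in>?R. ?h p)"
    by (rule infsum_reindex_bij_betw[OF bij])
  also have "\<dots> \<le> (\<Sum>\<^sub>\<infinity>p. ?h p)"
    by (rule infsum_mono_neutral) (auto intro: coef_summable)
  finally show "(\<Sum>\<^sub>\<infinity>p. ?f p) \<le> (norm v)\<^sup>2" by (simp add: norm_l2_square)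
qed

lemma coef_unit_op:
  assumes "g \<in> carrier G"
  shows "coef (unit_op i j g v) (k, x) = (if k = i \<and> x \<in> carrier G then coef v (j, inv g \<otimes> x) else 0)"
proof -
  have "(\<lambda>p. (cmod ((case p of (k, x) \<Rightarrow> if k = i \<and> x \<in> carrier G then coef v (j, inv g \<otimes> x) else 0)))\<^sup>2) summable_on UNIV"
    using unit_op_square_summable(1)[OF assms] by (simp add: case_prod_unfold)
  then show ?thesis unfolding unit_op_def by (simp add: Abs_l2_inverse)
qed

lemma coef_unit_op':
  assumes "g \<in> carrier G"
  shows "coef (unit_op i j g v) p = (if fst p = i \<and> snd p \<in> carrier G then coef v (j, inv g \<otimes> snd p) else 0)"
  using coef_unit_op[OF assms, of i j v "fst p" "snd p"] by simp

lemma norm_unit_op_le: "g \<in> carrier G \<Longrightarrow> norm (unit_op i j g v) \<le> norm v"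
proof -
  assume g: "g \<in> carrier G"
  have "(norm (unit_op i j g v))\<^sup>2 \<le> (norm v)\<^sup>2"
    using unit_op_square_summable(2)[OF g, of i v j]
    unfolding norm_l2_square[of "unit_op i j g v"] coef_unit_op'[OF g] .
  then show ?thesis by (rule power2_le_imp_le) simp
qed

lemma unit_op_cscale: "g \<in> carrier G \<Longrightarrow> unit_op i j g (cscale c v) = cscale c (unit_op i j g v)"
  by (rule l2_eqI) (auto simp: coef_unit_op cscale.rep_eq)

lemma unit_op_add: "g \<in> carrier G \<Longrightarrow> unit_op i j g (v + w) = unit_op i j g v + unit_op i j g w"
  by (rule l2_eqI) (auto simp: coef_unit_op plus_l2.rep_eq)

lemma bounded_linear_unit_op: "g \<in> carrier G \<Longrightarrow> bounded_linear (unit_op i j g)"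
  by (rule bounded_linear_intro[where K = 1])
    (simp_all add: unit_op_add unit_op_cscale scaleR_l2_cscale norm_unit_op_le)

lemma unit_op_unit_op:
  assumes "g \<in> carrier G" "h \<in> carrier G"
  shows "unit_op i j g (unit_op k l h v) = (if j = k then unit_op i l (g \<otimes> h) v else 0)"
  by (rule l2_eqI)
    (use assms in \<open>auto simp: coef_unit_op coef_zero inv_mult_group m_assoc\<close>)

lemma unit_op_basis:
  assumes "g \<in> carrier G" "y \<in> carrier G"
  shows "unit_op i j g (basis (k, y)) = (if j = k then basis (i, g \<otimes> y) else 0)"
proof (rule l2_eqI, clarify)
  fix k' x
  have "inv g \<otimes> x = y \<longleftrightarrow> x = g \<otimes> y" if "x \<in> carrier G"
    using assms that by (metis inv_solve_left')
  then show "coef (unit_op i j g (basis (k, y))) (k', x) =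
      coef (if j = k then basis (i, g \<otimes> y) else 0) (k', x)"
    using assms by (auto simp: coef_unit_op basis.rep_eq coef_zero)
qed

lemma unit_op_adjoint:
  assumes g: "g \<in> carrier G"
  shows "cinner (unit_op i j g v) w = cinner v (unit_op j i (inv g) w)"
proof -
  let ?D = "{i} \<times> carrier G" and ?R = "{j} \<times> carrier G"
  have bij: "bij_betw (\<lambda>p. (j, inv g \<otimes> snd p)) ?D ?R"
    by (rule bij_betw_byWitness[where f' = "\<lambda>p. (i, g \<otimes> snd p)"])
      (use g in \<open>auto simp flip: m_assoc\<close>)
  have "cinner (unit_op i j g v) w = (\<Sum>\<^sub>\<infinity>p\<in>?D. coef v (j, inv g \<otimes> snd p) * cnj (coef w p))"
    unfolding cinner.rep_eq by (rule infsum_cong_neutral) (auto simp: coef_unit_op g split: if_splits)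
  also have "\<dots> = (\<Sum>\<^sub>\<infinity>p\<in>?D. coef v (j, inv g \<otimes> snd p) * cnj (coef w (i, g \<otimes> snd (j, inv g \<otimes> snd p))))"
    by (rule infsum_cong) (auto simp: g simp flip: m_assoc)
  also have "\<dots> = (\<Sum>\<^sub>\<infinity>p\<in>?R. coef v p * cnj (coef w (i, g \<otimes> snd p)))"
    using infsum_reindex_bij_betw[OF bij, of "\<lambda>p. coef v p * cnj (coef w (i, g \<otimes> snd p))"]
    by (simp add: case_prod_unfold)
  also have "\<dots> = cinner v (unit_op j i (inv g) w)"
    unfolding cinner.rep_eq by (rule infsum_cong_neutral) (auto simp: coef_unit_op g split: if_splits)
  finally show ?thesis .
qed

text \<open>The linear span as an inductive set, so that bilinear identities reduce to the matrix
  units.\<close>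

inductive_set alg :: "nat \<Rightarrow> ((nat \<times> 'a) l2 \<Rightarrow> (nat \<times> 'a) l2) set" for d where
  unit: "i < d \<Longrightarrow> j < d \<Longrightarrow> g \<in> carrier G \<Longrightarrow> unit_op i j g \<in> alg d"
| zero: "(\<lambda>v. 0) \<in> alg d"
| add: "X \<in> alg d \<Longrightarrow> Y \<in> alg d \<Longrightarrow> (\<lambda>v. X v + Y v) \<in> alg d"
| scale: "X \<in> alg d \<Longrightarrow> (\<lambda>v. cscale c (X v)) \<in> alg d"

lemma cscale_zero: "cscale c 0 = 0"
  by transfer simp

lemma cscale_add: "cscale c (v + w) = cscale c v + cscale c w"
  by transfer (simp add: distrib_left)

lemma cscale_cscale: "cscale c (cscale c' v) = cscale (c * c') v"
  by transfer (simp add: mult.assoc)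

lemma alg_linear:
  assumes "X \<in> alg d"
  shows "X (v + w) = X v + X w" "X (cscale c v) = cscale c (X v)" "X 0 = 0"
  using assms
proof (induction arbitrary: v w c)
  case (unit i j g)
  { case 1 then show ?case using unit by (simp add: unit_op_add) }
  { case 2 then show ?case using unit by (simp add: unit_op_cscale) }
  { case 3 then show ?case using unit
      by (simp add: bounded_linear.linear[OF bounded_linear_unit_op] linear_0) }
next
  case zero
  { case 1 then show ?case by simp }
  { case 2 then show ?case by (simp add: cscale_zero) }
  { case 3 then show ?case by simp }
next
  case (add X Y)
  { case 1 then show ?case using add by simp }
  { case 2 then show ?case using add by (simp add: cscale_add) }
  { case 3 then show ?case using add by simp }
next
  case (scale X a)
  { case 1 then show ?case using scale by (simp add: cscale_add) }
  { case 2 then show ?case using scale by (simp add: cscale_cscale mult.commute) }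
  { case 3 then show ?case using scale by (simp add: cscale_zero) }
qed

lemma alg_op_on:
  assumes "X \<in> alg d"
  shows "op_on (tensor_index G d) X"
  using assms
proof induction
  case (unit i j g)
  have "restr (tensor_index G d) (unit_op i j g v) = unit_op i j g v" for v
    by (rule l2_eqI) (use unit in \<open>auto simp: restr.rep_eq coef_unit_op split: if_splits\<close>)
  moreover have "unit_op i j g (restr (tensor_index G d) v) = unit_op i j g v" for v
    by (rule l2_eqI) (use unit in \<open>auto simp: restr.rep_eq coef_unit_op split: if_splits\<close>)
  ultimately show ?case
    using unit by (simp add: op_on_def bounded_linear_unit_op unit_op_cscale)
next
  case zero
  have "restr I 0 = 0" for I :: "(nat \<times> 'a) set" by transfer auto
  then show ?case by (simp add: op_on_def cscale_zero bounded_linear_zero)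
next
  case (add X Y)
  then show ?case
    by (auto simp: op_on_def cscale_add bounded_linear_add
        linear_add[OF bounded_linear.linear[OF bounded_linear_restr]])
next
  case (scale X c)
  have "restr I (cscale c v) = cscale c (restr I v)" for I and v :: "(nat \<times> 'a) l2"
    by transfer auto
  with scale show ?case
    by (auto simp: op_on_def cscale_cscale mult.commute
        intro: bounded_linear_compose[OF bounded_linear_cscale])
qed

lemma alg_comp:
  assumes X: "X \<in> alg d" and Y: "Y \<in> alg d"
  shows "(\<lambda>v. X (Y v)) \<in> alg d"
  using X
proof induction
  case X: (unit i j g)
  show ?case using Y
  proof induction
    case (unit k l h)
    then show ?case
      using X alg.unit[of i d l "g \<otimes> h"] alg.zero by (cases "j = k") (auto simp: unit_op_unit_op)
  next
    case zero
    then show ?case using alg.zero alg_linear(3)[OF alg.unit[OF X]] by simp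
  next
    case (add A B)
    then show ?case using alg.add by (simp add: alg_linear(1)[OF alg.unit[OF X]])
  next
    case (scale A c)
    then show ?case using alg.scale by (simp add: alg_linear(2)[OF alg.unit[OF X]])
  qed
qed (auto intro: alg.intros)

definition tr_op :: "nat \<Rightarrow> ((nat \<times> 'a) l2 \<Rightarrow> (nat \<times> 'a) l2) \<Rightarrow> complex" where
  "tr_op d X = (\<Sum>i<d. cinner (X (basis (i, \<one>))) (basis (i, \<one>)))"

lemma tr_op_add: "tr_op d (\<lambda>v. X v + Y v) = tr_op d X + tr_op d Y"
  by (simp add: tr_op_def cinner_add sum.distrib)

lemma tr_op_scale: "tr_op d (\<lambda>v. cscale c (X v)) = c * tr_op d X"
  by (simp add: tr_op_def cinner_scale sum_distrib_left)

lemma cinner_zero: "cinner 0 v = 0"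
  by transfer simp

lemma tr_op_zero: "tr_op d (\<lambda>v. 0) = 0"
  by (simp add: tr_op_def cinner_zero)

lemma tr_op_unit_op:
  assumes "i < d" "g \<in> carrier G"
  shows "tr_op d (unit_op i j g) = (if i = j \<and> g = \<one> then 1 else 0)"
proof -
  have "tr_op d (unit_op i j g) = (\<Sum>k<d. if k = i then (if i = j \<and> g = \<one> then 1 else 0) else 0)"
    unfolding tr_op_def
    by (rule sum.cong) (use assms in \<open>auto simp: unit_op_basis cinner_basis basis.rep_eq coef_zero\<close>)
  then show ?thesis using assms by simp
qed

text \<open>On matrix units everything comes down to g h = e iff h g = e.\<close>

lemma tr_op_tracial:
  assumes X: "X \<in> alg d" and Y: "Y \<in> alg d"
  shows "tr_op d (\<lambda>v. X (Y v)) = tr_op d (\<lambda>v. Y (X v))"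
  using X
proof induction
  case X: (unit i j g)
  show ?case using Y
  proof induction
    case (unit k l h)
    have "g \<otimes> h = \<one> \<longleftrightarrow> h \<otimes> g = \<one>"
      using X unit by (metis inv_comm)
    moreover have "tr_op d (\<lambda>v. unit_op i j g (unit_op k l h v)) =
        (if j = k then tr_op d (unit_op i l (g \<otimes> h)) else 0)"
      using X unit by (cases "j = k") (simp_all add: unit_op_unit_op tr_op_zero)
    moreover have "tr_op d (\<lambda>v. unit_op k l h (unit_op i j g v)) =
        (if l = i then tr_op d (unit_op k j (h \<otimes> g)) else 0)"
      using X unit by (cases "l = i") (simp_all add: unit_op_unit_op tr_op_zero)
    ultimately show ?case
      using X unit by (auto simp: tr_op_unit_op)
  next
    case zero
    then show ?case by (simp add: alg_linear(3)[OF alg.unit[OF X]])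
  next
    case (add A B)
    then show ?case by (simp add: alg_linear(1)[OF alg.unit[OF X]] tr_op_add)
  next
    case (scale A c)
    then show ?case by (simp add: alg_linear(2)[OF alg.unit[OF X]] tr_op_scale)
  qed
next
  case zero
  then show ?case by (simp add: alg_linear(3)[OF Y])
next
  case (add A B)
  then show ?case by (simp add: alg_linear(1)[OF Y] tr_op_add)
next
  case (scale A c)
  then show ?case by (simp add: alg_linear(2)[OF Y] tr_op_scale)
qed

text \<open>(XY)^(m+1) = X (YX)^m Y, so the trace property applies. This rotates W' past U' U W in
  the moments of the test elements, and it also passes from F' F to F F'.\<close>

lemma tr_op_pow_commute:
  assumes X: "X \<in> alg d" and Y: "Y \<in> alg d"
  shows "tr_op d ((\<lambda>v. X (Y v)) ^^ n) = tr_op d ((\<lambda>v. Y (X v)) ^^ n)"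
proof (cases n)
  case (Suc m)
  let ?P = "\<lambda>v. X (Y v)" and ?Q = "\<lambda>v. Y (X v)"
  have PQ: "X ((?Q ^^ m) w) = (?P ^^ m) (X w)" for w
    by (induction m) auto
  have Z: "(\<lambda>v. (?Q ^^ m) (Y v)) \<in> alg d"
  proof (induction m)
    case (Suc m)
    then show ?case using alg_comp[OF alg_comp[OF Y X]] by simp
  qed (use Y in simp)
  have "tr_op d (?P ^^ Suc m) = tr_op d (\<lambda>v. X ((?Q ^^ m) (Y v)))"
    unfolding PQ by (simp only: funpow_Suc_right o_def)
  also have "\<dots> = tr_op d (\<lambda>v. (?Q ^^ m) (Y (X v)))"
    by (rule tr_op_tracial[OF X Z])
  also have "\<dots> = tr_op d (?Q ^^ Suc m)"
    by (simp only: funpow_Suc_right o_def)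
  finally show ?thesis using Suc by simp
qed simp

section \<open>The operators \<open>\<Sum> C\<^sub>m \<otimes> \<lambda>\<^bsub>g m\<^esub>\<close>\<close>

definition lambda_op :: "nat \<Rightarrow> 'm set \<Rightarrow> ('m \<Rightarrow> nat \<Rightarrow> nat \<Rightarrow> complex) \<Rightarrow> ('m \<Rightarrow> 'a) \<Rightarrow>
    (nat \<times> 'a) l2 \<Rightarrow> (nat \<times> 'a) l2" where
  "lambda_op d S c g v = (\<Sum>m\<in>S. \<Sum>i<d. \<Sum>j<d. cscale (c m i j) (unit_op i j (g m) v))"

lemma alg_sum:
  assumes "finite S" "\<And>m. m \<in> S \<Longrightarrow> X m \<in> alg d"
  shows "(\<lambda>v. \<Sum>m\<in>S. X m v) \<in> alg d"
  using assms by (induction S rule: finite_induct) (auto intro: alg.zero alg.add)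

lemma lambda_op_alg: "finite S \<Longrightarrow> g ` S \<subseteq> carrier G \<Longrightarrow> lambda_op d S c g \<in> alg d"
  unfolding lambda_op_def[abs_def] by (intro alg_sum alg.scale alg.unit) auto

lemma coef_sum: "coef (\<Sum>m\<in>S. f m) p = (\<Sum>m\<in>S. coef (f m) p)"
  by (induction S rule: infinite_finite_induct) (auto simp: coef_zero plus_l2.rep_eq)

lemma cinner_sum: "cinner (\<Sum>m\<in>S. f m) w = (\<Sum>m\<in>S. cinner (f m) w)"
  by (induction S rule: infinite_finite_induct) (auto simp: cinner_zero cinner_add)

lemma cinner_sum_right: "cinner v (\<Sum>m\<in>S. f m) = (\<Sum>m\<in>S. cinner v (f m))"
  by (subst (1 2) cinner_commute) (simp add: cinner_sum)

lemma lambda_sum_coef: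
  assumes "g ` S \<subseteq> carrier G" "\<xi> \<in> ell2 (tensor_index G d)"
  shows "lambda_sum G d S C g \<xi> = fun_op (tensor_index G d) (lambda_op d S (\<lambda>m i j. C m $$ (i, j)) g) \<xi>"
proof
  fix p :: "nat \<times> 'a"
  obtain k x where p: "p = (k, x)" by (cases p)
  obtain v where v: "restr (tensor_index G d) v = v" "coef v = \<xi>"
    by (rule ell2E[OF assms(2)])
  have "coef (lambda_op d S (\<lambda>m i j. C m $$ (i, j)) g v) (k, x) =
      (\<Sum>m\<in>S. \<Sum>i<d. \<Sum>j<d. C m $$ (i, j) * (if k = i \<and> x \<in> carrier G then \<xi> (j, inv (g m) \<otimes> x) else 0))"
    unfolding lambda_op_def coef_sum cscale.rep_eq v(2)[symmetric]
    by (intro sum.cong refl) (use assms in \<open>simp add: coef_unit_op image_subset_iff\<close>)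
  also have "\<dots> = (\<Sum>m\<in>S. \<Sum>i<d. if k = i then \<Sum>j<d. C m $$ (i, j) * (if x \<in> carrier G then \<xi> (j, inv (g m) \<otimes> x) else 0) else 0)"
    by (intro sum.cong refl) auto
  also have "\<dots> = lambda_sum G d S C g \<xi> (k, x)"
    unfolding lambda_sum_def mat_tensor_def left_regular_def
    by (intro sum.cong refl) auto
  finally show "lambda_sum G d S C g \<xi> p = fun_op (tensor_index G d) (lambda_op d S (\<lambda>m i j. C m $$ (i, j)) g) \<xi> p"
    using fun_op_coef[OF v(1)] v(2) p by simp
qed

lemma lambda_op_adjoint:
  assumes "g ` S \<subseteq> carrier G"
  shows "cinner (lambda_op d S c g v) w = cinner v (lambda_op d S (\<lambda>m i j. cnj (c m j i)) (\<lambda>m. inv (g m)) w)"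
proof -
  have "cinner (lambda_op d S c g v) w = (\<Sum>m\<in>S. \<Sum>i<d. \<Sum>j<d. c m i j * cinner v (unit_op j i (inv (g m)) w))"
    unfolding lambda_op_def cinner_sum cinner_scale
    by (intro sum.cong refl) (use assms in \<open>simp add: unit_op_adjoint image_subset_iff\<close>)
  also have "\<dots> = (\<Sum>m\<in>S. \<Sum>j<d. \<Sum>i<d. c m i j * cinner v (unit_op j i (inv (g m)) w))"
    by (intro sum.cong refl sum.swap)
  also have "\<dots> = cinner v (lambda_op d S (\<lambda>m i j. cnj (c m j i)) (\<lambda>m. inv (g m)) w)"
    unfolding lambda_op_def cinner_sum_right cinner_scale_right by simp
  finally show ?thesis .
qed

text \<open>A crude bound suffices: it supplies the constant M, which only normalizes the series and
  disappears from the final estimate.\<close>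

lemma norm_lambda_op_le:
  assumes "g ` S \<subseteq> carrier G" "\<And>m i j. m \<in> S \<Longrightarrow> i < d \<Longrightarrow> j < d \<Longrightarrow> cmod (c m i j) \<le> b"
  shows "norm (lambda_op d S c g v) \<le> real (card S) * (real d * (real d * b)) * norm v"
proof -
  have "norm (lambda_op d S c g v) \<le> (\<Sum>m\<in>S. \<Sum>i<d. \<Sum>j<d. norm (cscale (c m i j) (unit_op i j (g m) v)))"
    unfolding lambda_op_def by (intro order_trans[OF norm_sum] sum_mono norm_sum)
  also have "\<dots> \<le> (\<Sum>m\<in>S. \<Sum>i<d. \<Sum>j<d. b * norm v)"
    unfolding norm_cscale
  proof (intro sum_mono mult_mono)
    fix m i j assume "m \<in> S" "i \<in> {..<d}" "j \<in> {..<d}"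
    then show "cmod (c m i j) \<le> b" "norm (unit_op i j (g m) v) \<le> norm v" "0 \<le> b"
      using assms order_trans[OF norm_ge_zero assms(2)] by (auto simp: norm_unit_op_le)
  qed simp
  finally show ?thesis by (simp add: algebra_simps)
qed

end

section \<open>The averaged moment bound\<close>

text \<open>From |F' v|^2 = <F F' v, v> one gets |F' v|^4 <= M |F' v|^2 |v|^2, so the adjoint obeys
  the same bound. The set V^-1 is treated through this exchange.\<close>

lemma adjoint_pair_swap:
  assumes "adjoint_pair I F F' M"
  shows "adjoint_pair I F' F M"
proof -
  interpret adjoint_pair I F F' M by fact
  have adj': "cinner (F' v) w = cinner v (F w)" for v w
    by (metis adj cinner_commute)
  have "(norm (F' v))\<^sup>2 \<le> M * (norm v)\<^sup>2" for v
  proof -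
    have "(norm (F' v))\<^sup>2 = F (F' v) \<bullet> v"
      by (simp add: power2_norm_eq_inner inner_eq_Re adj' cinner_commute[of "F (F' v)"] flip: adj')
    also have "\<dots> \<le> norm (F (F' v)) * norm v" by (rule norm_cauchy_schwarz)
    finally have "((norm (F' v))\<^sup>2)\<^sup>2 \<le> (norm (F (F' v)) * norm v)\<^sup>2"
      by (rule power_mono) simp
    also have "\<dots> \<le> (M * (norm (F' v))\<^sup>2) * (norm v)\<^sup>2"
      unfolding power_mult_distrib by (intro mult_right_mono norm_le) simp
    finally have le: "(norm (F' v))\<^sup>2 * (norm (F' v))\<^sup>2 \<le> (norm (F' v))\<^sup>2 * (M * (norm v)\<^sup>2)"
      by (simp add: power2_eq_square mult_ac)
    show ?thesis
    proof (cases "F' v = 0")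
      case True
      then show ?thesis using M by simp
    next
      case False
      show ?thesis by (rule mult_left_le_imp_le[OF le]) (use False in simp)
    qed
  qed
  then show ?thesis using F F' adj' M by unfold_locales auto
qed

context group
begin

lemma tr_tau_fun_op:
  assumes "op_on (tensor_index G d) L"
  shows "Re (tr_tau G d (fun_op (tensor_index G d) L)) = (\<Sum>i<d. L (basis (i, \<one>)) \<bullet> basis (i, \<one>))"
proof -
  have "ell2_inner (tensor_index G d) (fun_op (tensor_index G d) L (\<lambda>k. if k = (i, \<one>) then 1 else 0))
      (\<lambda>k. if k = (i, \<one>) then 1 else 0) = cinner (L (basis (i, \<one>))) (basis (i, \<one>))" if "i < d" for i
  proof -
    have b: "restr (tensor_index G d) (basis (i, \<one>)) = basis (i, \<one>)"
      by (rule l2_eqI) (use that in \<open>auto simp: restr.rep_eq basis.rep_eq\<close>)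
    have r: "restr (tensor_index G d) (L v) = L v" for v using assms by (simp add: op_on_def)
    show ?thesis
      unfolding basis.rep_eq[symmetric] fun_op_coef[OF b] ell2_inner_coef[OF r] by simp
  qed
  then show ?thesis by (simp add: tr_tau_def inner_eq_Re)
qed

lemma L1_norm_eq:
  assumes "adjoint_pair (tensor_index G d) F F' M"
    and "\<And>\<xi>. \<xi> \<in> ell2 (tensor_index G d) \<Longrightarrow> T \<xi> = fun_op (tensor_index G d) F \<xi>"
  shows "L1_norm G d T =
    (\<Sum>i<d. scaled_pos_op.sqrt_pos (adjoint_pair.A F F') M (basis (i, \<one>)) \<bullet> basis (i, \<one>))"
proof -
  interpret adjoint_pair "tensor_index G d" F F' M by fact
  have "abs_op (tensor_index G d) T = fun_op (tensor_index G d) sqrt_pos"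
    by (rule abs_op_eq) (rule assms(2))
  then show ?thesis
    unfolding L1_norm_def by (simp only: tr_tau_fun_op[OF op_on_sqrt_pos])
qed

lemma L1_norm_nonneg:
  assumes "adjoint_pair (tensor_index G d) F F' M"
    and "\<And>\<xi>. \<xi> \<in> ell2 (tensor_index G d) \<Longrightarrow> T \<xi> = fun_op (tensor_index G d) F \<xi>"
  shows "0 \<le> L1_norm G d T"
proof -
  interpret adjoint_pair "tensor_index G d" F F' M by fact
  have "L1_norm G d T = (\<Sum>i<d. sqrt_pos (basis (i, \<one>)) \<bullet> basis (i, \<one>))"
    by (rule L1_norm_eq[OF assms(1)]) (rule assms(2))
  moreover have "0 \<le> sqrt_pos v \<bullet> v" for v
    using pos_op_sqrt_pos unfolding pos_op_def by blast
  ultimately show ?thesis by (simp only: sum_nonneg)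
qed

text \<open>
  If the moments of \<open>F\<^sub>\<theta>\<^sup>* F\<^sub>\<theta>\<close>, averaged over \<open>\<theta>\<close>, are those of the measure with an atom \<open>w\<^sub>0\<close> at 0 and the
  image of \<open>w\<^sub>1 d\<theta>\<close> under \<open>f\<close>, then the average of the \<open>L\<^sub>1\<close> norms is at most the integral of the square root
  against that measure: compare with the partial sums of the binomial series of \<open>(1 - y)\<^sup>1\<^sup>/\<^sup>2\<close>.
\<close>

lemma L1_moment_bound:
  fixes f :: "real \<Rightarrow> real"
  assumes pair: "\<And>\<theta>. adjoint_pair (tensor_index G d) (F \<theta>) (F' \<theta>) M"
    and T: "\<And>\<theta> \<xi>. \<xi> \<in> ell2 (tensor_index G d) \<Longrightarrow> T \<theta> \<xi> = fun_op (tensor_index G d) (F \<theta>) \<xi>"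
    and mom: "\<And>j. ((\<lambda>\<theta>. Re (tr_op d ((\<lambda>v. F' \<theta> (F \<theta> v)) ^^ j))) has_integral
        integral {0..2 * pi} (\<lambda>\<theta>. w0 * 0 ^ j + w1 * f \<theta> ^ j)) {0..2 * pi}"
    and f: "continuous_on {0..2 * pi} f" "\<And>\<theta>. 0 \<le> f \<theta>" "\<And>\<theta>. f \<theta> \<le> M"
    and w: "0 \<le> w0" "0 \<le> w1" and b: "\<And>\<theta>. b \<le> L1_norm G d (T \<theta>)"
  shows "2 * pi * b \<le> integral {0..2 * pi} (\<lambda>\<theta>. w1 * sqrt (f \<theta>))"
proof -
  have M: "0 < M" using pair adjoint_pair.M by blast
  define A where A_eq: "A \<theta> = adjoint_pair.A (F \<theta>) (F' \<theta>)" for \<theta>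
  define D where "D \<theta> = scaled_pos_op.defect (A \<theta>) M" for \<theta>
  have sp: "scaled_pos_op (A \<theta>) M" for \<theta>
  proof -
    interpret adjoint_pair "tensor_index G d" "F \<theta>" "F' \<theta>" M by (rule pair)
    show ?thesis unfolding A_eq by (rule scaled_pos_op_axioms)
  qed
  have A: "A \<theta> v = F' \<theta> (F \<theta> v)" for \<theta> v
    unfolding A_eq by (rule adjoint_pair.A_def[OF pair])
  have D: "D \<theta> v = v - (1 / M) *\<^sub>R A \<theta> v" for \<theta> v
    unfolding D_def by (rule scaled_pos_op.defect_def[OF sp])
  \<comment> \<open>Mixed moments of A^j D^k with D = 1 - A/M: the hypothesis covers k = 0, the
    series involves j = 0.\<close>
  define mom' where "mom' k j \<theta> = (\<Sum>i<d. (A \<theta> ^^ j) ((D \<theta> ^^ k) (basis (i, \<one>))) \<bullet> basis (i, \<one>))" for k j \<theta>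
  \<comment> \<open>The atom contributes \<open>w0 * 0 ^ j\<close> for every k, because 1 - y/M
    equals 1 at y = 0; here 0^0 = 1.\<close>
  define h where "h k j \<theta> = w0 * 0 ^ j + w1 * (f \<theta> ^ j * (1 - f \<theta> / M) ^ k)" for k j \<theta>
  have int_h: "h k j integrable_on {0..2 * pi}" for k j
    unfolding h_def[abs_def] by (intro integrable_continuous_interval continuous_intros f(1)) (use M in auto)
  \<comment> \<open>Induction on k for all j at once, by A^j D^(k+1) = A^j D^k - A^(j+1) D^k /
    M.\<close>
  have "(mom' k j has_integral integral {0..2 * pi} (h k j)) {0..2 * pi}" for k j
  proof (induction k arbitrary: j)
    case 0
    have "Re (tr_op d ((\<lambda>v. F' \<theta> (F \<theta> v)) ^^ j)) = mom' 0 j \<theta>" for \<theta>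
      by (simp add: tr_op_def mom'_def inner_eq_Re flip: A)
    then show ?case using mom[of j] by (simp add: h_def[abs_def] mom'_def[abs_def])
  next
    case (Suc k)
    have "mom' (Suc k) j \<theta> = mom' k j \<theta> - (1 / M) * mom' k (Suc j) \<theta>" for \<theta>
    proof -
      have "linear (A \<theta> ^^ j)"
      proof (induction j)
        case (Suc j)
        then show ?case
          using linear_compose[OF Suc scaled_pos_op.linear_A[OF sp, of \<theta>]] by (simp add: o_def)
      qed (simp add: linear_id id_def[symmetric])
      then have "(A \<theta> ^^ j) ((D \<theta> ^^ Suc k) v) = (A \<theta> ^^ j) ((D \<theta> ^^ k) v) - (1 / M) *\<^sub>R (A \<theta> ^^ Suc j) ((D \<theta> ^^ k) v)" for v
        unfolding funpow_Suc_right[of j] using D[of \<theta> "(D \<theta> ^^ k) v"] by (simp add: linear_diff linear_scale)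
      then show ?thesis
        by (simp add: mom'_def inner_diff_left sum_subtractf sum_distrib_left del: funpow.simps)
    qed
    then have "mom' (Suc k) j = (\<lambda>\<theta>. mom' k j \<theta> - (1 / M) * mom' k (Suc j) \<theta>)" by blast
    moreover have "h (Suc k) j = (\<lambda>\<theta>. h k j \<theta> - (1 / M) * h k (Suc j) \<theta>)"
      by (rule ext) (simp add: h_def field_simps)
    moreover have "integral {0..2 * pi} (\<lambda>\<theta>. h k j \<theta> - (1 / M) * h k (Suc j) \<theta>) =
        integral {0..2 * pi} (h k j) - (1 / M) * integral {0..2 * pi} (h k (Suc j))"
      by (subst integral_diff[OF int_h integrable_on_mult_right[OF int_h]]) simp
    ultimately show ?case
      using has_integral_diff[OF Suc[of j] has_integral_mult_right[OF Suc[of "Suc j"], of "1 / M"]] by simp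
  qed
  then have mom0: "(mom' k 0 has_integral integral {0..2 * pi} (h k 0)) {0..2 * pi}" for k .
  define t where "t N = (\<Sum>k. \<bar>sqrt_coeff (k + Suc N)\<bar>)" for N
  have int_sqrt: "(\<lambda>\<theta>. w1 * sqrt (f \<theta>)) integrable_on {0..2 * pi}"
    by (intro integrable_continuous_interval continuous_intros f(1))
  have bound: "2 * pi * b \<le> integral {0..2 * pi} (\<lambda>\<theta>. w1 * sqrt (f \<theta>)) + 2 * pi * (sqrt M * (w0 + w1)) * t N" for N
  proof -
    have le: "b \<le> sqrt M * (\<Sum>k\<le>N. sqrt_coeff k * mom' k 0 \<theta>)" for \<theta>
    proof -
      have "b \<le> (\<Sum>i<d. scaled_pos_op.sqrt_pos (A \<theta>) M (basis (i, \<one>)) \<bullet> basis (i, \<one>))"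
        unfolding A_eq by (rule order_trans[OF b eq_refl[OF L1_norm_eq[OF pair]]]) (rule T)
      also have "\<dots> \<le> (\<Sum>i<d. sqrt M * (\<Sum>k\<le>N. sqrt_coeff k * ((D \<theta> ^^ k) (basis (i, \<one>)) \<bullet> basis (i, \<one>))))"
        unfolding D_def by (intro sum_mono scaled_pos_op.sqrt_pos_inner_le[OF sp])
      also have "\<dots> = sqrt M * (\<Sum>i<d. \<Sum>k\<le>N. sqrt_coeff k * ((D \<theta> ^^ k) (basis (i, \<one>)) \<bullet> basis (i, \<one>)))"
        by (simp only: sum_distrib_left)
      also have "(\<Sum>i<d. \<Sum>k\<le>N. sqrt_coeff k * ((D \<theta> ^^ k) (basis (i, \<one>)) \<bullet> basis (i, \<one>))) =
          (\<Sum>k\<le>N. \<Sum>i<d. sqrt_coeff k * ((D \<theta> ^^ k) (basis (i, \<one>)) \<bullet> basis (i, \<one>)))"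
        by (rule sum.swap)
      finally show ?thesis by (simp only: mom'_def funpow_0 sum_distrib_left)
    qed
    have "((\<lambda>\<theta>. sqrt M * (\<Sum>k\<le>N. sqrt_coeff k * mom' k 0 \<theta>)) has_integral
        sqrt M * (\<Sum>k\<le>N. sqrt_coeff k * integral {0..2 * pi} (h k 0))) {0..2 * pi}"
      by (intro has_integral_mult_right has_integral_sum mom0) auto
    \<comment> \<open>The left side is constant in \<theta>; what is integrated on the right is a
      finite combination of moments.\<close>
    then have "integral {0..2 * pi} (\<lambda>\<theta>. b) \<le> sqrt M * (\<Sum>k\<le>N. sqrt_coeff k * integral {0..2 * pi} (h k 0))"
      by (intro has_integral_le[OF integrable_integral[OF integrable_const_ivl]]) (use le in auto)
    also have "\<dots> = integral {0..2 * pi} (\<lambda>\<theta>. sqrt M * (\<Sum>k\<le>N. sqrt_coeff k * h k 0 \<theta>))"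
      by (rule integral_unique[symmetric], intro has_integral_mult_right has_integral_sum)
        (auto intro: integrable_integral int_h)
    also have "\<dots> \<le> integral {0..2 * pi} (\<lambda>\<theta>. w1 * sqrt (f \<theta>) + sqrt M * (w0 + w1) * t N)"
    proof (rule integral_le)
      show "(\<lambda>\<theta>. sqrt M * (\<Sum>k\<le>N. sqrt_coeff k * h k 0 \<theta>)) integrable_on {0..2 * pi}"
        by (intro integrable_on_mult_right integrable_sum int_h) auto
      show "(\<lambda>\<theta>. w1 * sqrt (f \<theta>) + sqrt M * (w0 + w1) * t N) integrable_on {0..2 * pi}"
        by (intro integrable_add int_sqrt integrable_const_ivl)
      fix \<theta>
      \<comment> \<open>The atom at 0 corresponds to y = 1, where the root vanishes and a partial
        sum is pure error.\<close>
      have "\<bar>(\<Sum>k\<le>N. sqrt_coeff k * 1 ^ k) - sqrt (1 - 1)\<bar> \<le> 1 ^ Suc N * t N"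
        unfolding t_def by (rule sqrt_approx_error) auto
      then have 0: "(\<Sum>k\<le>N. sqrt_coeff k) \<le> t N" by simp
      have "\<bar>(\<Sum>k\<le>N. sqrt_coeff k * (1 - f \<theta> / M) ^ k) - sqrt (1 - (1 - f \<theta> / M))\<bar> \<le> 1 ^ Suc N * t N"
        unfolding t_def by (rule sqrt_approx_error) (use f(2,3)[of \<theta>] M in \<open>auto simp: abs_le_iff field_simps\<close>)
      then have 1: "(\<Sum>k\<le>N. sqrt_coeff k * (1 - f \<theta> / M) ^ k) \<le> sqrt (f \<theta>) / sqrt M + t N"
        by (simp add: real_sqrt_divide)
      have "sqrt M * (\<Sum>k\<le>N. sqrt_coeff k * h k 0 \<theta>) =
          sqrt M * (w0 * (\<Sum>k\<le>N. sqrt_coeff k) + w1 * (\<Sum>k\<le>N. sqrt_coeff k * (1 - f \<theta> / M) ^ k))"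
        by (simp add: h_def sum_distrib_left sum.distrib algebra_simps)
      also have "\<dots> \<le> sqrt M * (w0 * t N + w1 * (sqrt (f \<theta>) / sqrt M + t N))"
        by (intro mult_left_mono add_mono 0 1 w) (use M in auto)
      also have "\<dots> = w1 * sqrt (f \<theta>) + sqrt M * (w0 + w1) * t N"
        using M by (simp add: field_simps)
      finally show "sqrt M * (\<Sum>k\<le>N. sqrt_coeff k * h k 0 \<theta>) \<le> w1 * sqrt (f \<theta>) + sqrt M * (w0 + w1) * t N" .
    qed
    finally show ?thesis
      by (subst (asm) integral_add[OF int_sqrt integrable_const_ivl]) (simp add: mult_ac)
  qed
  have "(\<lambda>N. integral {0..2 * pi} (\<lambda>\<theta>. w1 * sqrt (f \<theta>)) + 2 * pi * (sqrt M * (w0 + w1)) * t N)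
      \<longlonglongrightarrow> integral {0..2 * pi} (\<lambda>\<theta>. w1 * sqrt (f \<theta>)) + 2 * pi * (sqrt M * (w0 + w1)) * 0"
    unfolding t_def by (intro tendsto_intros sqrt_coeff_tail)
  then show ?thesis
    using bound by (intro LIMSEQ_le_const) (auto intro: exI[of _ 0])
qed

end

section \<open>The test elements\<close>

lemma integral_cos_multiple:
  "((\<lambda>\<theta>. cos (of_int n * \<theta>)) has_integral (if n = 0 then 2 * pi else 0)) {0..2 * pi}"
proof (cases "n = 0")
  case True
  then show ?thesis using has_integral_const_real[of "1 :: real" 0 "2 * pi"] by simp
next
  case False
  have "((\<lambda>\<theta>. cos (of_int n * \<theta>)) has_integral
      sin (of_int n * (2 * pi)) / of_int n - sin (of_int n * 0) / of_int n) {0..2 * pi}"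
  proof (rule fundamental_theorem_of_calculus)
    show "((\<lambda>\<theta>. sin (of_int n * \<theta>) / of_int n) has_vector_derivative cos (of_int n * \<theta>)) (at \<theta> within {0..2 * pi})" for \<theta>
      unfolding has_real_derivative_iff_has_vector_derivative[symmetric]
      by (auto intro!: derivative_eq_intros simp: False)
  qed simp
  moreover have "sin (of_int n * (2 * pi)) = 0"
    using sin_int_2pin[of n] by (simp add: mult_ac)
  ultimately show ?thesis using False by simp
qed

text \<open>In the application \<open>P n\<close> means h^n = e. Frequencies n <> 0 integrate to 0
  whether present or not, and n = 0 is always present, so the order of h drops out.\<close>

lemma integral_trig_sum:
  assumes "P (0 :: int)"
  shows "((\<lambda>\<theta>. \<Sum>(a, n)\<leftarrow>L. a * (if P n then cos (of_int n * \<theta>) else 0)) has_integral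
    2 * pi * (\<Sum>(a, n)\<leftarrow>L. if n = 0 then a else 0)) {0..2 * pi}"
proof (induction L)
  case (Cons x L)
  obtain a n where x: "x = (a, n)" by (cases x)
  have "((\<lambda>\<theta>. a * (if P n then cos (of_int n * \<theta>) else 0)) has_integral 2 * pi * (if n = 0 then a else 0)) {0..2 * pi}"
  proof (cases "P n")
    case True
    then show ?thesis
      using has_integral_mult_right[OF integral_cos_multiple[of n], of a] by (cases "n = 0") (simp_all add: mult_ac)
  next
    case False
    then show ?thesis using assms by (cases "n = 0") simp_all
  qed
  from has_integral_add[OF this Cons] show ?case
    by (simp add: x distrib_left)
qed simp

text \<open>
  The Laurent coefficients of \<open>(4 + z + z\<^sup>-\<^sup>1)\<^sup>j\<close>, listed with repetitions so that multiplication by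
  \<open>4 + z + z\<^sup>-\<^sup>1\<close> needs no reindexing.
\<close>

fun walk :: "nat \<Rightarrow> (real \<times> int) list" where
  "walk 0 = [(1, 0)]"
| "walk (Suc j) = map (\<lambda>(a, n). (4 * a, n)) (walk j) @ map (\<lambda>(a, n). (a, n + 1)) (walk j) @
    map (\<lambda>(a, n). (a, n - 1)) (walk j)"

lemma walk_cis: "(\<Sum>(a, n)\<leftarrow>walk j. of_real a * cis (of_int n * \<theta>)) = of_real ((4 + 2 * cos \<theta>) ^ j)"
proof (induction j)
  case (Suc j)
  let ?S = "\<Sum>(a, n)\<leftarrow>walk j. of_real a * cis (of_int n * \<theta>)"
  have "(\<Sum>(a, n)\<leftarrow>L. of_real (4 * a) * cis (of_int n * \<theta>)) = 4 * (\<Sum>(a, n)\<leftarrow>L. of_real a * cis (of_int n * \<theta>))"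
    "(\<Sum>(a, n)\<leftarrow>L. of_real a * cis (of_int (n + 1) * \<theta>)) = cis \<theta> * (\<Sum>(a, n)\<leftarrow>L. of_real a * cis (of_int n * \<theta>))"
    "(\<Sum>(a, n)\<leftarrow>L. of_real a * cis (of_int (n - 1) * \<theta>)) = cis (- \<theta>) * (\<Sum>(a, n)\<leftarrow>L. of_real a * cis (of_int n * \<theta>))"
    for L by (induction L) (auto simp: algebra_simps cis_mult)
  then have "(\<Sum>(a, n)\<leftarrow>walk (Suc j). of_real a * cis (of_int n * \<theta>)) = (4 + cis \<theta> + cis (- \<theta>)) * ?S"
    by (simp add: comp_def case_prod_unfold distrib_right)
  also have "4 + cis \<theta> + cis (- \<theta>) = of_real (4 + 2 * cos \<theta>)"
    by (simp add: complex_eq_iff)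
  finally show ?case by (simp add: Suc)
qed simp

lemma walk_cos: "(\<Sum>(a, n)\<leftarrow>walk j. a * cos (of_int n * \<theta>)) = (4 + 2 * cos \<theta>) ^ j"
proof -
  have "Re (\<Sum>(a, n)\<leftarrow>L. of_real a * cis (of_int n * \<theta>)) = (\<Sum>(a, n)\<leftarrow>L. a * cos (of_int n * \<theta>))" for L
    by (induction L) auto
  from this[of "walk j"] show ?thesis unfolding walk_cis by simp
qed

lemma walk_integral:
  assumes "P (0 :: int)"
  shows "((\<lambda>\<theta>. \<Sum>(a, n)\<leftarrow>walk j. a * (if P n then cos (of_int n * \<theta>) else 0)) has_integral
    integral {0..2 * pi} (\<lambda>\<theta>. (4 + 2 * cos \<theta>) ^ j)) {0..2 * pi}"
proof -
  have "((\<lambda>\<theta>. (4 + 2 * cos \<theta>) ^ j) has_integral 2 * pi * (\<Sum>(a, n)\<leftarrow>walk j. if n = 0 then a else 0)) {0..2 * pi}"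
    using integral_trig_sum[of "\<lambda>_. True" "walk j"] by (simp add: walk_cos)
  then show ?thesis using integral_trig_sum[of P "walk j"] assms by (simp add: integral_unique)
qed

context group
begin

lemma unit_op_0: "g \<in> carrier G \<Longrightarrow> unit_op i j g 0 = 0"
  by (rule l2_eqI) (auto simp: coef_unit_op coef_zero)

text \<open>\<open>F\<^sub>z = U\<^sub>z W\<close> with \<open>U\<^sub>z = E\<^sub>0\<^sub>0 x\<^sub>1 + E\<^sub>1\<^sub>0 (x\<^sub>2 + z x\<^sub>3) / \<surd>2\<close> and \<open>W = E\<^sub>0\<^sub>0 + E\<^sub>0\<^sub>1 g\<close>, and their adjoints.\<close>

definition op_U :: "'a \<Rightarrow> 'a \<Rightarrow> 'a \<Rightarrow> complex \<Rightarrow> (nat \<times> 'a) l2 \<Rightarrow> (nat \<times> 'a) l2" where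
  "op_U x1 x2 x3 z v = unit_op 0 0 x1 v + (cscale (1 / sqrt 2) (unit_op 1 0 x2 v) + cscale (z / sqrt 2) (unit_op 1 0 x3 v))"

definition op_U' :: "'a \<Rightarrow> 'a \<Rightarrow> 'a \<Rightarrow> complex \<Rightarrow> (nat \<times> 'a) l2 \<Rightarrow> (nat \<times> 'a) l2" where
  "op_U' x1 x2 x3 z v = unit_op 0 0 (inv x1) v +
    (cscale (1 / sqrt 2) (unit_op 0 1 (inv x2) v) + cscale (cnj z / sqrt 2) (unit_op 0 1 (inv x3) v))"

definition op_W :: "'a \<Rightarrow> (nat \<times> 'a) l2 \<Rightarrow> (nat \<times> 'a) l2" where
  "op_W g v = unit_op 0 0 \<one> v + unit_op 0 1 g v"

definition op_W' :: "'a \<Rightarrow> (nat \<times> 'a) l2 \<Rightarrow> (nat \<times> 'a) l2" where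
  "op_W' g v = unit_op 0 0 \<one> v + unit_op 1 0 (inv g) v"

lemma op_alg:
  assumes "x1 \<in> carrier G" "x2 \<in> carrier G" "x3 \<in> carrier G" "g \<in> carrier G"
  shows "op_U x1 x2 x3 z \<in> alg 2" "op_U' x1 x2 x3 z \<in> alg 2" "op_W g \<in> alg 2" "op_W' g \<in> alg 2"
  unfolding op_U_def[abs_def] op_U'_def[abs_def] op_W_def[abs_def] op_W'_def[abs_def]
  by (intro alg.add alg.scale alg.unit; use assms in simp)+

lemma op_adjoint:
  assumes "x1 \<in> carrier G" "x2 \<in> carrier G" "x3 \<in> carrier G" "g \<in> carrier G"
  shows "cinner (op_U x1 x2 x3 z v) w = cinner v (op_U' x1 x2 x3 z w)"
    "cinner (op_W g v) w = cinner v (op_W' g w)"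
  using assms
  by (simp_all add: op_U_def op_U'_def op_W_def op_W'_def cinner_add cinner_add_right cinner_scale
      cinner_scale_right unit_op_adjoint)

text \<open>The product U' U W W': here W W' = 2 E_00, and U' U is E_00 times 2 plus half of z h and
  of its adjoint. In the constant 2, x_1 contributes 1 and x_2, x_3 contribute 1/2 each.\<close>

definition op_Q :: "'a \<Rightarrow> complex \<Rightarrow> (nat \<times> 'a) l2 \<Rightarrow> (nat \<times> 'a) l2" where
  "op_Q h z v = cscale 4 (unit_op 0 0 \<one> v) + (cscale z (unit_op 0 0 h v) + cscale (cnj z) (unit_op 0 0 (inv h) v))"

lemma op_product:
  assumes x: "x1 \<in> carrier G" "x2 \<in> carrier G" "x3 \<in> carrier G" "g \<in> carrier G" and z: "cmod z = 1"
  shows "op_U' x1 x2 x3 z (op_U x1 x2 x3 z (op_W g (op_W' g v))) = op_Q (inv x2 \<otimes> x3) z v"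
proof -
  have WW: "op_W g (op_W' g v) = cscale 2 (unit_op 0 0 \<one> v)"
    by (rule l2_eqI)
      (use x in \<open>simp add: op_W_def op_W'_def unit_op_add unit_op_unit_op unit_op_0 cscale.rep_eq plus_l2.rep_eq coef_zero\<close>)
  have inv: "inv x3 \<otimes> x2 = inv (inv x2 \<otimes> x3)"
    using x by (simp add: inv_mult_group)
  have zz: "cnj z * z = 1"
    using z complex_norm_square[of z] by (simp add: mult.commute)
  have s: "complex_of_real (sqrt 2) * complex_of_real (sqrt 2) = 2"
    by (simp flip: of_real_mult)
  have "op_U' x1 x2 x3 z (op_U x1 x2 x3 z w) =
      cscale 2 (unit_op 0 0 \<one> w) + (cscale (z / 2) (unit_op 0 0 (inv x2 \<otimes> x3) w) +
        cscale (cnj z / 2) (unit_op 0 0 (inv (inv x2 \<otimes> x3)) w))" for w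
  proof -
    have "op_U' x1 x2 x3 z (op_U x1 x2 x3 z w) =
        unit_op 0 0 \<one> w + (cscale (1 / (sqrt 2 * sqrt 2)) (unit_op 0 0 \<one> w) +
          cscale (z / (sqrt 2 * sqrt 2)) (unit_op 0 0 (inv x2 \<otimes> x3) w) +
          (cscale (cnj z / (sqrt 2 * sqrt 2)) (unit_op 0 0 (inv (inv x2 \<otimes> x3)) w) +
           cscale (cnj z * z / (sqrt 2 * sqrt 2)) (unit_op 0 0 \<one> w)))"
      using x unfolding inv[symmetric]
      by (simp add: op_U_def op_U'_def unit_op_add unit_op_cscale unit_op_unit_op cscale_add cscale_cscale cscale_zero s)
    also have "\<dots> = cscale 2 (unit_op 0 0 \<one> w) + (cscale (z / 2) (unit_op 0 0 (inv x2 \<otimes> x3) w) +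
        cscale (cnj z / 2) (unit_op 0 0 (inv (inv x2 \<otimes> x3)) w))"
      unfolding s zz by (rule l2_eqI) (simp add: plus_l2.rep_eq cscale.rep_eq)
    finally show ?thesis .
  qed
  from this[of "cscale 2 (unit_op 0 0 \<one> v)"] show ?thesis
    unfolding WW op_Q_def using x by (simp add: unit_op_cscale unit_op_unit_op cscale_cscale)
qed

lemma op_Q_pow_basis:
  assumes h: "h \<in> carrier G"
  shows "(op_Q h (cis \<theta>) ^^ j) (basis (0, \<one>)) =
    (\<Sum>(a, n)\<leftarrow>walk j. cscale (of_real a * cis (of_int n * \<theta>)) (basis (0, h [^] n)))"
proof (induction j)
  case 0
  have "cscale 1 v = v" for v :: "(nat \<times> 'a) l2" by transfer simp
  then show ?case by simp
next
  case (Suc j)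
  have Q: "op_Q h (cis \<theta>) \<in> alg 1"
    unfolding op_Q_def[abs_def] by (intro alg.add alg.scale alg.unit) (use h in auto)
  have step: "op_Q h (cis \<theta>) (cscale (of_real a * cis (of_int n * \<theta>)) (basis (0, h [^] n))) =
      cscale (of_real (4 * a) * cis (of_int n * \<theta>)) (basis (0, h [^] n)) +
      (cscale (of_real a * cis (of_int (n + 1) * \<theta>)) (basis (0, h [^] (n + 1))) +
       cscale (of_real a * cis (of_int (n - 1) * \<theta>)) (basis (0, h [^] (n - 1))))" for a and n :: int
  proof -
    have "h [^] (n + 1) = h \<otimes> h [^] n"
      using h int_pow_mult[of h 1 n] by (simp add: add.commute)
    moreover have "h [^] (n - 1) = inv h \<otimes> h [^] n"
      using h int_pow_mult[of h "- 1" n] int_pow_neg[of h 1] by (simp add: add.commute)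
    moreover have "cis (of_int (n + 1) * \<theta>) = cis (of_int n * \<theta>) * cis \<theta>"
      "cis (of_int (n - 1) * \<theta>) = cis (of_int n * \<theta>) * cis (- \<theta>)"
      by (simp_all add: cis_mult algebra_simps)
    ultimately show ?thesis
      unfolding op_Q_def using h
      by (simp add: unit_op_cscale unit_op_basis cscale_cscale cis_cnj mult_ac)
  qed
  have "op_Q h (cis \<theta>) (\<Sum>(a, n)\<leftarrow>L. cscale (of_real a * cis (of_int n * \<theta>)) (basis (0, h [^] n))) =
      (\<Sum>(a, n)\<leftarrow>map (\<lambda>(a, n). (4 * a, n)) L @ map (\<lambda>(a, n). (a, n + 1)) L @ map (\<lambda>(a, n). (a, n - 1)) L.
        cscale (of_real a * cis (of_int n * \<theta>)) (basis (0, h [^] n)))" for L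
  proof (induction L)
    case Nil
    then show ?case using alg_linear(3)[OF Q] by simp
  next
    case (Cons x L)
    then show ?case
      by (cases x) (simp add: alg_linear(1)[OF Q] step add_ac del: of_int_add of_int_diff of_real_mult)
  qed
  then show ?case by (simp add: Suc)
qed

text \<open>The basis vector with index 1 is annihilated by \<open>op_Q\<close> and accounts for the
  atom 0^j. From the other one the walk returns to e exactly when h^n = e, and averaging keeps n =
  0.\<close>

lemma tr_op_op_Q_pow:
  assumes h: "h \<in> carrier G"
  shows "((\<lambda>\<theta>. Re (tr_op 2 (op_Q h (cis \<theta>) ^^ j))) has_integral
    integral {0..2 * pi} (\<lambda>\<theta>. 1 * 0 ^ j + 1 * (4 + 2 * cos \<theta>) ^ j)) {0..2 * pi}"
proof (cases j)
  case 0
  have "Re (tr_op 2 id) = 2"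
    by (simp add: tr_op_def sum_lessThan_2 cinner_basis basis.rep_eq)
  then show ?thesis using 0 has_integral_const_real[of "2 :: real" 0 "2 * pi"] by simp
next
  case (Suc m)
  have "Re (tr_op 2 (op_Q h (cis \<theta>) ^^ j)) =
      (\<Sum>(a, n)\<leftarrow>walk j. a * (if h [^] n = \<one> then cos (of_int n * \<theta>) else 0))" for \<theta>
  proof -
    have Q: "op_Q h (cis \<theta>) \<in> alg 2"
      unfolding op_Q_def[abs_def] by (intro alg.add alg.scale alg.unit) (use h in auto)
    have "op_Q h (cis \<theta>) (basis (1, \<one>)) = 0"
      unfolding op_Q_def using h by (simp add: unit_op_basis cscale_zero)
    moreover have "(op_Q h (cis \<theta>) ^^ m) 0 = 0"
      by (induction m) (simp_all add: alg_linear(3)[OF Q])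
    ultimately have "(op_Q h (cis \<theta>) ^^ j) (basis (1, \<one>)) = 0"
      by (simp add: Suc funpow_swap1)
    then have "tr_op 2 (op_Q h (cis \<theta>) ^^ j) = coef ((op_Q h (cis \<theta>) ^^ j) (basis (0, \<one>))) (0, \<one>)"
      by (simp add: tr_op_def sum_lessThan_2 cinner_basis coef_zero)
    moreover have "Re (coef (\<Sum>(a, n)\<leftarrow>L. cscale (of_real a * cis (of_int n * \<theta>)) (basis (0, h [^] n))) (0, \<one>)) =
        (\<Sum>(a, n)\<leftarrow>L. a * (if h [^] n = \<one> then cos (of_int n * \<theta>) else 0))" for L
      by (induction L) (auto simp: coef_zero plus_l2.rep_eq cscale.rep_eq basis.rep_eq)
    ultimately show ?thesis unfolding op_Q_pow_basis[OF h] by simp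
  qed
  then show ?thesis
    using walk_integral[of "\<lambda>n. h [^] n = \<one>" j] Suc by simp
qed

end

section \<open>Test families and their norms\<close>

lemma mat_sum_eq_smult_one:
  assumes "\<And>i j. i < 2 \<Longrightarrow> j < 2 \<Longrightarrow> (\<Sum>m\<in>S. X m $$ (i, j)) = (if i = j then a else 0)"
  shows "mat_sum 2 S X = a \<cdot>\<^sub>m 1\<^sub>m 2"
  by (rule eq_matI) (simp_all add: mat_sum_def assms)

lemma mat_adjoint_mult_entry:
  assumes "A \<in> carrier_mat 2 2" "i < 2" "j < 2"
  shows "(mat_adjoint A * A) $$ (i, j) = cnj (A $$ (0, i)) * A $$ (0, j) + cnj (A $$ (1, i)) * A $$ (1, j)"
    and "(A * mat_adjoint A) $$ (i, j) = A $$ (i, 0) * cnj (A $$ (j, 0)) + A $$ (i, 1) * cnj (A $$ (j, 1))"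
  unfolding mat_mult_2[OF mat_adjoint_carrier_2[OF assms(1)] assms] mat_mult_2[OF assms(1) mat_adjoint_carrier_2[OF assms(1)] assms(2,3)]
  using mat_adjoint_2[OF assms(1,2)] mat_adjoint_2[OF assms(1) _ assms(3)] by simp_all

text \<open>A family of matrices whose \<open>S\<^sub>1\<^sup>2(\<ell>\<^sub>2)\<close> norm is at least \<open>2 \<surd>a\<close> by duality.\<close>

definition tight_family :: "'a set \<Rightarrow> ('a \<Rightarrow> complex mat) \<Rightarrow> real \<Rightarrow> bool" where
  "tight_family S C a \<longleftrightarrow> finite S \<and> 1 \<le> card S \<and> card S \<le> 6 \<and> (\<forall>y\<in>S. C y \<in> carrier_mat 2 2) \<and> 0 < a \<and>
    mat_sum 2 S (\<lambda>y. mat_adjoint (C y) * C y) = of_real a \<cdot>\<^sub>m 1\<^sub>m 2 \<and>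
    mat_sum 2 S (\<lambda>y. C y * mat_adjoint (C y)) = of_real a \<cdot>\<^sub>m 1\<^sub>m 2"

context group
begin

text \<open>The flag switches to the adjoint, which is supported on the inverses.\<close>

definition test_norm :: "bool \<Rightarrow> 'a set \<Rightarrow> ('a \<Rightarrow> complex mat) \<Rightarrow> real" where
  "test_norm b S C = L1_norm G 2 (if b then lambda_sum G 2 S (\<lambda>y. mat_adjoint (C y)) (\<lambda>y. inv y)
    else lambda_sum G 2 S C (\<lambda>y. y))"

lemma lambda_op_cong:
  "(\<And>m i j. m \<in> S \<Longrightarrow> i < d \<Longrightarrow> j < d \<Longrightarrow> c m i j = c' m i j) \<Longrightarrow> lambda_op d S c g = lambda_op d S c' g"
  unfolding lambda_op_def by (intro ext sum.cong refl) simp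

text \<open>The shared frame of both kinds of test element. The moments of F F' agree with those of
  F' F by traciality, so both values of the flag get the same estimate. K > 0 follows from a > 0 and
  the nonnegativity of the norm.\<close>

lemma test_norm_bound:
  fixes C :: "real \<Rightarrow> 'a \<Rightarrow> complex mat" and f :: "real \<Rightarrow> real"
  assumes S: "finite S" "S \<subseteq> carrier G" "card S \<le> 6"
    and C: "\<And>\<theta> y. y \<in> S \<Longrightarrow> C \<theta> y \<in> carrier_mat 2 2"
      "\<And>\<theta> y i j. y \<in> S \<Longrightarrow> i < 2 \<Longrightarrow> j < 2 \<Longrightarrow> cmod (C \<theta> y $$ (i, j)) \<le> 2"
    and F: "\<And>\<theta>. lambda_op 2 S (\<lambda>y i j. C \<theta> y $$ (i, j)) (\<lambda>y. y) = F \<theta>"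
    and F': "\<And>\<theta>. F' \<theta> \<in> alg 2" "\<And>\<theta> v w. cinner (F \<theta> v) w = cinner v (F' \<theta> w)"
    and mom: "\<And>j. ((\<lambda>\<theta>. Re (tr_op 2 ((\<lambda>v. F' \<theta> (F \<theta> v)) ^^ j))) has_integral
        integral {0..2 * pi} (\<lambda>\<theta>. wa * 0 ^ j + wb * f \<theta> ^ j)) {0..2 * pi}"
    and f: "continuous_on {0..2 * pi} f" "\<And>\<theta>. 0 \<le> f \<theta>" "\<And>\<theta>. f \<theta> \<le> 2304"
    and w: "0 \<le> wa" "0 \<le> wb"
    and a: "0 < a" "\<And>\<theta>. a \<le> K * test_norm b S (C \<theta>)"
  shows "2 * pi * a \<le> K * integral {0..2 * pi} (\<lambda>\<theta>. wb * sqrt (f \<theta>))"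
proof -
  let ?I = "tensor_index G 2"
  have Falg: "F \<theta> \<in> alg 2" for \<theta>
    unfolding F[symmetric] by (rule lambda_op_alg) (use S in auto)
  have pair: "adjoint_pair ?I (F \<theta>) (F' \<theta>) 2304" for \<theta>
  proof (unfold_locales)
    fix v
    have "norm (F \<theta> v) \<le> real (card S) * (real 2 * (real 2 * 2)) * norm v"
      unfolding F[symmetric] by (rule norm_lambda_op_le) (use S C in auto)
    \<comment> \<open>48 = 6 * 2 * 2 * 2: at most six terms, dimension 2 counted twice, entries at
      most 2. Its square is 2304.\<close>
    also have "\<dots> \<le> 48 * norm v" using S(3) by (intro mult_right_mono) auto
    finally have "(norm (F \<theta> v))\<^sup>2 \<le> (48 * norm v)\<^sup>2" by (rule power_mono) simp
    then show "(norm (F \<theta> v))\<^sup>2 \<le> 2304 * (norm v)\<^sup>2" by (simp add: power_mult_distrib)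
  qed (use alg_op_on[OF Falg] alg_op_on[OF F'(1)] F'(2) in auto)
  have F'_eq: "F' \<theta> = lambda_op 2 S (\<lambda>y i j. mat_adjoint (C \<theta> y) $$ (i, j)) (\<lambda>y. inv y)" for \<theta>
  proof
    fix w
    have "lambda_op 2 S (\<lambda>y i j. mat_adjoint (C \<theta> y) $$ (i, j)) (\<lambda>y. inv y) =
        lambda_op 2 S (\<lambda>y i j. cnj (C \<theta> y $$ (j, i))) (\<lambda>y. inv y)"
      by (rule lambda_op_cong) (use C mat_adjoint_2 in blast)
    moreover have "cinner v (F' \<theta> w) = cinner v (lambda_op 2 S (\<lambda>y i j. cnj (C \<theta> y $$ (j, i))) (\<lambda>y. inv y) w)" for v
      using lambda_op_adjoint[of "\<lambda>y. y" S 2 "\<lambda>y i j. C \<theta> y $$ (i, j)" v w] S F'(2)[of \<theta> v w] by (simp add: F)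
    ultimately show "F' \<theta> w = lambda_op 2 S (\<lambda>y i j. mat_adjoint (C \<theta> y) $$ (i, j)) (\<lambda>y. inv y) w"
      using cinner_nondeg by metis
  qed
  have T: "lambda_sum G 2 S (C \<theta>) (\<lambda>y. y) \<xi> = fun_op ?I (F \<theta>) \<xi>" if "\<xi> \<in> ell2 ?I" for \<theta> \<xi>
    using lambda_sum_coef[of "\<lambda>y. y" S \<xi> 2 "C \<theta>"] that S by (simp add: F)
  have T': "lambda_sum G 2 S (\<lambda>y. mat_adjoint (C \<theta> y)) (\<lambda>y. inv y) \<xi> = fun_op ?I (F' \<theta>) \<xi>"
    if "\<xi> \<in> ell2 ?I" for \<theta> \<xi>
    using lambda_sum_coef[of "\<lambda>y. inv y" S \<xi> 2 "\<lambda>y. mat_adjoint (C \<theta> y)"] that S by (auto simp: F'_eq)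
  have mom': "((\<lambda>\<theta>. Re (tr_op 2 ((\<lambda>v. F \<theta> (F' \<theta> v)) ^^ j))) has_integral
        integral {0..2 * pi} (\<lambda>\<theta>. wa * 0 ^ j + wb * f \<theta> ^ j)) {0..2 * pi}" for j
    unfolding tr_op_pow_commute[OF Falg F'(1)] by (rule mom)
  have nonneg: "0 \<le> test_norm b S (C \<theta>)" for \<theta>
    unfolding test_norm_def
    using L1_norm_nonneg[OF pair T] L1_norm_nonneg[OF adjoint_pair_swap[OF pair] T'] by simp
  have K: "0 < K"
  proof (rule ccontr)
    assume "\<not> 0 < K"
    then have "K * test_norm b S (C 0) \<le> 0" using nonneg by (simp add: mult_nonpos_nonneg)
    then show False using a(1) a(2)[of 0] by simp
  qed
  have le: "a / K \<le> test_norm b S (C \<theta>)" for \<theta>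
    using a(2)[of \<theta>] K by (simp add: field_simps)
  have "2 * pi * (a / K) \<le> integral {0..2 * pi} (\<lambda>\<theta>. wb * sqrt (f \<theta>))"
  proof (cases b)
    case True
    show ?thesis
      by (rule L1_moment_bound[OF adjoint_pair_swap[OF pair] T' mom' f w])
        (use le True in \<open>simp_all add: test_norm_def\<close>)
  next
    case False
    show ?thesis
      by (rule L1_moment_bound[OF pair T mom f w])
        (use le False in \<open>simp_all add: test_norm_def\<close>)
  qed
  then show "2 * pi * a \<le> K * integral {0..2 * pi} (\<lambda>\<theta>. wb * sqrt (f \<theta>))"
    using K by (simp add: field_simps)
qed

lemma integral_sqrt_J: "integral {0..2 * pi} (\<lambda>\<theta>. 1 * sqrt (4 + 2 * cos \<theta>)) = 2 * (2 * pi * J_const)"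
proof -
  have "sqrt (4 + 2 * cos \<theta>) = 2 * sqrt (1 + 1 / 2 * cos \<theta>)" for \<theta>
  proof -
    have "4 + 2 * cos \<theta> = 4 * (1 + 1 / 2 * cos \<theta>)" by simp
    then show ?thesis by (simp only: real_sqrt_mult real_sqrt_four)
  qed
  then show ?thesis by (simp add: J_const_def)
qed

text \<open>The coefficient of U_z W at y, as a sum of indicators. Column 1 is column 0 translated
  by g. Coinciding group elements add up automatically, so every pattern of coincidences is covered
  at once.\<close>

definition path_coeff :: "'a \<Rightarrow> 'a \<Rightarrow> 'a \<Rightarrow> 'a \<Rightarrow> complex \<Rightarrow> 'a \<Rightarrow> nat \<Rightarrow> nat \<Rightarrow> complex" where
  "path_coeff x1 x2 x3 g z y i j = (let u = (\<lambda>x. if j = 0 then x else x \<otimes> g) in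
    if i = 0 then (if y = u x1 then 1 else 0)
    else (if y = u x2 then 1 / of_real (sqrt 2) else 0) + (if y = u x3 then z / of_real (sqrt 2) else 0))"

lemma sum_cscale_pick:
  fixes v :: "'m \<Rightarrow> 'k l2"
  assumes "finite S" "x \<in> S"
  shows "(\<Sum>y\<in>S. cscale (if y = x then c else 0) (v y)) = cscale c (v x)"
proof -
  have "cscale 0 w = 0" for w :: "'k l2" by transfer simp
  then have "(\<Sum>y\<in>S. cscale (if y = x then c else 0) (v y)) = (\<Sum>y\<in>S. if y = x then cscale c (v x) else 0)"
    by (intro sum.cong) auto
  then show ?thesis using assms by simp
qed

lemma cscale_add_left: "cscale (c + c') v = cscale c v + cscale c' v"
  by transfer (simp add: distrib_right)

lemma lambda_op_path:
  assumes S: "finite S" "{x1, x2, x3, x1 \<otimes> g, x2 \<otimes> g, x3 \<otimes> g} \<subseteq> S"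
    and x: "x1 \<in> carrier G" "x2 \<in> carrier G" "x3 \<in> carrier G" "g \<in> carrier G"
  shows "lambda_op 2 S (path_coeff x1 x2 x3 g z) (\<lambda>y. y) = (\<lambda>v. op_U x1 x2 x3 z (op_W g v))"
proof
  fix v
  have "lambda_op 2 S (path_coeff x1 x2 x3 g z) (\<lambda>y. y) v =
      unit_op 0 0 x1 v + unit_op 0 1 (x1 \<otimes> g) v +
      (cscale (1 / sqrt 2) (unit_op 1 0 x2 v) + cscale (z / sqrt 2) (unit_op 1 0 x3 v) +
       (cscale (1 / sqrt 2) (unit_op 1 1 (x2 \<otimes> g) v) + cscale (z / sqrt 2) (unit_op 1 1 (x3 \<otimes> g) v)))"
  proof -
    have one: "cscale 1 w = w" for w :: "(nat \<times> 'a) l2" by transfer simp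
    show ?thesis
      using S unfolding lambda_op_def sum_lessThan_2 sum.distrib
      by (simp add: path_coeff_def Let_def cscale_add_left sum.distrib sum_cscale_pick one)
  qed
  also have "\<dots> = op_U x1 x2 x3 z (op_W g v)"
    using x by (simp add: op_U_def op_W_def unit_op_add unit_op_unit_op cscale_add add_ac)
  finally show "lambda_op 2 S (path_coeff x1 x2 x3 g z) (\<lambda>y. y) v = op_U x1 x2 x3 z (op_W g v)" .
qed

text \<open>The sum of C* C pairs only entries of one row, that of C C* only entries of one column.
  Within row 1 the supports {x_2, x_3} and {x_2 g, x_3 g} are disjoint, by g \<noteq> e and the last
  two conditions on the points; within a column the points belonging to different rows differ.
  Coincidences across both row and column, such as x_1 g = x_2, never enter.\<close>

lemma path_tight:
  assumes x: "x1 \<in> carrier G" "x2 \<in> carrier G" "x3 \<in> carrier G" "g \<in> carrier G" "g \<noteq> \<one>"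
    and d: "x1 \<noteq> x2" "x1 \<noteq> x3" "x2 \<noteq> x3" "x2 \<otimes> g \<noteq> x3" "x3 \<otimes> g \<noteq> x2" and z: "cmod z = 1"
  shows "tight_family {x1, x2, x3, x1 \<otimes> g, x2 \<otimes> g, x3 \<otimes> g}
    (\<lambda>y. Matrix.mat 2 2 (\<lambda>(i, j). path_coeff x1 x2 x3 g z y i j)) 2"
proof -
  let ?S = "{x1, x2, x3, x1 \<otimes> g, x2 \<otimes> g, x3 \<otimes> g}"
  let ?C = "\<lambda>y. Matrix.mat 2 2 (\<lambda>(i, j). path_coeff x1 x2 x3 g z y i j)"
  define c where "c = path_coeff x1 x2 x3 g z"
  have fin: "finite ?S" by simp
  have C: "?C y \<in> carrier_mat 2 2" for y by simp
  have neq: "x1 \<otimes> g \<noteq> x1" "x2 \<otimes> g \<noteq> x2" "x3 \<otimes> g \<noteq> x3"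
    using x by simp_all
  have neq': "x1 \<otimes> g \<noteq> x2 \<otimes> g" "x1 \<otimes> g \<noteq> x3 \<otimes> g" "x2 \<otimes> g \<noteq> x3 \<otimes> g"
    using x d by simp_all
  have zz: "cnj z * z = 1" "z * cnj z = 1"
    using z complex_norm_square[of z] by (simp_all add: mult.commute)
  have s: "complex_of_real (sqrt 2) * complex_of_real (sqrt 2) = 2"
    by (simp flip: of_real_mult)
  have pick: "(\<Sum>y\<in>?S. (if y = p then a else 0) * cnj (if y = q then b else 0)) = (if p = q then a * cnj b else 0)"
    if "p \<in> ?S" for p q a b
  proof -
    have "(\<Sum>y\<in>?S. (if y = p then a else 0) * cnj (if y = q then b else 0)) =
        (\<Sum>y\<in>?S. if y = p then (if p = q then a * cnj b else 0) else 0)"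
      by (rule sum.cong) auto
    then show ?thesis using that fin by (simp only: sum.delta if_True)
  qed
  have inner: "(\<Sum>y\<in>?S. c y i j * cnj (c y k l)) = (if i = k \<and> j = l then 1 else 0)"
    if "i < 2" "j < 2" "k < 2" "l < 2" "i = k \<or> j = l" for i j k l
  proof -
    define u where "u j x = (if j = 0 then x else x \<otimes> g)" for j :: nat and x
    have c0: "c y 0 j = (if y = u j x1 then 1 else 0)" for y j
      by (simp add: c_def path_coeff_def u_def)
    have c1: "c y 1 j = (if y = u j x2 then 1 / of_real (sqrt 2) else 0) + (if y = u j x3 then z / of_real (sqrt 2) else 0)" for y j
      by (simp add: c_def path_coeff_def u_def)
    have uS: "u j x1 \<in> ?S" "u j x2 \<in> ?S" "u j x3 \<in> ?S" for j
      by (auto simp: u_def)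
    have u1: "u j x1 = u l x1 \<longleftrightarrow> (j = 0 \<longleftrightarrow> l = 0)" "u j x2 = u l x2 \<longleftrightarrow> (j = 0 \<longleftrightarrow> l = 0)"
      "u j x3 = u l x3 \<longleftrightarrow> (j = 0 \<longleftrightarrow> l = 0)" "u j x2 \<noteq> u l x3" "u j x3 \<noteq> u l x2"
      "u j x1 \<noteq> u j x2" "u j x1 \<noteq> u j x3" "u j x2 \<noteq> u j x1" "u j x3 \<noteq> u j x1" for j l
      using d neq neq' by (auto simp: u_def)
    have P00: "(\<Sum>y\<in>?S. c y 0 j * cnj (c y 0 l)) = (if j = 0 \<longleftrightarrow> l = 0 then 1 else 0)" for j l
      unfolding c0 pick[OF uS(1)] u1 by (cases "j = 0"; cases "l = 0") simp_all
    have P11: "(\<Sum>y\<in>?S. c y 1 j * cnj (c y 1 l)) = (if j = 0 \<longleftrightarrow> l = 0 then 1 else 0)" for j l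
      unfolding c1 complex_cnj_add distrib_left distrib_right sum.distrib pick[OF uS(2)] pick[OF uS(3)] u1
      using s zz by (cases "j = 0"; cases "l = 0") (simp_all add: u1)
    have P01: "(\<Sum>y\<in>?S. c y 0 j * cnj (c y 1 j)) = 0" for j
      unfolding c0 c1 complex_cnj_add distrib_left sum.distrib pick[OF uS(1)] u1 by (simp add: u1)
    have P10: "(\<Sum>y\<in>?S. c y 1 j * cnj (c y 0 j)) = 0" for j
      unfolding c0 c1 distrib_right sum.distrib pick[OF uS(2)] pick[OF uS(3)] u1 by (simp add: u1)
    have "i = 0 \<or> i = 1" "j = 0 \<or> j = 1" "k = 0 \<or> k = 1" "l = 0 \<or> l = 1"
      using that by linarith+
    then show ?thesis
      using that(5) P00 P11 P01 P10 by (elim disjE) (simp_all only: simp_thms if_True if_False zero_neq_one one_neq_zero)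
  qed
  have one2: "1 < (2 :: nat)" by simp
  have ent: "?C y $$ (i, j) = c y i j" if "i < 2" "j < 2" for y i j
    using that by (simp add: c_def)
  have col: "mat_sum 2 ?S (\<lambda>y. mat_adjoint (?C y) * ?C y) = of_real 2 \<cdot>\<^sub>m 1\<^sub>m 2"
  proof (rule mat_sum_eq_smult_one)
    fix i j :: nat assume ij: "i < 2" "j < 2"
    have "(\<Sum>y\<in>?S. (mat_adjoint (?C y) * ?C y) $$ (i, j)) =
        (\<Sum>y\<in>?S. c y 0 j * cnj (c y 0 i)) + (\<Sum>y\<in>?S. c y 1 j * cnj (c y 1 i))"
      unfolding mat_adjoint_mult_entry(1)[OF C ij] sum.distrib[symmetric]
      unfolding ent[OF zero_less_numeral ij(1)] ent[OF zero_less_numeral ij(2)] ent[OF one2 ij(1)] ent[OF one2 ij(2)]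
      by (simp only: mult.commute)
    then show "(\<Sum>y\<in>?S. (mat_adjoint (?C y) * ?C y) $$ (i, j)) = (if i = j then of_real 2 else 0)"
      unfolding inner[OF zero_less_numeral ij(2) zero_less_numeral ij(1) disjI1[OF refl]]
        inner[OF one2 ij(2) one2 ij(1) disjI1[OF refl]] by auto
  qed
  have row: "mat_sum 2 ?S (\<lambda>y. ?C y * mat_adjoint (?C y)) = of_real 2 \<cdot>\<^sub>m 1\<^sub>m 2"
  proof (rule mat_sum_eq_smult_one)
    fix i j :: nat assume ij: "i < 2" "j < 2"
    have "(\<Sum>y\<in>?S. (?C y * mat_adjoint (?C y)) $$ (i, j)) =
        (\<Sum>y\<in>?S. c y i 0 * cnj (c y j 0)) + (\<Sum>y\<in>?S. c y i 1 * cnj (c y j 1))"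
      unfolding mat_adjoint_mult_entry(2)[OF C ij] sum.distrib[symmetric]
      unfolding ent[OF ij(1) zero_less_numeral] ent[OF ij(2) zero_less_numeral] ent[OF ij(1) one2] ent[OF ij(2) one2] ..
    then show "(\<Sum>y\<in>?S. (?C y * mat_adjoint (?C y)) $$ (i, j)) = (if i = j then of_real 2 else 0)"
      unfolding inner[OF ij(1) zero_less_numeral ij(2) zero_less_numeral disjI2[OF refl]]
        inner[OF ij(1) one2 ij(2) one2 disjI2[OF refl]] by auto
  qed
  have "card ?S \<le> 6"
    using card_length[of "[x1, x2, x3, x1 \<otimes> g, x2 \<otimes> g, x3 \<otimes> g]"] by simp
  moreover have "1 \<le> card ?S"
    by (simp add: Suc_le_eq card_gt_0_iff)
  ultimately show ?thesis
    unfolding tight_family_def using C col row by (intro conjI ballI) simp_all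
qed

lemma path_bound:
  assumes x: "x1 \<in> carrier G" "x2 \<in> carrier G" "x3 \<in> carrier G" "g \<in> carrier G" "g \<noteq> \<one>"
    and d: "x1 \<noteq> x2" "x1 \<noteq> x3" "x2 \<noteq> x3" "x2 \<otimes> g \<noteq> x3" "x3 \<otimes> g \<noteq> x2"
    and V: "{x1, x2, x3, x1 \<otimes> g, x2 \<otimes> g, x3 \<otimes> g} \<subseteq> V"
    and K: "\<And>S C a. S \<subseteq> V \<Longrightarrow> tight_family S C a \<Longrightarrow> 2 * sqrt a \<le> K * test_norm b S C"
  shows "c_star \<le> K"
proof -
  let ?S = "{x1, x2, x3, x1 \<otimes> g, x2 \<otimes> g, x3 \<otimes> g}"
  define C where "C \<theta> y = Matrix.mat 2 2 (\<lambda>(i, j). path_coeff x1 x2 x3 g (cis \<theta>) y i j)" for \<theta> y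
  let ?F = "\<lambda>\<theta> v. op_U x1 x2 x3 (cis \<theta>) (op_W g v)"
  let ?F' = "\<lambda>\<theta> v. op_W' g (op_U' x1 x2 x3 (cis \<theta>) v)"
  have tight: "tight_family ?S (C \<theta>) 2" for \<theta>
    using path_tight[OF x d, of "cis \<theta>"] unfolding C_def[abs_def] by simp
  note alg = op_alg[OF x(1-4)]
  \<comment> \<open>2 sqrt 2 is the duality bound for a = 2; the right side equals 4 pi J K.\<close>
  have "2 * pi * (2 * sqrt 2) \<le> K * integral {0..2 * pi} (\<lambda>\<theta>. 1 * sqrt (4 + 2 * cos \<theta>))"
  proof (rule test_norm_bound[where S = ?S and C = C and F = ?F and F' = ?F' and wa = 1 and wb = 1 and b = b])
    show "?S \<subseteq> carrier G" using x by simp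
    show "card ?S \<le> 6" using tight[of 0] by (simp only: tight_family_def)
    show "cmod (C \<theta> y $$ (i, j)) \<le> 2" if "i < 2" "j < 2" for \<theta> y i j
    proof -
      have ind: "cmod (if P then 1 else 0) \<le> 2" "cmod (if P then 1 / of_real (sqrt 2) else 0) \<le> 1"
        "cmod (if P then cis \<theta> / of_real (sqrt 2) else 0) \<le> 1" for P
        by (simp_all add: norm_divide)
      have "cmod (path_coeff x1 x2 x3 g (cis \<theta>) y i j) \<le> 2"
      proof (cases "i = 0")
        case True
        show ?thesis unfolding path_coeff_def Let_def if_P[OF True] by (rule ind)
      next
        case False
        show ?thesis
          unfolding path_coeff_def Let_def if_not_P[OF False]
          by (rule order_trans[OF norm_triangle_ineq order_trans[OF add_mono[OF ind(2,3)]]]) simp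
      qed
      then show ?thesis using that by (simp add: C_def)
    qed
    show "lambda_op 2 ?S (\<lambda>y i j. C \<theta> y $$ (i, j)) (\<lambda>y. y) = ?F \<theta>" for \<theta>
      unfolding lambda_op_path[OF _ subset_refl x(1-4), symmetric, simplified]
      by (rule lambda_op_cong) (simp add: C_def)
    show "?F' \<theta> \<in> alg 2" for \<theta> by (rule alg_comp[OF alg(4,2)])
    show "cinner (?F \<theta> v) w = cinner v (?F' \<theta> w)" for \<theta> v w
      by (simp add: op_adjoint[OF x(1-4)])
    show "((\<lambda>\<theta>. Re (tr_op 2 ((\<lambda>v. ?F' \<theta> (?F \<theta> v)) ^^ j))) has_integral
        integral {0..2 * pi} (\<lambda>\<theta>. 1 * 0 ^ j + 1 * (4 + 2 * cos \<theta>) ^ j)) {0..2 * pi}" for j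
    proof -
      \<comment> \<open>Traciality moves W' to the right end, where W W' is a multiple of the corner
        projection; W' W, by contrast, is not diagonal.\<close>
      have "tr_op 2 ((\<lambda>v. ?F' \<theta> (?F \<theta> v)) ^^ j) = tr_op 2 (op_Q (inv x2 \<otimes> x3) (cis \<theta>) ^^ j)" for \<theta>
      proof -
        have Y: "(\<lambda>v. op_U' x1 x2 x3 (cis \<theta>) (?F \<theta> v)) \<in> alg 2"
          by (rule alg_comp[OF alg(2) alg_comp[OF alg(1,3)]])
        show ?thesis
          unfolding tr_op_pow_commute[OF alg(4) Y] op_product[OF x(1-4) norm_cis] ..
      qed
      then show ?thesis using tr_op_op_Q_pow[of "inv x2 \<otimes> x3" j] x by simp
    qed
    show "continuous_on {0..2 * pi} (\<lambda>\<theta>. 4 + 2 * cos \<theta>)" by (intro continuous_intros)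
    show "0 \<le> 4 + 2 * cos \<theta>" "4 + 2 * cos \<theta> \<le> 2304" for \<theta> :: real
      using cos_ge_minus_one[of \<theta>] cos_le_one[of \<theta>] by linarith+
    show "2 * sqrt 2 \<le> K * test_norm b ?S (C \<theta>)" for \<theta>
      by (rule K[OF V tight])
  qed (simp_all add: C_def)
  then have "sqrt 2 \<le> K * J_const"
    unfolding integral_sqrt_J by simp
  moreover have "0 < J_const" using J_const_bounds(1) by simp
  ultimately show ?thesis by (simp add: c_star_def field_simps)
qed

section \<open>Cosets of a subgroup of order 3\<close>

definition diag_op :: "'a \<Rightarrow> (nat \<times> 'a) l2 \<Rightarrow> (nat \<times> 'a) l2" where
  "diag_op h v = unit_op 0 0 h v + unit_op 1 1 h v"

lemma diag_op_alg: "h \<in> carrier G \<Longrightarrow> diag_op h \<in> alg 2"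
  unfolding diag_op_def[abs_def] by (intro alg.add alg.unit) auto

lemma diag_op_diag_op:
  "h \<in> carrier G \<Longrightarrow> k \<in> carrier G \<Longrightarrow> diag_op h (diag_op k v) = diag_op (h \<otimes> k) v"
  by (simp add: diag_op_def unit_op_add unit_op_unit_op)

lemma diag_op_adjoint: "h \<in> carrier G \<Longrightarrow> cinner (diag_op h v) w = cinner v (diag_op (inv h) w)"
  by (simp add: diag_op_def cinner_add cinner_add_right unit_op_adjoint)

lemma tr_op_diag_op: "h \<in> carrier G \<Longrightarrow> tr_op 2 (diag_op h) = (if h = \<one> then 2 else 0)"
  unfolding diag_op_def[abs_def] tr_op_add by (simp add: tr_op_unit_op)

definition op_P :: "'a \<Rightarrow> (nat \<times> 'a) l2 \<Rightarrow> (nat \<times> 'a) l2" where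
  "op_P g v = diag_op \<one> v + diag_op g v + diag_op (g \<otimes> g) v"

text \<open>For \<open>V \<supseteq> x \<langle>g\<rangle>\<close> with \<open>g\<close> of order 3, the test element is \<open>1 \<otimes> \<lambda>\<^sub>x (1 + \<lambda>\<^sub>g + \<lambda>\<^sub>g\<^sub>g)\<close>, three times a partial isometry.\<close>

lemma cycle_bound:
  assumes x: "x \<in> carrier G" "g \<in> carrier G" "g \<noteq> \<one>" "g \<otimes> g \<noteq> \<one>" "g \<otimes> g \<otimes> g = \<one>"
    and V: "{x, x \<otimes> g, x \<otimes> (g \<otimes> g)} \<subseteq> V"
    and K: "\<And>S C a. S \<subseteq> V \<Longrightarrow> tight_family S C a \<Longrightarrow> 2 * sqrt a \<le> K * test_norm b S C"
  shows "c_star \<le> K"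
proof -
  let ?S = "{x, x \<otimes> g, x \<otimes> (g \<otimes> g)}"
  define C where "C \<theta> y = (1\<^sub>m 2 :: complex mat)" for \<theta> :: real and y :: 'a
  let ?F = "\<lambda>\<theta> :: real. \<lambda>v. diag_op x (op_P g v)"
  let ?F' = "\<lambda>\<theta> :: real. \<lambda>v. op_P g (diag_op (inv x) v)"
  have gg: "g \<otimes> g \<in> carrier G" using x by simp
  have inv_g: "inv g = g \<otimes> g"
    using x by (metis gg inv_equality)
  then have inv_gg: "inv (g \<otimes> g) = g" using x by (metis inv_inv)
  have ne: "x \<noteq> x \<otimes> g" "x \<noteq> x \<otimes> (g \<otimes> g)" "x \<otimes> g \<noteq> x \<otimes> (g \<otimes> g)"
    using x by simp_all
  then have card: "card ?S = 3" by simp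
  have C2: "C \<theta> y \<in> carrier_mat 2 2" for \<theta> y by (simp add: C_def)
  have ent: "C \<theta> y $$ (i, j) = (if i = j then 1 else 0)" if "i < 2" "j < 2" for \<theta> y i j
    using that by (simp add: C_def)
  have tight: "tight_family ?S (C \<theta>) 3" for \<theta>
    unfolding tight_family_def
  proof (intro conjI)
    show "mat_sum 2 ?S (\<lambda>y. mat_adjoint (C \<theta> y) * C \<theta> y) = of_real 3 \<cdot>\<^sub>m 1\<^sub>m 2"
    proof (rule mat_sum_eq_smult_one)
      fix i j :: nat assume ij: "i < 2" "j < 2"
      show "(\<Sum>y\<in>?S. (mat_adjoint (C \<theta> y) * C \<theta> y) $$ (i, j)) = (if i = j then of_real 3 else 0)"
        unfolding mat_adjoint_mult_entry(1)[OF C2 ij] using ij card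
        by (auto simp: ent less_2_cases_iff)
    qed
    show "mat_sum 2 ?S (\<lambda>y. C \<theta> y * mat_adjoint (C \<theta> y)) = of_real 3 \<cdot>\<^sub>m 1\<^sub>m 2"
    proof (rule mat_sum_eq_smult_one)
      fix i j :: nat assume ij: "i < 2" "j < 2"
      show "(\<Sum>y\<in>?S. (C \<theta> y * mat_adjoint (C \<theta> y)) $$ (i, j)) = (if i = j then of_real 3 else 0)"
        unfolding mat_adjoint_mult_entry(2)[OF C2 ij] using ij card
        by (auto simp: ent less_2_cases_iff)
    qed
  qed (use card in \<open>simp_all add: C2\<close>)
  have P: "op_P g \<in> alg 2"
    unfolding op_P_def[abs_def] using x by (intro alg.add diag_op_alg) auto
  note P_lin = alg_linear[OF P]
  have lin: "diag_op h (v + w) = diag_op h v + diag_op h w" if "h \<in> carrier G" for h v w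
    by (rule alg_linear(1)[OF diag_op_alg[OF that]])
  have cscale3: "v + v + v = cscale 3 v" for v :: "(nat \<times> 'a) l2" by transfer simp
  have PP: "op_P g (op_P g v) = cscale 3 (op_P g v)" for v
  proof -
    have "g \<otimes> (g \<otimes> g) = \<one>" "g \<otimes> g \<otimes> (g \<otimes> g) = g"
      using x by (simp_all add: m_assoc)
    then show ?thesis
      using x gg unfolding cscale3[symmetric]
      by (simp add: op_P_def lin diag_op_diag_op add_ac)
  qed
  have A: "?F' \<theta> (?F \<theta> v) = cscale 3 (op_P g v)" for \<theta> v
  proof -
    have ix: "inv x \<otimes> (x \<otimes> k) = k" if "k \<in> carrier G" for k
      using x that by (simp flip: m_assoc)
    have "diag_op (inv x) (diag_op x (op_P g v)) = op_P g v"
      using x gg ix by (simp add: op_P_def lin diag_op_diag_op)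
    then show ?thesis using PP by simp
  qed
  have A_pow: "((\<lambda>v. cscale 3 (op_P g v)) ^^ Suc n) v = cscale (of_real (9 ^ n * 3)) (op_P g v)" for n v
  proof (induction n)
    case (Suc n)
    then show ?case by (simp add: P_lin cscale_cscale PP mult_ac)
  qed simp
  have tr_op_P: "tr_op 2 (op_P g) = 2"
    unfolding op_P_def[abs_def] tr_op_add using x by (simp add: tr_op_diag_op)
  \<comment> \<open>F' F = 9 q with the projection q = P/3 of trace 2/3; the remaining mass 4/3 of
    the total 2 sits at 0. Integrating the square root gives 2/3 * 3 = 2, against the duality bound
    2 sqrt 3.\<close>
  have mom: "Re (tr_op 2 ((\<lambda>v. ?F' \<theta> (?F \<theta> v)) ^^ j)) = 4 / 3 * 0 ^ j + 2 / 3 * 9 ^ j" for \<theta> j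
  proof (cases j)
    case 0
    then show ?thesis by (simp add: tr_op_def sum_lessThan_2 cinner_basis basis.rep_eq)
  next
    case (Suc n)
    have "(\<lambda>v. cscale 3 (op_P g v)) ^^ Suc n = (\<lambda>v. cscale (of_real (9 ^ n * 3)) (op_P g v))"
      by (rule ext) (rule A_pow)
    then show ?thesis unfolding A Suc by (simp only: tr_op_scale tr_op_P) simp
  qed
  have bound: "2 * pi * (2 * sqrt 3) \<le> K * integral {0..2 * pi} (\<lambda>\<theta>. 2 / 3 * sqrt 9)"
  proof (rule test_norm_bound[where S = ?S and C = C and F = ?F and F' = ?F' and wa = "4 / 3" and wb = "2 / 3" and b = b
        and f = "\<lambda>_. 9"])
    show "?S \<subseteq> carrier G" using x by simp
    show "card ?S \<le> 6" using card by simp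
    show "cmod (C \<theta> y $$ (i, j)) \<le> 2" if "i < 2" "j < 2" for \<theta> y i j
      using that by (simp add: ent)
    show "lambda_op 2 ?S (\<lambda>y i j. C \<theta> y $$ (i, j)) (\<lambda>y. y) = ?F \<theta>" for \<theta>
    proof
      fix v
      have "cscale 1 w = w" "cscale 0 w = 0" for w :: "(nat \<times> 'a) l2" by (transfer, simp)+
      then have "lambda_op 2 ?S (\<lambda>y i j. C \<theta> y $$ (i, j)) (\<lambda>y. y) v = (\<Sum>y\<in>?S. diag_op y v)"
        unfolding lambda_op_def sum_lessThan_2 by (intro sum.cong) (simp_all add: ent diag_op_def)
      also have "\<dots> = ?F \<theta> v"
        using x gg ne by (simp add: op_P_def lin diag_op_diag_op add_ac)
      finally show "lambda_op 2 ?S (\<lambda>y i j. C \<theta> y $$ (i, j)) (\<lambda>y. y) v = ?F \<theta> v" .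
    qed
    show "?F' \<theta> \<in> alg 2" for \<theta>
      by (rule alg_comp[OF P diag_op_alg]) (use x in simp)
    show "cinner (?F \<theta> v) w = cinner v (?F' \<theta> w)" for \<theta> v w
      using x gg by (simp add: op_P_def diag_op_adjoint cinner_add cinner_add_right inv_g inv_gg)
    show "((\<lambda>\<theta>. Re (tr_op 2 ((\<lambda>v. ?F' \<theta> (?F \<theta> v)) ^^ j))) has_integral
        integral {0..2 * pi} (\<lambda>\<theta>. 4 / 3 * 0 ^ j + 2 / 3 * 9 ^ j)) {0..2 * pi}" for j
      unfolding mom by (rule integrable_integral[OF integrable_const_ivl])
    show "2 * sqrt 3 \<le> K * test_norm b ?S (C \<theta>)" for \<theta>
      by (rule K[OF V tight])
  qed (simp_all add: C2)
  have "sqrt 9 = (3 :: real)" using real_sqrt_unique[of 3 9] by simp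
  then have "2 * pi * (2 * sqrt 3) \<le> 2 * pi * (2 * K)"
    using bound by simp
  then have "sqrt 3 \<le> K" by simp
  moreover have "1.4381696566 \<le> sqrt 3"
    by (rule real_le_rsqrt) (simp add: power2_eq_square)
  ultimately show ?thesis using c_star_bounds(2) by linarith
qed

section \<open>Three pairs with the same quotient\<close>

lemma ecard_gt_2:
  assumes "2 < ecard P"
  obtains p q r where "p \<in> P" "q \<in> P" "r \<in> P" "p \<noteq> q" "p \<noteq> r" "q \<noteq> r"
proof -
  have "\<exists>T\<subseteq>P. card T = 3 \<and> finite T"
  proof (cases "finite P")
    case True
    then have "(2 :: enat) < enat (card P)" using assms by (simp add: ecard_def)
    then have "3 \<le> card P" by (simp add: numeral_eq_enat)
    then show ?thesis using obtain_subset_with_card_n by metis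
  next
    case False
    then show ?thesis using infinite_arbitrarily_large by blast
  qed
  then obtain T where "T \<subseteq> P" "card T = 3" by blast
  then show ?thesis using that unfolding card_3_iff by blast
qed

text \<open>
  Join the indices \<open>i\<close>, \<open>j\<close> of the three pairs \<open>(x\<^sub>i, x\<^sub>i g)\<close> when \<open>x\<^sub>i g = x\<^sub>j\<close> or \<open>x\<^sub>j g = x\<^sub>i\<close>. Two non-adjacent ones can play
  the role of \<open>x\<^sub>2\<close>, \<open>x\<^sub>3\<close>; otherwise the three points form a coset of a subgroup of order 3.
\<close>

lemma Z2c_le:
  assumes V: "V \<subseteq> carrier G"
    and K: "\<And>S C a. S \<subseteq> V \<Longrightarrow> tight_family S C a \<Longrightarrow> 2 * sqrt a \<le> K * test_norm b S C"
    and "K < c_star"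
  shows "Z2c G V \<le> 2"
proof (rule ccontr)
  assume "\<not> Z2c G V \<le> 2"
  then obtain g where g: "g \<in> carrier G" "g \<noteq> \<one>"
    and gt: "2 < ecard {(x, y). x \<in> V \<and> y \<in> V \<and> inv x \<otimes> y = g}"
    unfolding Z2c_def not_le less_SUP_iff by auto
  from gt obtain p q r where pqr: "p \<in> {(x, y). x \<in> V \<and> y \<in> V \<and> inv x \<otimes> y = g}"
    "q \<in> {(x, y). x \<in> V \<and> y \<in> V \<and> inv x \<otimes> y = g}" "r \<in> {(x, y). x \<in> V \<and> y \<in> V \<and> inv x \<otimes> y = g}"
    "p \<noteq> q" "p \<noteq> r" "q \<noteq> r" by (rule ecard_gt_2)
  define x1 x2 x3 where "x1 = fst p" and "x2 = fst q" and "x3 = fst r"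
  have y: "snd s = fst s \<otimes> g" if "s \<in> {(x, y). x \<in> V \<and> y \<in> V \<and> inv x \<otimes> y = g}" for s
    using that V by (auto simp flip: m_assoc simp: subset_iff)
  have xV: "x1 \<in> V" "x2 \<in> V" "x3 \<in> V" "x1 \<otimes> g \<in> V" "x2 \<otimes> g \<in> V" "x3 \<otimes> g \<in> V"
    using pqr y[OF pqr(1)] y[OF pqr(2)] y[OF pqr(3)] by (auto simp: x1_def x2_def x3_def)
  then have x: "x1 \<in> carrier G" "x2 \<in> carrier G" "x3 \<in> carrier G" using V by auto
  \<comment> \<open>A pair is determined by its first entry, so distinct pairs have distinct first
    entries.\<close>
  have ne: "x1 \<noteq> x2" "x1 \<noteq> x3" "x2 \<noteq> x3"
    using pqr(4-6) y[OF pqr(1)] y[OF pqr(2)] y[OF pqr(3)] by (auto simp: x1_def x2_def x3_def prod_eq_iff)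
  note path = path_bound[OF _ _ _ g _ _ _ _ _ _ K]
  have cycle: "c_star \<le> K"
    if c: "u \<in> carrier G" "w \<in> V" "u \<in> V" "t \<in> V" "u \<noteq> t" "u \<otimes> g = w" "w \<otimes> g = t" "t \<otimes> g = u" for u w t
  proof (rule cycle_bound[OF c(1) g(1,2) _ _ _ K])
    have ugg: "u \<otimes> (g \<otimes> g) = t" using c(1,6,7) g by (simp flip: m_assoc)
    then show "g \<otimes> g \<noteq> \<one>" using c(1,5) by auto
    have "u \<otimes> (g \<otimes> g \<otimes> g) = u" using ugg c(1,8) g by (simp flip: m_assoc)
    then show "g \<otimes> g \<otimes> g = \<one>" using c(1) g by simp
    show "{u, u \<otimes> g, u \<otimes> (g \<otimes> g)} \<subseteq> V" using c ugg by simp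
  qed
  have "c_star \<le> K"
  proof (cases "x2 \<otimes> g \<noteq> x3 \<and> x3 \<otimes> g \<noteq> x2")
    case True
    then show ?thesis using x ne xV by (intro path[of x1 x2 x3]) auto
  next
    case 23: False
    show ?thesis
    proof (cases "x1 \<otimes> g \<noteq> x3 \<and> x3 \<otimes> g \<noteq> x1")
      case True
      then show ?thesis using x ne xV by (intro path[of x2 x1 x3]) auto
    next
      case 13: False
      show ?thesis
      proof (cases "x1 \<otimes> g \<noteq> x2 \<and> x2 \<otimes> g \<noteq> x1")
        case True
        then show ?thesis using x ne xV by (intro path[of x3 x1 x2]) auto
      next
        case 12: False
        \<comment> \<open>All three pairs of points are joined now. Right multiplication by g gives
          each point only one successor, so three edges on three points must form an oriented
          cycle.\<close>
        have "(x1 \<otimes> g = x2 \<and> x2 \<otimes> g = x3 \<and> x3 \<otimes> g = x1) \<or> (x1 \<otimes> g = x3 \<and> x3 \<otimes> g = x2 \<and> x2 \<otimes> g = x1)"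
          using 12 13 23 ne by metis
        then show ?thesis using cycle[of x1 x2 x3] cycle[of x1 x3 x2] x xV ne by blast
      qed
    qed
  qed
  then show False using assms(3) by simp
qed

text \<open>Passing to adjoints interchanges the two sums, and both are a times the
  identity.\<close>

lemma tight_family_inv:
  assumes S: "S \<subseteq> carrier G" and tight: "tight_family S C a"
  shows "tight_family ((\<lambda>y. inv y) ` S) (\<lambda>y. mat_adjoint (C (inv y))) a"
proof -
  have inj: "inj_on (\<lambda>y. inv y) S"
    using S by (auto simp: inj_on_def subset_iff)
  have ii: "inv (inv y) = y" if "y \<in> S" for y using that S by auto
  have C: "C y \<in> carrier_mat 2 2" if "y \<in> S" for y using tight that by (simp add: tight_family_def)
  have adj_adj: "mat_adjoint (mat_adjoint (C y)) = C y" if "y \<in> S" for y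
    by (rule eq_matI) (use C[OF that] mat_adjoint_2[OF mat_adjoint_carrier_2[OF C[OF that]]] mat_adjoint_2[OF C[OF that]]
        mat_adjoint_carrier_2[OF mat_adjoint_carrier_2[OF C[OF that]]] in auto)
  have "mat_sum 2 ((\<lambda>y. inv y) ` S) (\<lambda>y. mat_adjoint (mat_adjoint (C (inv y))) * mat_adjoint (C (inv y))) =
      mat_sum 2 S (\<lambda>y. C y * mat_adjoint (C y))"
    unfolding mat_sum_def sum.reindex[OF inj] by (simp add: ii adj_adj cong: sum.cong)
  moreover have "mat_sum 2 ((\<lambda>y. inv y) ` S) (\<lambda>y. mat_adjoint (C (inv y)) * mat_adjoint (mat_adjoint (C (inv y)))) =
      mat_sum 2 S (\<lambda>y. mat_adjoint (C y) * C y)"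
    unfolding mat_sum_def sum.reindex[OF inj] by (simp add: ii adj_adj cong: sum.cong)
  ultimately show ?thesis
    using tight ii mat_adjoint_carrier_2[OF C] unfolding tight_family_def by (simp add: card_image[OF inj])
qed

text \<open>A tight family on a subset of V^-1 becomes, by adjoints and inversion, one supported in
  V. The hypothesis on V, applied to it, is the estimate with the flag set for the original
  family.\<close>

lemma Z2_le:
  assumes V: "V \<subseteq> carrier G" and Kc: "K < c_star"
    and K: "\<And>S C a. S \<subseteq> V \<Longrightarrow> tight_family S C a \<Longrightarrow>
      2 * sqrt a \<le> K * L1_norm G 2 (lambda_sum G 2 S C (\<lambda>y. y))"
  shows "Z2 G V \<le> 2"
proof -
  have "Z2c G V \<le> 2"
    by (rule Z2c_le[OF V _ Kc, of False]) (simp add: test_norm_def K)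
  moreover have "Z2c G ((\<lambda>y. inv y) ` V) \<le> 2"
  proof (rule Z2c_le[OF _ _ Kc, of _ True])
    show "(\<lambda>y. inv y) ` V \<subseteq> carrier G" using V by auto
    fix S C a assume S: "S \<subseteq> (\<lambda>y. inv y) ` V" and tight: "tight_family S C a"
    have SG: "S \<subseteq> carrier G" using S V by auto
    have inj: "inj_on (\<lambda>y. inv y) S"
      using SG by (auto simp: inj_on_def subset_iff)
    have "(\<lambda>y. inv y) ` S \<subseteq> V" using S V by (auto simp: subset_iff)
    then have "2 * sqrt a \<le> K * L1_norm G 2 (lambda_sum G 2 ((\<lambda>y. inv y) ` S) (\<lambda>y. mat_adjoint (C (inv y))) (\<lambda>y. y))"
      by (rule K[OF _ tight_family_inv[OF SG tight]])
    also have "lambda_sum G 2 ((\<lambda>y. inv y) ` S) (\<lambda>y. mat_adjoint (C (inv y))) (\<lambda>y. y) =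
        lambda_sum G 2 S (\<lambda>y. mat_adjoint (C y)) (\<lambda>y. inv y)"
      unfolding lambda_sum_def sum.reindex[OF inj] using SG
      by (intro ext sum.cong) (auto simp: subset_iff)
    finally show "2 * sqrt a \<le> K * test_norm True S C" by (simp add: test_norm_def)
  qed
  ultimately show ?thesis by (simp add: Z2_def Z2r_def)
qed

end

theorem theorem2p5:
  fixes G :: "('a, 'b) monoid_scheme" and V :: "'a set"
  assumes "group G" and "V \<subseteq> carrier G"
  shows "(1.4381696565 \<le> c_star \<and> c_star < 1.4381696566) \<and>
    (A1 G V < ennreal c_star \<longrightarrow> Z2 G V \<le> 2) \<and>
    ((\<exists>K<c_star. \<forall>r::nat. 1 \<le> r \<and> r \<le> 6 \<longrightarrow>
        (\<forall>(g :: nat \<Rightarrow> 'a) (C :: nat \<Rightarrow> complex mat).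
           inj_on g {1..r} \<and> g ` {1..r} \<subseteq> V \<and> (\<forall>m\<in>{1..r}. C m \<in> carrier_mat 2 2) \<longrightarrow>
           S1_norm 2 {1..r} C \<le> K * L1_norm G 2 (lambda_sum G 2 {1..r} C g)))
      \<longrightarrow> Z2 G V \<le> 2)"
proof (intro conjI impI)
  interpret group G by fact
  show "1.4381696565 \<le> c_star" "c_star < 1.4381696566" by (rule c_star_bounds)+
  show "Z2 G V \<le> 2" if A1: "A1 G V < ennreal c_star"
  proof -
    \<comment> \<open>Below c_* the infimum has an admissible constant, which is then used at d =
      2.\<close>
    obtain K where "0 \<le> K" and lt: "ennreal K < ennreal c_star"
      and K: "\<forall>d\<ge>1. \<forall>S C. finite S \<and> S \<subseteq> V \<and> (\<forall>g\<in>S. C g \<in> carrier_mat d d) \<longrightarrow>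
        S1_norm d S C \<le> K * L1_norm G d (lambda_sum G d S C (\<lambda>g. g))"
      using A1 unfolding A1_def Inf_less_iff by (elim bexE CollectE exE conjE) simp
    show ?thesis
    proof (rule Z2_le[OF assms(2)])
      show "K < c_star" using lt \<open>0 \<le> K\<close> by (simp add: ennreal_less_iff)
      fix S C a assume "S \<subseteq> V" and tight: "tight_family S C a"
      then have "S1_norm 2 S C \<le> K * L1_norm G 2 (lambda_sum G 2 S C (\<lambda>g. g))"
        by (intro K[rule_format]) (simp_all add: tight_family_def)
      moreover have "2 * sqrt a \<le> S1_norm 2 S C"
        using tight by (intro S1_norm_ge) (auto simp: tight_family_def)
      ultimately show "2 * sqrt a \<le> K * L1_norm G 2 (lambda_sum G 2 S C (\<lambda>y. y))" by simp
    qed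
  qed
  show "Z2 G V \<le> 2"
    if hyp: "\<exists>K<c_star. \<forall>r::nat. 1 \<le> r \<and> r \<le> 6 \<longrightarrow>
        (\<forall>(g :: nat \<Rightarrow> 'a) (C :: nat \<Rightarrow> complex mat).
           inj_on g {1..r} \<and> g ` {1..r} \<subseteq> V \<and> (\<forall>m\<in>{1..r}. C m \<in> carrier_mat 2 2) \<longrightarrow>
           S1_norm 2 {1..r} C \<le> K * L1_norm G 2 (lambda_sum G 2 {1..r} C g))" (is "\<exists>K<c_star. ?P K")
  proof -
    obtain K where Kc: "K < c_star" and K: "?P K" using hyp by blast
    show ?thesis
    proof (rule Z2_le[OF assms(2) Kc])
      fix S C a assume SV: "S \<subseteq> V" and tight: "tight_family S C a"
      then have S: "finite S" "1 \<le> card S" "card S \<le> 6" and C: "\<forall>y\<in>S. C y \<in> carrier_mat 2 2" and a: "0 < a"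
        and sums: "mat_sum 2 S (\<lambda>y. mat_adjoint (C y) * C y) = of_real a \<cdot>\<^sub>m 1\<^sub>m 2"
          "mat_sum 2 S (\<lambda>y. C y * mat_adjoint (C y)) = of_real a \<cdot>\<^sub>m 1\<^sub>m 2"
        by (auto simp: tight_family_def)
      \<comment> \<open>An enumeration of S without repetition, with r = card S between 1 and 6; all
        sums are invariant under this reindexing.\<close>
      obtain h where h: "bij_betw h {1..card S} S"
        using ex_bij_betw_nat_finite_1[OF S(1)] by blast
      have Ch: "\<forall>m\<in>{1..card S}. C (h m) \<in> carrier_mat 2 2"
        using C bij_betwE[OF h] by blast
      have "S1_norm 2 {1..card S} (\<lambda>m. C (h m)) \<le> K * L1_norm G 2 (lambda_sum G 2 {1..card S} (\<lambda>m. C (h m)) h)"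
        by (rule K[rule_format])
          (use S Ch SV bij_betw_imp_inj_on[OF h] bij_betw_imp_surj_on[OF h] in simp_all)
      also have "lambda_sum G 2 {1..card S} (\<lambda>m. C (h m)) h = lambda_sum G 2 S C (\<lambda>y. y)"
        unfolding lambda_sum_def
        by (rule ext, rule ext) (rule sum.reindex_bij_betw[OF h, of "\<lambda>y. mat_tensor 2 (C y) (left_regular G y) _ _"])
      finally have le: "S1_norm 2 {1..card S} (\<lambda>m. C (h m)) \<le> K * L1_norm G 2 (lambda_sum G 2 S C (\<lambda>y. y))" .
      have re: "mat_sum 2 {1..card S} (\<lambda>m. X (h m)) = mat_sum 2 S X" for X
        unfolding mat_sum_def
        by (rule arg_cong[where f = "Matrix.mat 2 2"], rule ext, rule sum.reindex_bij_betw[OF h, of "\<lambda>m. X m $$ _"])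
      have "2 * sqrt a \<le> S1_norm 2 {1..card S} (\<lambda>m. C (h m))"
        by (rule S1_norm_ge[OF Ch a])
          (use sums re[of "\<lambda>y. mat_adjoint (C y) * C y"] re[of "\<lambda>y. C y * mat_adjoint (C y)"] in simp_all)
      then show "2 * sqrt a \<le> K * L1_norm G 2 (lambda_sum G 2 S C (\<lambda>y. y))"
        using le by (rule order_trans)
    qed
  qed
qed

end
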